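(* Let $d\ge 1$ and let $\Omega\subset\mathbb{R}^d$ be a bounded domain with Lipschitz boundary. Let $s>0$ and let either $q=1$ and $s>\frac{q(d-2)}{2d}$, or $q>1$ and $s\ge\frac{q(d-2)}{2d}$. Then there exists a constant $C(q,s)>0$, only depending on $\Omega$, $d$, $q$, $s$, such that for all nonnegative functions $g$ with $g\in L^q(\Omega)$ and $\nabla (g^s)\in L^2(\Omega)$, $$\int_\Omega\eta_q(g|\bar g)\,dx\le C(q,s)\,\|g\|_{L^q(\Omega)}^{q-2s}\int_\Omega|\nabla (g^s)|^2\,dx .$$
   Context: Here $\bar g=\frac{1}{|\Omega|}\int_\Omega g\,dx$ and $$\eta_1(g|\bar g)=g\log\frac{g}{\bar g},\qquad \eta_q(g|\bar g)=\frac{g^q-\bar g^q}{q-1}\quad\text{for } q>1,$$ with the convention that $g\log(g/\bar g)=0$ where $g=0$. Gradients are weak gradients. For $g\equiv 0$ both sides of the inequality are understood to be zero. *)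

theory Defs
  imports "HOL-Analysis.Analysis"
begin

(* The half-space description in rotated coordinates: v is the vertical direction, the hyperplane
   orthogonal to v carries the horizontal variables, and inside a ball around the boundary point
   the set is the strict epigraph of a Lipschitz function. For DIM('a) = 1 the hyperplane is {0}
   and gamma is a constant. *)
definition lipschitz_boundary :: "'a::euclidean_space set \<Rightarrow> bool" where
  "lipschitz_boundary \<Omega> \<longleftrightarrow>
    (\<forall>p \<in> frontier \<Omega>. \<exists>r>0. \<exists>v \<gamma> L. norm v = 1 \<and> L-lipschitz_on {z. z \<bullet> v = 0} \<gamma> \<and>
      \<Omega> \<inter> ball p r = {y \<in> ball p r. \<gamma> (y - (y \<bullet> v) *\<^sub>R v) < (y \<bullet> v :: real)})"

definition bounded_lipschitz_domain :: "'a::euclidean_space set \<Rightarrow> bool" where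
  "bounded_lipschitz_domain \<Omega> \<longleftrightarrow>
    open \<Omega> \<and> connected \<Omega> \<and> \<Omega> \<noteq> {} \<and> bounded \<Omega> \<and> lipschitz_boundary \<Omega>"

(* Membership in the Lebesgue space of exponent p, for 0 < p < infinity. *)
definition in_Lp :: "'a::euclidean_space set \<Rightarrow> real \<Rightarrow>
    ('a \<Rightarrow> 'b::{banach, second_countable_topology}) \<Rightarrow> bool" where
  "in_Lp \<Omega> p f \<longleftrightarrow> f \<in> borel_measurable (lebesgue_on \<Omega>) \<and>
    integrable (lebesgue_on \<Omega>) (\<lambda>x. norm (f x) powr p)"

definition Lp_norm :: "'a::euclidean_space set \<Rightarrow> real \<Rightarrow>
    ('a \<Rightarrow> 'b::{banach, second_countable_topology}) \<Rightarrow> real" where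
  "Lp_norm \<Omega> p f = (LINT x|lebesgue_on \<Omega>. norm (f x) powr p) powr (1 / p)"

definition loc_integrable :: "'a::euclidean_space set \<Rightarrow>
    ('a \<Rightarrow> 'b::{banach, second_countable_topology}) \<Rightarrow> bool" where
  "loc_integrable \<Omega> f \<longleftrightarrow> (\<forall>K. compact K \<and> K \<subseteq> \<Omega> \<longrightarrow> integrable (lebesgue_on K) f)"

abbreviation partial_deriv :: "'a \<Rightarrow> ('a::euclidean_space \<Rightarrow> real) \<Rightarrow> 'a \<Rightarrow> real" where
  "partial_deriv b f x \<equiv> frechet_derivative f (at x) b"

primrec Ck :: "nat \<Rightarrow> ('a::euclidean_space \<Rightarrow> real) \<Rightarrow> bool" where
  "Ck 0 f \<longleftrightarrow> continuous_on UNIV f"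
| "Ck (Suc k) f \<longleftrightarrow> (\<forall>x. f differentiable (at x)) \<and> (\<forall>b\<in>Basis. Ck k (partial_deriv b f))"

(* Smooth functions with compact support in \<Omega>, extended by zero to the whole space. *)
definition test_function :: "'a::euclidean_space set \<Rightarrow> ('a \<Rightarrow> real) \<Rightarrow> bool" where
  "test_function \<Omega> \<phi> \<longleftrightarrow> (\<forall>k. Ck k \<phi>) \<and>
    compact (closure {x. \<phi> x \<noteq> 0}) \<and> closure {x. \<phi> x \<noteq> 0} \<subseteq> \<Omega>"

(* G is a representative of the weak gradient of u; it is determined up to null sets. *)
definition weak_gradient :: "'a::euclidean_space set \<Rightarrow> ('a \<Rightarrow> real) \<Rightarrow> ('a \<Rightarrow> 'a) \<Rightarrow> bool" where
  "weak_gradient \<Omega> u G \<longleftrightarrow> loc_integrable \<Omega> u \<and> loc_integrable \<Omega> G \<and>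
    (\<forall>\<phi>. test_function \<Omega> \<phi> \<longrightarrow> (\<forall>b\<in>Basis.
      (LINT x|lebesgue_on \<Omega>. u x * partial_deriv b \<phi> x) =
      - (LINT x|lebesgue_on \<Omega>. (G x \<bullet> b) * \<phi> x)))"

definition mean_value :: "'a::euclidean_space set \<Rightarrow> ('a \<Rightarrow> real) \<Rightarrow> real" where
  "mean_value \<Omega> g = (1 / measure lebesgue \<Omega>) * (LINT x|lebesgue_on \<Omega>. g x)"

(* In the case q = 1 the convention 0 * log 0 = 0 holds automatically for real multiplication. *)
definition eta :: "real \<Rightarrow> real \<Rightarrow> real \<Rightarrow> real" where
  "eta q g m = (if q = 1 then g * ln (g / m) else (g powr q - m powr q) / (q - 1))"

end

theory Submission
  imports Defs
begin

text \<open>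
Put \<open>u = g powr s\<close> and \<open>p = q / s\<close>. The inequality follows from the Poincare-Sobolev inequality
\<open>\<parallel>u - c\<parallel> \<le> C \<parallel>\<nabla>u\<parallel>\<close>, with \<open>L\<close> of order \<open>r\<close> on the left and \<open>L\<close> of order \<open>2\<close> on the right, for an
exponent \<open>r \<ge> max 2 p\<close> (and \<open>r > p\<close> if \<open>q = 1\<close>). The hypothesis on \<open>s\<close> says that such an \<open>r\<close> exists
(\<open>sobolev_exponent_exists\<close>).

Entropy. By homogeneity the norm of \<open>g\<close> may be taken to be \<open>1\<close>. Let \<open>D\<close> be a multiple of the norm of the
gradient of \<open>u\<close>. The mean minimises the integrated Bregman divergence, so the entropy is at most the
integral of the divergence of \<open>g\<close> from \<open>c powr (1/s)\<close> (\<open>entropy_le_bregman\<close>). If \<open>D\<close> is small, then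
\<open>c\<close> is comparable to a constant, the divergence is bounded by \<open>(u - c)\<^sup>2\<close> plus the power \<open>r\<close> of
\<open>\<bar>u - c\<bar>\<close>, and the Poincare-Sobolev inequality gives order \<open>D\<^sup>2\<close> (\<open>entropy_le_small_osc\<close>). If \<open>D\<close>
is not small, the entropy is bounded for \<open>q > 1\<close> and grows logarithmically in \<open>D\<close> for \<open>q = 1\<close>, which
is again at most of order \<open>D\<^sup>2\<close>.

Poincare-Sobolev inequality. It is proved for smooth functions on a set that is star-shaped with
respect to a ball. Along a segment from a point with a large value to a point with a small one, a
truncation of the function must drop; integrating over all such pairs of points and changing
variables gives a weak-type estimate for each dyadic layer of values (\<open>segment_transport\<close>,
\<open>level_set_isoperimetry\<close>), and Maz'ya's summation over the layers turns these estimates into the strong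
inequality with the critical exponent (\<open>dyadic_level_sum\<close>, \<open>poincare_sobolev_smooth\<close>). Mollification on
slightly contracted copies of the star-shaped set extends it to weak gradients
(\<open>poincare_on_star_shaped\<close>). Finally, a bounded Lipschitz domain is a finite union of star-shaped pieces
(\<open>lipschitz_domain_star_piece\<close>), and since the domain is connected, the inequalities on overlapping
pieces can be glued together (\<open>poincare_on_connected_union\<close>).
\<close>

section \<open>Elementary inequalities for powers\<close>

lemma powr_add_le:
  fixes a b p :: real
  assumes "0 \<le> a" "0 \<le> b" "0 < p"
  shows "(a + b) powr p \<le> 2 powr p * (a powr p + b powr p)"
proof -
  have "(a + b) powr p \<le> (2 * max a b) powr p"
    using assms by (intro powr_mono2) auto
  also have "\<dots> = 2 powr p * (max a b) powr p" by (simp add: powr_mult)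
  also have "\<dots> \<le> 2 powr p * (a powr p + b powr p)"
    by (intro mult_left_mono) (auto simp: max_def)
  finally show ?thesis .
qed

lemma abs_powr_add_le:
  fixes a b p :: real
  assumes "0 < p"
  shows "\<bar>a + b\<bar> powr p \<le> 2 powr p * (\<bar>a\<bar> powr p + \<bar>b\<bar> powr p)"
proof -
  have "\<bar>a + b\<bar> powr p \<le> (\<bar>a\<bar> + \<bar>b\<bar>) powr p" using assms by (intro powr_mono2) auto
  also have "\<dots> \<le> 2 powr p * (\<bar>a\<bar> powr p + \<bar>b\<bar> powr p)"
    using assms by (intro powr_add_le) auto
  finally show ?thesis .
qed

text \<open>
Below the level \<open>\<tau>\<close> the power \<open>p\<close> is bounded by its value at \<open>\<tau>\<close>, above it the larger power \<open>r\<close>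
dominates. This replaces Hoelder's inequality whenever an integral of a lower power has to be
controlled by one of a higher power on a set of finite measure.
\<close>

lemma powr_interpolate:
  fixes x \<tau> p r :: real
  assumes "0 < p" "p \<le> r" "0 < \<tau>" "0 \<le> x"
  shows "x powr p \<le> \<tau> powr p + \<tau> powr (p - r) * x powr r"
proof (cases "x \<le> \<tau>")
  case True
  then have "x powr p \<le> \<tau> powr p" using assms by (intro powr_mono2) auto
  then show ?thesis by (smt (verit) mult_nonneg_nonneg powr_ge_zero)
next
  case False
  then have "0 < x" using assms by simp
  then have "x powr p = x powr (p - r) * x powr r" by (simp add: powr_add[symmetric])
  also have "\<dots> \<le> \<tau> powr (p - r) * x powr r"
    using False assms by (intro mult_right_mono powr_mono2') auto
  finally show ?thesis by (smt (verit) powr_ge_zero)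
qed

section \<open>The relative entropy as a Bregman divergence\<close>

lemma quadratic_bound_at_critical_point:
  fixes \<phi> \<phi>' \<phi>'' :: "real \<Rightarrow> real"
  assumes d1: "\<And>x. x \<in> {a..b} \<Longrightarrow> (\<phi> has_real_derivative \<phi>' x) (at x)"
    and d2: "\<And>x. x \<in> {a..b} \<Longrightarrow> (\<phi>' has_real_derivative \<phi>'' x) (at x)"
    and cont: "continuous_on {a..b} \<phi>''" and x0: "x0 \<in> {a..b}"
    and zero: "\<phi> x0 = 0" "\<phi>' x0 = 0"
  shows "\<exists>K\<ge>0. \<forall>z\<in>{a..b}. \<phi> z \<le> K * (z - x0)\<^sup>2"
proof -
  have "compact (\<phi>'' ` {a..b})" by (intro compact_continuous_image cont) auto
  then obtain K where K: "\<And>x. x \<in> {a..b} \<Longrightarrow> norm (\<phi>'' x) \<le> K"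
    by (meson compact_imp_bounded bounded_iff image_eqI)
  have K0: "K \<ge> 0" using K[OF x0] by (smt (verit) norm_ge_zero)
  have A: "norm (\<phi>' z) \<le> K * \<bar>z - x0\<bar>" if "z \<in> {a..b}" for z
    using field_differentiable_bound[of "{a..b}" \<phi>' \<phi>'' K z x0] K d2 that zero x0
    by (auto intro: has_field_derivative_at_within)
  have "\<phi> z \<le> K * (z - x0)\<^sup>2" if z: "z \<in> {a..b}" for z
  proof -
    have seg: "closed_segment x0 z \<subseteq> {a..b}"
      using z x0 by (intro closed_segment_subset) auto
    have "norm (\<phi> z - \<phi> x0) \<le> (K * \<bar>z - x0\<bar>) * norm (z - x0)"
    proof (rule field_differentiable_bound[of "closed_segment x0 z" \<phi> \<phi>'])
      fix w assume w: "w \<in> closed_segment x0 z"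
      then show "(\<phi> has_field_derivative \<phi>' w) (at w within closed_segment x0 z)"
        using d1[of w] seg by (blast intro: has_field_derivative_at_within)
      have "\<bar>w - x0\<bar> \<le> \<bar>z - x0\<bar>" 
        using w by (auto simp: closed_segment_eq_real_ivl split: if_splits)
      then show "norm (\<phi>' w) \<le> K * \<bar>z - x0\<bar>"
        using A[of w] w seg K0 by (smt (verit) mult_left_mono subsetD)
    qed auto
    then show ?thesis using zero by (simp add: power2_eq_square abs_mult_self_eq mult.assoc)
  qed
  then show ?thesis using K0 by blast
qed

text \<open>
The Bregman divergence from \<open>1\<close> of the convex function behind \<open>eta q\<close>, namely \<open>x ln x\<close> for \<open>q = 1\<close>
and \<open>x powr q / (q - 1)\<close> for \<open>q > 1\<close>. By homogeneity \<open>m powr q * bregman q (y / m)\<close> is the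
divergence of \<open>y\<close> from \<open>m\<close>.
\<close>

definition bregman :: "real \<Rightarrow> real \<Rightarrow> real" where
  "bregman q x = (if q = 1 then x * ln x - x + 1 else (x powr q - 1 - q * (x - 1)) / (q - 1))"

lemma bregman_nonneg:
  assumes "q \<ge> 1" "x \<ge> 0"
  shows "bregman q x \<ge> 0"
proof (cases "x = 0")
  case True then show ?thesis using assms by (simp add: bregman_def)
next
  case False
  then have x: "x > 0" using assms by simp
  have tangent: "ln z \<ge> 1 - 1 / z" if "z > 0" for z :: real
    using ln_le_minus_one[of "1/z"] that by (simp add: ln_div)
  show ?thesis
  proof (cases "q = 1")
    case True
    have "x * ln x \<ge> x * (1 - 1 / x)" using tangent[OF x] x by (intro mult_left_mono) auto
    then show ?thesis using True x by (simp add: bregman_def algebra_simps)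
  next
    case False
    then have q: "q > 1" using assms by simp
    have "(x powr q) powr (1/q) * 1 powr (1 - 1/q) \<le> (1/q) * x powr q + (1 - 1/q) * 1"
      using q x by (intro Youngs_inequality_0) auto
    then have "x \<le> (1/q) * x powr q + (1 - 1/q)"
      using q x by (simp add: powr_powr)
    then have "q * x \<le> q * ((1/q) * x powr q + (1 - 1/q))"
      using q by (intro mult_left_mono) auto
    also have "\<dots> = x powr q + (q - 1)"
      using q by (simp add: field_simps)
    finally have "q * x \<le> x powr q + (q - 1)" .
    then show ?thesis using q by (simp add: bregman_def field_simps)
  qed
qed

text \<open>
A Bregman divergence vanishes to second order at its base point, and \<open>z \<mapsto> z powr (1/s)\<close> is smooth
near \<open>1\<close>, so substituting it keeps the quadratic behaviour.
\<close>

lemma bregman_near_one: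
  assumes "s > 0" "q \<ge> 1"
  shows "\<exists>K\<ge>0. \<forall>z\<in>{1/2..2}. bregman q (z powr (1/s)) \<le> K * (z - 1)\<^sup>2"
proof (cases "q = 1")
  case True
  define p where "p = 1 / s"
  have e: "bregman q (z powr (1/s)) = p * (z powr p * ln z) - z powr p + 1" for z
    using True by (simp add: bregman_def p_def)
  show ?thesis unfolding e
  proof (rule quadratic_bound_at_critical_point[where \<phi>' = "\<lambda>z. p * p * (z powr (p - 1) * ln z)"
        and \<phi>'' = "\<lambda>z. p * p * ((p - 1) * z powr (p - 2) * ln z + z powr (p - 2))"])
    fix x :: real assume "x \<in> {1/2..2}"
    then have x: "x > 0" by simp
    have a: "x powr p = x * x powr (p - 1)" "x powr (p - 1) = x * x powr (p - 2)"
      using powr_mult_base[of x "p - 1"] powr_mult_base[of x "p - 2"] x by auto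
    show "((\<lambda>z. p * (z powr p * ln z) - z powr p + 1) has_real_derivative p * p * (x powr (p - 1) * ln x)) (at x)"
      using x by (auto intro!: derivative_eq_intros simp: a(1) field_simps)
    show "((\<lambda>z. p * p * (z powr (p - 1) * ln z)) has_real_derivative
       p * p * ((p - 1) * x powr (p - 2) * ln x + x powr (p - 2))) (at x)"
      using x by (auto intro!: derivative_eq_intros simp: a(2) field_simps)
  qed (auto intro!: continuous_intros)
next
  case False
  then have q: "q > 1" using assms by simp
  define p where "p = q / s"
  define m where "m = 1 / s"
  have pm: "p = q * m" by (simp add: p_def m_def)
  have e: "bregman q (z powr (1/s)) = (z powr p - 1 - q * (z powr m - 1)) / (q - 1)" for z
    using False by (simp add: bregman_def p_def m_def powr_powr)
  show ?thesis unfolding e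
  proof (rule quadratic_bound_at_critical_point[where \<phi>' = "\<lambda>z. p * (z powr (p - 1) - z powr (m - 1)) / (q - 1)"
        and \<phi>'' = "\<lambda>z. p * ((p - 1) * z powr (p - 2) - (m - 1) * z powr (m - 2)) / (q - 1)"])
    fix x :: real assume "x \<in> {1/2..2}"
    then have x: "x > 0" by simp
    have "((\<lambda>z. z powr p - 1 - q * (z powr m - 1)) has_real_derivative p * (x powr (p - 1) - x powr (m - 1))) (at x)"
      using x by (auto intro!: derivative_eq_intros simp: pm field_simps)
    then show "((\<lambda>z. (z powr p - 1 - q * (z powr m - 1)) / (q - 1)) has_real_derivative p * (x powr (p - 1) - x powr (m - 1)) / (q - 1)) (at x)"
      by (rule DERIV_cdivide)
    have "((\<lambda>z. p * (z powr (p - 1) - z powr (m - 1))) has_real_derivative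
       p * ((p - 1) * x powr (p - 2) - (m - 1) * x powr (m - 2))) (at x)"
      using x by (auto intro!: derivative_eq_intros simp: field_simps)
    then show "((\<lambda>z. p * (z powr (p - 1) - z powr (m - 1)) / (q - 1)) has_real_derivative
       p * ((p - 1) * x powr (p - 2) - (m - 1) * x powr (m - 2)) / (q - 1)) (at x)"
      by (rule DERIV_cdivide)
  qed (use q in \<open>auto intro!: continuous_intros\<close>)
qed

text \<open>
Away from \<open>z = 1\<close> only growth matters: near \<open>0\<close> the divergence is bounded, while for large \<open>z\<close> it
grows like \<open>z powr (q/s)\<close>, with an additional logarithm if \<open>q = 1\<close>. The logarithm is what makes the
strict inequality \<open>q / s < r\<close> necessary in that case.
\<close>

lemma bregman_away_from_one:
  assumes s: "s > 0" and r: "(q = 1 \<and> r > q / s) \<or> (q > 1 \<and> r \<ge> q / s)"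
  shows "\<exists>K\<ge>0. \<forall>z\<ge>0. z \<notin> {1/2..2} \<longrightarrow>
    bregman q (z powr (1/s)) \<le> K * ((z - 1)\<^sup>2 + \<bar>z - 1\<bar> powr r)"
proof -
  define p where "p = q / s"
  have q: "q \<ge> 1" using r by auto
  have p: "p > 0" using s q by (simp add: p_def)
  moreover have "p \<le> r" using r by (auto simp: p_def)
  ultimately have r0: "r > 0" by simp
  have small: "\<exists>K\<ge>0. \<forall>z\<in>{0..1/2}. bregman q (z powr (1/s)) \<le> K"
  proof (cases "q = 1")
    case True
    have xlnx: "y * ln y \<le> 0" if "0 \<le> y" "y \<le> 1" for y :: real
      using that by (cases "y = 0") (auto simp: mult_nonneg_nonpos)
    have "bregman q (z powr (1/s)) \<le> 1" if "z \<in> {0..1/2}" for z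
    proof -
      have "z powr (1/s) \<le> 1" using that s by (intro powr_le1) auto
      then have "z powr (1/s) * ln (z powr (1/s)) \<le> 0"
        using xlnx[of "z powr (1/s)"] by simp
      then show ?thesis using True powr_ge_zero[of z "1/s"]
        by (simp add: bregman_def del: powr_ge_zero)
    qed
    then show ?thesis by (meson zero_le_one)
  next
    case False
    then have q1: "q > 1" using q by simp
    have "bregman q (z powr (1/s)) \<le> q / (q - 1)" if "z \<in> {0..1/2}" for z
    proof -
      have "z powr (1/s) \<le> 1" "(z powr (1/s)) powr q \<le> 1" "0 \<le> z powr (1/s)"
        using that s q by (auto intro!: powr_le1)
      moreover from this(3) have "0 \<le> q * z powr (1/s)" using q by simp
      ultimately have "(z powr (1/s)) powr q - 1 - q * (z powr (1/s) - 1) \<le> q"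
        by (simp add: right_diff_distrib)
      then have "((z powr (1/s)) powr q - 1 - q * (z powr (1/s) - 1)) / (q - 1) \<le> q / (q - 1)"
        using q1 by (intro divide_right_mono) auto
      then show ?thesis using False by (simp only: bregman_def if_False)
    qed
    then show ?thesis using q1 by (intro exI[of _ "q/(q-1)"]) auto
  qed
  then obtain K1 where K1: "K1 \<ge> 0" "\<And>z. z \<in> {0..1/2} \<Longrightarrow> bregman q (z powr (1/s)) \<le> K1" by auto
  have large: "\<exists>K\<ge>0. \<forall>z>2. bregman q (z powr (1/s)) \<le> K * z powr r"
  proof (cases "q = 1")
    case True
    have pr: "r > p" using r True by (auto simp: p_def)
    have "bregman q (z powr (1/s)) \<le> (p / (r - p)) * z powr r" if "z > 2" for z
    proof -
      have "z powr p \<ge> 1" using that p by (intro ge_one_powr_ge_zero) auto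
      then have "bregman q (z powr (1/s)) \<le> p * (z powr p * ln z)"
        using True by (simp add: bregman_def p_def)
      also have "\<dots> \<le> p * (z powr p * (z powr (r - p) / (r - p)))"
        using that pr p by (intro mult_left_mono ln_powr_bound) auto
      also have "\<dots> = (p / (r - p)) * z powr r"
        using that by (simp add: powr_add[symmetric])
      finally show ?thesis .
    qed
    then show ?thesis using pr p by (intro exI[of _ "p/(r-p)"]) auto
  next
    case False
    then have q1: "q > 1" and pr: "r \<ge> p" using q r by (auto simp: p_def)
    have "bregman q (z powr (1/s)) \<le> (1 / (q - 1)) * z powr r" if "z > 2" for z
    proof -
      have "z powr (1/s) \<ge> 1" using that s by (intro ge_one_powr_ge_zero) auto
      then have "0 \<le> q * (z powr (1/s) - 1)" using q by simp
      then have "bregman q (z powr (1/s)) \<le> z powr p / (q - 1)"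
        using q1 by (simp add: bregman_def p_def powr_powr divide_right_mono)
      also have "\<dots> \<le> z powr r / (q - 1)" 
        using q1 pr that by (intro divide_right_mono powr_mono) auto
      finally show ?thesis by simp
    qed
    then show ?thesis using q1 by (intro exI[of _ "1/(q-1)"]) auto
  qed
  then obtain K2 where K2: "K2 \<ge> 0" "\<And>z. z > 2 \<Longrightarrow> bregman q (z powr (1/s)) \<le> K2 * z powr r" by auto
  define K where "K = 4 * K1 + K2 * 2 powr r"
  have "bregman q (z powr (1/s)) \<le> K * ((z - 1)\<^sup>2 + \<bar>z - 1\<bar> powr r)" if z: "z \<ge> 0" "z \<notin> {1/2..2}" for z
  proof (cases "z < 1/2")
    case True
    then have "(1 - z) * (1 - z) \<ge> (1/2) * (1/2)" by (intro mult_mono) auto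
    then have "4 * (z - 1)\<^sup>2 \<ge> 1" by (simp add: power2_eq_square algebra_simps)
    then have "K1 * 1 \<le> K1 * (4 * (z - 1)\<^sup>2)" using K1 by (intro mult_left_mono) auto
    moreover have "bregman q (z powr (1/s)) \<le> K1" using K1 z True by auto
    moreover have "0 \<le> K2 * 2 powr r * (z - 1)\<^sup>2" "0 \<le> K * \<bar>z - 1\<bar> powr r"
      using K1 K2 by (auto simp: K_def)
    ultimately show ?thesis by (simp add: K_def algebra_simps)
  next
    case False
    then have z2: "z > 2" using z by auto
    have "z powr r \<le> (2 * \<bar>z - 1\<bar>) powr r" using z2 r0 by (intro powr_mono2) auto
    then have "K2 * z powr r \<le> K2 * (2 powr r * \<bar>z - 1\<bar> powr r)"
      using K2 by (intro mult_left_mono) (auto simp: powr_mult)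
    moreover have "bregman q (z powr (1/s)) \<le> K2 * z powr r" using K2 z2 by auto
    moreover have "0 \<le> K * (z - 1)\<^sup>2" "0 \<le> 4 * K1 * \<bar>z - 1\<bar> powr r"
      using K1 K2 by (auto simp: K_def)
    ultimately show ?thesis by (simp add: K_def algebra_simps)
  qed
  moreover have "K \<ge> 0" using K1 K2 by (simp add: K_def)
  ultimately show ?thesis by blast
qed

lemma bregman_upper_bound:
  assumes s: "s > 0" and r: "(q = 1 \<and> r > q / s) \<or> (q > 1 \<and> r \<ge> q / s)"
  shows "\<exists>K\<ge>0. \<forall>z\<ge>0. bregman q (z powr (1/s)) \<le> K * ((z - 1)\<^sup>2 + \<bar>z - 1\<bar> powr r)"
proof -
  obtain K1 where K1: "K1 \<ge> 0" "\<And>z. z\<in>{1/2..2} \<Longrightarrow> bregman q (z powr (1/s)) \<le> K1 * (z - 1)\<^sup>2"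
    using bregman_near_one[of s q] assms by auto
  obtain K2 where K2: "K2 \<ge> 0" "\<And>z. z \<ge> 0 \<Longrightarrow> z \<notin> {1/2..2} \<Longrightarrow> 
    bregman q (z powr (1/s)) \<le> K2 * ((z - 1)\<^sup>2 + \<bar>z - 1\<bar> powr r)"
    using bregman_away_from_one[OF assms] by blast
  have "bregman q (z powr (1/s)) \<le> (K1 + K2) * ((z - 1)\<^sup>2 + \<bar>z - 1\<bar> powr r)" if "z \<ge> 0" for z
  proof (cases "z \<in> {1/2..2}")
    case True
    have "0 \<le> K2 * ((z - 1)\<^sup>2 + \<bar>z - 1\<bar> powr r)" "0 \<le> K1 * \<bar>z - 1\<bar> powr r" using K1 K2 by auto
    then show ?thesis using K1(2)[OF True] by (simp add: algebra_simps)
  next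
    case False
    have "0 \<le> K1 * ((z - 1)\<^sup>2 + \<bar>z - 1\<bar> powr r)" using K1 by auto
    then show ?thesis using K2(2)[OF that False] by (simp add: algebra_simps)
  qed
  then show ?thesis using K1 K2 by (intro exI[of _ "K1+K2"]) auto
qed

text \<open>
Changing the base point of a Bregman divergence changes it by an affine function only, and
\<open>eta q y h\<close> is itself the divergence of \<open>y\<close> from \<open>h\<close> up to an affine function.
\<close>

lemma bregman_eq_eta_plus_affine:
  assumes "q \<ge> 1" "m > 0" "h > 0"
  shows "\<exists>\<alpha> \<beta>. \<forall>y\<ge>0. m powr q * bregman q (y / m) = eta q y h + (\<alpha> + \<beta> * y)"
proof (cases "q = 1")
  case True
  have "m powr q * bregman q (y / m) = eta q y h + (m + (ln (h / m) - 1) * y)" if "y \<ge> 0" for y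
    using that assms True
    by (cases "y = 0") (auto simp: bregman_def eta_def ln_div algebra_simps)
  then show ?thesis by blast
next
  case False
  then have q: "q > 1" using assms by simp
  have "m powr q * bregman q (y / m) = eta q y h +
      ((h powr q - m powr q + q * m powr q) / (q - 1) + (- q * m powr q / m / (q - 1)) * y)" if "y \<ge> 0" for y
  proof -
    have "m powr q * ((y / m) powr q - 1 - q * (y / m - 1)) =
      (y powr q - h powr q) + ((h powr q - m powr q + q * m powr q) + (- q * m powr q / m) * y)"
      using assms by (simp add: powr_divide right_diff_distrib)
    then have "m powr q * bregman q (y / m) =
      ((y powr q - h powr q) + ((h powr q - m powr q + q * m powr q) + (- q * m powr q / m) * y)) / (q - 1)"
      using False by (simp only: bregman_def if_False times_divide_eq_right)
    then show ?thesis
      using False by (simp only: eta_def if_False add_divide_distrib times_divide_eq_left)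
  qed
  then show ?thesis by blast
qed

section \<open>Entropy of a function whose power is nearly constant\<close>

text \<open>
The normalised situation: the \<open>q\<close>-th power of \<open>g\<close> has integral \<open>1\<close>, and \<open>g powr s\<close> is within \<open>D\<close> of
the constant \<open>c\<close> in \<open>L\<close> of order \<open>r\<close>. Here \<open>D\<close> stands for a multiple of the norm of the gradient of
\<open>g powr s\<close>, and the assumption on \<open>osc\<close> is what the Poincare-Sobolev inequality provides.
\<close>

locale near_constant_power = finite_measure M for M :: "'a measure" +
  fixes q s r c D :: real and g :: "'a \<Rightarrow> real"
  assumes mass: "0 < measure M (space M)"
    and s: "0 < s" and r: "2 \<le> r" "(q = 1 \<and> q / s < r) \<or> (1 < q \<and> q / s \<le> r)"
    and g: "g \<in> borel_measurable M" "\<And>x. 0 \<le> g x"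
    and gq: "integrable M (\<lambda>x. g x powr q)" "(\<integral>x. g x powr q \<partial>M) = 1"
    and cD: "0 \<le> c" "0 < D"
    and osc: "integrable M (\<lambda>x. \<bar>g x powr s - c\<bar> powr r)"
      "(\<integral>x. \<bar>g x powr s - c\<bar> powr r \<partial>M) \<le> D powr r"
begin

abbreviation "\<mu> \<equiv> measure M (space M)"
abbreviation "p \<equiv> q / s"
abbreviation "avg \<equiv> (\<integral>x. g x \<partial>M) / \<mu>"

declare g(1) [measurable]

lemma q: "1 \<le> q" using r by auto

lemma p: "0 < p" "p \<le> r" using s q r by auto

lemma power_gs: "(g x powr s) powr p = g x powr q"
  using s by (simp add: powr_powr)

lemma g_integrable: "integrable M g"
proof (rule Bochner_Integration.integrable_bound)
  show "integrable M (\<lambda>x. 1 + g x powr q)" using gq by simp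
  show "AE x in M. norm (g x) \<le> norm (1 + g x powr q)"
  proof (rule AE_I2)
    fix x
    have "g x \<le> 1 + g x powr q"
    proof (cases "g x \<le> 1")
      case False
      then have "g x powr 1 \<le> g x powr q" using q by (intro powr_mono) auto
      then show ?thesis using False by simp
    qed (smt (verit) powr_ge_zero)
    then show "norm (g x) \<le> norm (1 + g x powr q)" using g(2)[of x] by simp
  qed
qed (rule g)

lemma avg_pos: "0 < avg"
proof -
  have "(\<integral>x. g x \<partial>M) \<noteq> 0"
  proof
    assume "(\<integral>x. g x \<partial>M) = 0"
    then have "AE x in M. g x = 0"
      using integral_nonneg_eq_0_iff_AE[OF g_integrable] g by auto
    then have "AE x in M. g x powr q = 0" by auto
    then have "(\<integral>x. g x powr q \<partial>M) = 0" by (rule integral_eq_zero_AE)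
    then show False using gq by simp
  qed
  moreover have "(\<integral>x. g x \<partial>M) \<ge> 0" using g by simp
  ultimately show ?thesis using mass by simp
qed

lemma osc_lower_power:
  assumes e: "0 < e" "e \<le> r"
  shows "integrable M (\<lambda>x. \<bar>g x powr s - c\<bar> powr e)"
    "(\<integral>x. \<bar>g x powr s - c\<bar> powr e \<partial>M) \<le> (\<mu> + 1) * D powr e"
proof -
  let ?h = "\<lambda>x. D powr e + D powr (e - r) * \<bar>g x powr s - c\<bar> powr r"
  have le: "\<bar>g x powr s - c\<bar> powr e \<le> ?h x" for x
    using powr_interpolate[of e r D "\<bar>g x powr s - c\<bar>"] e cD by simp
  have h: "integrable M ?h" using osc by simp
  show i: "integrable M (\<lambda>x. \<bar>g x powr s - c\<bar> powr e)"
    by (rule Bochner_Integration.integrable_bound[OF h]) (use le in \<open>auto intro: order_trans\<close>)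
  have "(\<integral>x. \<bar>g x powr s - c\<bar> powr e \<partial>M) \<le> (\<integral>x. ?h x \<partial>M)"
    using le by (intro integral_mono i h) auto
  also have "\<dots> = D powr e * \<mu> + D powr (e - r) * (\<integral>x. \<bar>g x powr s - c\<bar> powr r \<partial>M)"
    using osc by simp
  also have "\<dots> \<le> D powr e * \<mu> + D powr (e - r) * D powr r"
    using osc by (intro add_left_mono mult_left_mono) auto
  also have "\<dots> = (\<mu> + 1) * D powr e"
    using cD by (simp add: powr_add[symmetric] algebra_simps)
  finally show "(\<integral>x. \<bar>g x powr s - c\<bar> powr e \<partial>M) \<le> (\<mu> + 1) * D powr e" .
qed

text \<open>
If \<open>D\<close> is small, the normalisation forces \<open>c\<close> to be bounded away from \<open>0\<close> (here) and from infinity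
(\<open>constant_upper\<close>). This is what permits dividing by \<open>c\<close> later. The factor \<open>2 powr p\<close> is the price
for a triangle inequality that is also valid for exponents below \<open>1\<close>.
\<close>

lemma constant_lower: "1 \<le> 2 powr p * (\<mu> * c powr p + (\<mu> + 1) * D powr p)"
proof -
  note o = osc_lower_power[of p, OF p]
  have "g x powr q \<le> 2 powr p * (c powr p + \<bar>g x powr s - c\<bar> powr p)" for x
    using abs_powr_add_le[of p c "g x powr s - c"] p cD power_gs[of x] by simp
  then have "1 \<le> (\<integral>x. 2 powr p * (c powr p + \<bar>g x powr s - c\<bar> powr p) \<partial>M)"
    unfolding gq(2)[symmetric] by (intro integral_mono gq) (use o in auto)
  also have "\<dots> = 2 powr p * (\<mu> * c powr p + (\<integral>x. \<bar>g x powr s - c\<bar> powr p \<partial>M))"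
    using o by simp
  also have "\<dots> \<le> 2 powr p * (\<mu> * c powr p + (\<mu> + 1) * D powr p)"
    using o by (intro mult_left_mono add_left_mono) auto
  finally show ?thesis .
qed

lemma constant_upper: "\<mu> * c powr p \<le> 2 powr p * (1 + (\<mu> + 1) * D powr p)"
proof -
  note o = osc_lower_power[of p, OF p]
  have "c powr p \<le> 2 powr p * (g x powr q + \<bar>g x powr s - c\<bar> powr p)" for x
    using abs_powr_add_le[of p "g x powr s" "c - g x powr s"] p cD power_gs[of x]
    by (simp add: abs_minus_commute)
  then have "(\<integral>x. c powr p \<partial>M) \<le> (\<integral>x. 2 powr p * (g x powr q + \<bar>g x powr s - c\<bar> powr p) \<partial>M)"
    by (intro integral_mono) (use o gq in auto)
  also have "\<dots> = 2 powr p * (1 + (\<integral>x. \<bar>g x powr s - c\<bar> powr p \<partial>M))"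
    using o gq by simp
  also have "\<dots> \<le> 2 powr p * (1 + (\<mu> + 1) * D powr p)"
    using o by (intro mult_left_mono add_left_mono) auto
  finally show ?thesis by simp
qed

lemma osc_any_constant: "integrable M (\<lambda>x. \<bar>g x powr s - a\<bar> powr r)"
proof (rule Bochner_Integration.integrable_bound)
  show "integrable M (\<lambda>x. 2 powr r * (\<bar>g x powr s - c\<bar> powr r + \<bar>c - a\<bar> powr r))"
    using osc by simp
  have "\<bar>g x powr s - a\<bar> powr r \<le> 2 powr r * (\<bar>g x powr s - c\<bar> powr r + \<bar>c - a\<bar> powr r)" for x
    using abs_powr_add_le[of r "g x powr s - c" "c - a"] r by simp
  then show "AE x in M. norm (\<bar>g x powr s - a\<bar> powr r) \<le>
    norm (2 powr r * (\<bar>g x powr s - c\<bar> powr r + \<bar>c - a\<bar> powr r))" by (auto intro: order_trans)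
qed simp

lemma osc_any_constant_lower_power:
  assumes e: "0 < e" "e \<le> r"
  shows "integrable M (\<lambda>x. \<bar>g x powr s - a\<bar> powr e)"
proof (rule Bochner_Integration.integrable_bound)
  show "integrable M (\<lambda>x. 1 + \<bar>g x powr s - a\<bar> powr r)"
    using osc_any_constant by simp
  have "\<bar>g x powr s - a\<bar> powr e \<le> 1 + \<bar>g x powr s - a\<bar> powr r" for x
    using powr_interpolate[of e r 1 "\<bar>g x powr s - a\<bar>"] e by simp
  then show "AE x in M. norm (\<bar>g x powr s - a\<bar> powr e) \<le> norm (1 + \<bar>g x powr s - a\<bar> powr r)"
    by (auto intro: order_trans)
qed simp

lemma bregman_osc_bound:
  assumes K: "K \<ge> 0" "\<And>z. z \<ge> 0 \<Longrightarrow> bregman q (z powr (1/s)) \<le> K * ((z - 1)\<^sup>2 + \<bar>z - 1\<bar> powr r)"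
    and a: "a > 0"
  shows "a powr p * bregman q (g x / a powr (1/s)) \<le>
    K * a powr p * (a powr (-2) * \<bar>g x powr s - a\<bar> powr 2 + a powr (-r) * \<bar>g x powr s - a\<bar> powr r)"
proof -
  define z where "z = g x powr s / a"
  have z: "z \<ge> 0" using a by (simp add: z_def)
  have "z powr (1/s) = g x / a powr (1/s)" using s g(2) by (simp add: z_def powr_divide powr_powr)
  moreover have z1: "\<bar>z - 1\<bar> = \<bar>g x powr s - a\<bar> / a"
    using a by (simp add: z_def field_simps abs_divide)
  moreover have "(z - 1)\<^sup>2 = (\<bar>g x powr s - a\<bar> / a) powr 2" 
    unfolding z1[symmetric] by simp
  ultimately have "bregman q (g x / a powr (1/s)) \<le>
     K * ((\<bar>g x powr s - a\<bar> / a) powr 2 + (\<bar>g x powr s - a\<bar> / a) powr r)"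
    using K(2)[OF z] by simp
  also have "\<dots> = K * (a powr (-2) * \<bar>g x powr s - a\<bar> powr 2 + a powr (-r) * \<bar>g x powr s - a\<bar> powr r)"
    by (simp only: powr_divide powr_minus) (simp add: divide_inverse mult.commute)
  finally have "a powr p * bregman q (g x / a powr (1/s)) \<le> a powr p * 
    (K * (a powr (-2) * \<bar>g x powr s - a\<bar> powr 2 + a powr (-r) * \<bar>g x powr s - a\<bar> powr r))"
    by (intro mult_left_mono) auto
  then show ?thesis by (simp only: mult_ac)
qed

lemma bregman_integrable:
  assumes "m > 0"
  shows "integrable M (\<lambda>x. m powr q * bregman q (g x / m))"
proof -
  obtain K where K: "K \<ge> 0" "\<And>z. z \<ge> 0 \<Longrightarrow> bregman q (z powr (1/s)) \<le> K * ((z - 1)\<^sup>2 + \<bar>z - 1\<bar> powr r)"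
    using bregman_upper_bound[OF s, of q r] r by auto
  define a where "a = m powr s"
  have a: "a > 0" "m = a powr (1/s)" "m powr q = a powr p"
    using assms s by (simp_all add: a_def powr_powr)
  let ?h = "\<lambda>x. K * a powr p * (a powr (-2) * \<bar>g x powr s - a\<bar> powr 2 + a powr (-r) * \<bar>g x powr s - a\<bar> powr r)"
  have le: "m powr q * bregman q (g x / m) \<le> ?h x" for x
    unfolding a(3) unfolding a(2) by (rule bregman_osc_bound[OF K a(1)])
  have nn: "0 \<le> m powr q * bregman q (g x / m)" for x
    using bregman_nonneg[OF q, of "g x / m"] g(2)[of x] assms by simp
  show ?thesis
  proof (rule Bochner_Integration.integrable_bound[where f="?h"])
    show "integrable M ?h"
      using osc_any_constant[of a] osc_any_constant_lower_power[of 2 a] r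
      by (intro integrable_mult_right Bochner_Integration.integrable_add) auto
    show "(\<lambda>x. m powr q * bregman q (g x / m)) \<in> borel_measurable M"
      unfolding bregman_def by measurable
    show "AE x in M. norm (m powr q * bregman q (g x / m)) \<le> norm (?h x)"
    proof (rule AE_I2)
      fix x
      show "norm (m powr q * bregman q (g x / m)) \<le> norm (?h x)"
        using le[of x] nn[of x] unfolding real_norm_def by linarith
    qed
  qed
qed

lemma eta_integrable: "integrable M (\<lambda>x. eta q (g x) avg)"
proof -
  obtain \<alpha> \<beta> where ab: "\<And>y. y \<ge> 0 \<Longrightarrow> avg powr q * bregman q (y / avg) = eta q y avg + (\<alpha> + \<beta> * y)"
    using bregman_eq_eta_plus_affine[OF q avg_pos avg_pos] by blast
  have "integrable M (\<lambda>x. avg powr q * bregman q (g x / avg) - (\<alpha> + \<beta> * g x))"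
    using bregman_integrable[OF avg_pos] g_integrable by auto
  then show ?thesis using ab g(2) by simp
qed

text \<open>
Among all constants \<open>m\<close>, the mean minimises the integral of the Bregman divergence of \<open>g\<close> from \<open>m\<close>:
the two integrals differ by the divergence of the mean from \<open>m\<close>, which is nonnegative. So the
entropy may be estimated with any convenient constant in place of the mean.
\<close>

lemma entropy_le_bregman:
  assumes "m > 0"
  shows "(\<integral>x. eta q (g x) avg \<partial>M) \<le> (\<integral>x. m powr q * bregman q (g x / m) \<partial>M)"
proof -
  obtain \<alpha> \<beta> where ab: "\<And>y. y \<ge> 0 \<Longrightarrow> m powr q * bregman q (y / m) = eta q y avg + (\<alpha> + \<beta> * y)"
    using bregman_eq_eta_plus_affine[OF q assms avg_pos] by blast
  have "0 \<le> m powr q * bregman q (avg / m)"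
    by (intro mult_nonneg_nonneg bregman_nonneg[OF q] divide_nonneg_nonneg)
      (use avg_pos assms g mass in auto)
  also have "\<dots> = \<alpha> + \<beta> * avg"
    using ab[of avg] avg_pos by (auto simp: eta_def)
  finally have "0 \<le> \<mu> * (\<alpha> + \<beta> * avg)" using mass by simp
  also have "\<dots> = (\<integral>x. \<alpha> + \<beta> * g x \<partial>M)"
    using g_integrable mass by (simp add: field_simps)
  finally have "(\<integral>x. eta q (g x) avg \<partial>M) \<le> (\<integral>x. eta q (g x) avg + (\<alpha> + \<beta> * g x) \<partial>M)"
    using eta_integrable g_integrable by simp
  then show ?thesis using ab g(2) by simp
qed

text \<open>
For small \<open>D\<close> the comparison constant is \<open>m = c powr (1/s)\<close>, so that \<open>g powr s\<close> is compared with \<open>c\<close>.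
The pointwise bound of the divergence is quadratic in \<open>g powr s - c\<close> up to a higher power, and both
contributions are of order \<open>D\<^sup>2\<close>.
\<close>

lemma entropy_le_small_osc:
  assumes K: "K \<ge> 0" "\<And>z. z \<ge> 0 \<Longrightarrow> bregman q (z powr (1/s)) \<le> K * ((z - 1)\<^sup>2 + \<bar>z - 1\<bar> powr r)"
    and ab: "0 < a" "a \<le> c powr p" "c powr p \<le> b" and D: "D \<le> 1"
  shows "(\<integral>x. eta q (g x) avg \<partial>M) \<le>
    K * b * (\<mu> + 1) * ((a powr (1/p)) powr (-2) + (a powr (1/p)) powr (-r)) * D\<^sup>2"
proof -
  have c: "c > 0" using ab cD by (cases "c = 0") auto
  have cp: "(c powr (1/s)) powr q = c powr p" using s by (simp add: powr_powr)
  have ac: "a powr (1/p) \<le> c"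
  proof -
    have "a powr (1/p) \<le> (c powr p) powr (1/p)" using ab p q s by (intro powr_mono2) auto
    then show ?thesis using c s q by (simp add: powr_powr)
  qed
  let ?o = "\<lambda>e x. \<bar>g x powr s - c\<bar> powr e"
  let ?h = "\<lambda>x. K * c powr p * (c powr (-2) * ?o 2 x + c powr (-r) * ?o r x)"
  note o2 = osc_lower_power[of 2] and or = osc_lower_power[of r]
  have ih: "integrable M ?h" using o2 or r by simp
  have "(\<integral>x. eta q (g x) avg \<partial>M) \<le> (\<integral>x. c powr p * bregman q (g x / c powr (1/s)) \<partial>M)"
    using entropy_le_bregman[of "c powr (1/s)"] c cp by simp
  also have "\<dots> \<le> (\<integral>x. ?h x \<partial>M)"
    using bregman_integrable[of "c powr (1/s)"] c cp ih
    by (intro integral_mono bregman_osc_bound[OF K c]) auto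
  also have "\<dots> = K * c powr p * (c powr (-2) * (\<integral>x. ?o 2 x \<partial>M) + c powr (-r) * (\<integral>x. ?o r x \<partial>M))"
    using o2 or r by simp
  also have "\<dots> \<le> K * c powr p * (c powr (-2) * ((\<mu> + 1) * D powr 2) + c powr (-r) * ((\<mu> + 1) * D powr r))"
    using K o2(2) or(2) r by (intro mult_left_mono add_mono) auto
  also have "\<dots> \<le> K * b * ((a powr (1/p)) powr (-2) * ((\<mu> + 1) * D powr 2) + (a powr (1/p)) powr (-r) * ((\<mu> + 1) * D powr 2))"
  proof (intro mult_mono add_mono)
    show "c powr -2 \<le> (a powr (1 / p)) powr -2" "c powr -r \<le> (a powr (1 / p)) powr -r"
      using ac ab r by (auto intro!: powr_mono2')
    show "D powr r \<le> D powr 2" using D cD r by (intro powr_mono') auto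
  qed (use K ab in auto)
  also have "\<dots> = K * b * (\<mu> + 1) * ((a powr (1/p)) powr (-2) + (a powr (1/p)) powr (-r)) * D\<^sup>2"
    using cD by (simp add: algebra_simps)
  finally show ?thesis .
qed

lemma entropy_le_large_osc_power:
  assumes "q > 1"
  shows "(\<integral>x. eta q (g x) avg \<partial>M) \<le> 1 / (q - 1)"
proof -
  have "(\<integral>x. eta q (g x) avg \<partial>M) \<le> (\<integral>x. g x powr q / (q - 1) \<partial>M)"
    using assms gq by (intro integral_mono eta_integrable) (auto simp: eta_def divide_right_mono)
  then show ?thesis using gq by simp
qed

text \<open>
For large \<open>D\<close> and \<open>q = 1\<close> the entropy grows only logarithmically. One writes
\<open>ln w = ln \<Lambda> + ln (w / \<Lambda>)\<close> and bounds the last logarithm by a power of \<open>w / \<Lambda>\<close>, which turns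
\<open>g ln g\<close> into \<open>ln \<Lambda>\<close> times the mass of \<open>g\<close> plus a small multiple of the integral of
\<open>g powr (r s)\<close>. The latter is at most of order \<open>max 1 D powr r\<close>, which dictates the choice of \<open>\<Lambda>\<close>.
\<close>

lemma entropy_le_large_osc_log:
  assumes q1: "q = 1" and \<delta>: "0 < \<delta>" "\<delta> \<le> 1" "\<delta> \<le> D"
  shows "(\<integral>x. eta q (g x) avg \<partial>M) \<le>
    (r / (r * s - 1) + \<mu> powr (r * s - 1) * (2 powr r * (1 + \<mu> * ((2 powr p * (\<mu> + 2) / \<mu>) powr (r/p)))) / (r * s - 1)) / \<delta>\<^sup>2 * D\<^sup>2"
proof -
  define \<epsilon> where "\<epsilon> = r * s - 1"
  have \<epsilon>: "\<epsilon> > 0" using r s q1 by (simp add: \<epsilon>_def field_simps)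
  define X where "X = max 1 D"
  have X: "X \<ge> 1" "D \<le> X" by (auto simp: X_def)
  define B where "B = 2 powr p * (\<mu> + 2) / \<mu>"
  have cr: "c powr r \<le> B powr (r/p) * X powr r"
  proof -
    have "1 \<le> X powr p" "D powr p \<le> X powr p"
      using X p cD by (auto intro!: ge_one_powr_ge_zero powr_mono2)
    then have "1 + (\<mu> + 1) * D powr p \<le> X powr p + (\<mu> + 1) * X powr p"
      by (intro add_mono mult_left_mono) auto
    also have "\<dots> = (\<mu> + 2) * X powr p" by (simp add: distrib_right)
    finally have "2 powr p * (1 + (\<mu> + 1) * D powr p) \<le> 2 powr p * ((\<mu> + 2) * X powr p)"
      by (intro mult_left_mono) auto
    then have "\<mu> * c powr p \<le> 2 powr p * ((\<mu> + 2) * X powr p)"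
      using constant_upper by linarith
    then have "c powr p \<le> B * X powr p" using mass by (simp add: B_def field_simps)
    then have "(c powr p) powr (r/p) \<le> (B * X powr p) powr (r/p)"
      using divide_nonneg_pos[OF _ p(1), of r] r(1) by (intro powr_mono2) auto
    then show ?thesis using p q s by (simp add: powr_powr powr_mult)
  qed
  let ?u = "\<lambda>x. (g x powr s) powr r"
  have iu: "integrable M ?u" using osc_any_constant[of 0] by simp
  have ur: "(\<integral>x. ?u x \<partial>M) \<le> 2 powr r * (1 + \<mu> * B powr (r/p)) * X powr r"
  proof -
    have "?u x \<le> 2 powr r * (\<bar>g x powr s - c\<bar> powr r + c powr r)" for x
      using abs_powr_add_le[of r "g x powr s - c" c] r cD by simp
    then have "(\<integral>x. ?u x \<partial>M) \<le> (\<integral>x. 2 powr r * (\<bar>g x powr s - c\<bar> powr r + c powr r) \<partial>M)"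
      using osc iu by (intro integral_mono) auto
    also have "\<dots> = 2 powr r * ((\<integral>x. \<bar>g x powr s - c\<bar> powr r \<partial>M) + \<mu> * c powr r)" using osc by simp
    also have "\<dots> \<le> 2 powr r * (X powr r + \<mu> * (B powr (r/p) * X powr r))"
      using osc(2) cr X cD r by (intro mult_left_mono add_mono order_trans[OF osc(2)] powr_mono2) auto
    also have "\<dots> = 2 powr r * (1 + \<mu> * B powr (r/p)) * X powr r" by (simp add: algebra_simps)
    finally show ?thesis .
  qed
  \<comment> \<open>This makes \<open>\<Lambda> powr (- \<epsilon>)\<close> cancel the factor \<open>X powr r\<close> of the bound \<open>ur\<close>.\<close>
  define \<Lambda> where "\<Lambda> = X powr (r / \<epsilon>)"
  have \<Lambda>: "\<Lambda> > 0" "ln \<Lambda> = (r / \<epsilon>) * ln X" "\<Lambda> powr (-\<epsilon>) = X powr (-r)"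
    using X \<epsilon> by (auto simp: \<Lambda>_def powr_powr)
  have int1: "(\<integral>x. g x \<partial>M) = 1" using gq(2) g(2) q1 by simp
  then have avg: "avg = 1 / \<mu>" by simp
  have pw: "eta q y avg \<le> y * ln \<Lambda> + \<mu> powr \<epsilon> * \<Lambda> powr (-\<epsilon>) * ((y powr s) powr r) / \<epsilon>" if "y \<ge> 0" for y
  proof (cases "y = 0")
    case False
    then have y: "y > 0" using that by simp
    define w where "w = y * \<mu> / \<Lambda>"
    have w: "w > 0" using y mass \<Lambda> by (simp add: w_def)
    have lw: "ln w \<le> w powr \<epsilon> / \<epsilon>"
    proof (cases "w \<ge> 1")
      case True then show ?thesis using \<epsilon> by (intro ln_powr_bound) auto
    next
      case False
      then have "ln w \<le> 0" using w by simp
      then show ?thesis using \<epsilon> by (meson divide_nonneg_pos order_trans powr_ge_zero)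
    qed
    have "eta q y avg = y * ln (y * \<mu>)" using q1 unfolding avg by (simp add: eta_def)
    also have "\<dots> = y * ln \<Lambda> + y * ln w" using y mass \<Lambda>(1)
      by (simp add: w_def ln_mult ln_div algebra_simps)
    also have "\<dots> \<le> y * ln \<Lambda> + y * (w powr \<epsilon> / \<epsilon>)" 
      using mult_left_mono[OF lw, of y] y by linarith
    also have "y * (w powr \<epsilon> / \<epsilon>) = \<mu> powr \<epsilon> * \<Lambda> powr (-\<epsilon>) * (y * y powr \<epsilon>) / \<epsilon>"
      by (simp add: w_def powr_mult powr_divide powr_minus divide_inverse inverse_powr)
    also have "y * y powr \<epsilon> = (y powr s) powr r"
      using y by (simp add: powr_mult_base powr_powr \<epsilon>_def mult.commute)
    finally show ?thesis .
  qed (use q1 in \<open>simp add: eta_def\<close>)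
  have "(\<integral>x. eta q (g x) avg \<partial>M) \<le> (\<integral>x. g x * ln \<Lambda> + \<mu> powr \<epsilon> * \<Lambda> powr (-\<epsilon>) * ?u x / \<epsilon> \<partial>M)"
    using pw g(2) iu g_integrable by (intro integral_mono eta_integrable) auto
  also have "\<dots> = ln \<Lambda> + \<mu> powr \<epsilon> * \<Lambda> powr (-\<epsilon>) * (\<integral>x. ?u x \<partial>M) / \<epsilon>"
    using iu g_integrable int1 by simp
  also have "\<dots> \<le> (r / \<epsilon>) * X + \<mu> powr \<epsilon> * \<Lambda> powr (-\<epsilon>) * (2 powr r * (1 + \<mu> * B powr (r/p)) * X powr r) / \<epsilon>"
    unfolding \<Lambda>(2) using ur \<epsilon> X r ln_le_minus_one[of X]
    by (intro add_mono mult_left_mono divide_right_mono) auto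
  also have "\<dots> = (r / \<epsilon>) * X + \<mu> powr \<epsilon> * (2 powr r * (1 + \<mu> * B powr (r/p))) / \<epsilon>"
    using X unfolding \<Lambda>(3) by (simp add: powr_minus)
  also have "\<dots> \<le> (r / \<epsilon> + \<mu> powr \<epsilon> * (2 powr r * (1 + \<mu> * B powr (r/p))) / \<epsilon>) * X\<^sup>2"
  proof -
    have XX: "X \<le> X\<^sup>2" "1 \<le> X\<^sup>2" using X one_le_power[of X 2] self_le_power[of X 2] by auto
    have "(r / \<epsilon>) * X \<le> (r / \<epsilon>) * X\<^sup>2" using XX r \<epsilon> by (intro mult_left_mono) auto
    moreover have "Z * 1 \<le> Z * X\<^sup>2" if "Z \<ge> 0" for Z using XX that by (intro mult_left_mono) auto
    from this[of "\<mu> powr \<epsilon> * (2 powr r * (1 + \<mu> * B powr (r/p))) / \<epsilon>"]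
    have "\<mu> powr \<epsilon> * (2 powr r * (1 + \<mu> * B powr (r/p))) / \<epsilon> \<le>
      \<mu> powr \<epsilon> * (2 powr r * (1 + \<mu> * B powr (r/p))) / \<epsilon> * X\<^sup>2"
      using \<epsilon> by simp
    ultimately show ?thesis by (simp add: distrib_right)
  qed
  also have "\<dots> \<le> (r / \<epsilon> + \<mu> powr \<epsilon> * (2 powr r * (1 + \<mu> * B powr (r/p))) / \<epsilon>) * (D\<^sup>2 / \<delta>\<^sup>2)"
  proof (intro mult_left_mono)
    have "X \<le> D / \<delta>" using \<delta> cD by (auto simp: X_def field_simps)
    then have "X\<^sup>2 \<le> (D / \<delta>)\<^sup>2" using X by (intro power_mono) auto
    then show "X\<^sup>2 \<le> D\<^sup>2 / \<delta>\<^sup>2" by (simp add: power_divide)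
  qed (use \<epsilon> r in auto)
  finally show ?thesis unfolding \<epsilon>_def B_def by simp
qed

end

text \<open>
The threshold \<open>\<delta>\<close> is chosen so that \<open>D \<le> \<delta>\<close> leaves at least half of the mass to the constant
\<open>c\<close>. Beyond the threshold any bound that is at most of order \<open>D\<^sup>2\<close> suffices.
\<close>

lemma entropy_le_normalised:
  fixes M :: "'a measure"
  assumes M: "finite_measure M" "0 < measure M (space M)"
    and s: "0 < s" and r: "2 \<le> r" "(q = 1 \<and> q / s < r) \<or> (1 < q \<and> q / s \<le> r)"
  shows "\<exists>C>0. \<forall>g c D. near_constant_power M q s r c D g \<longrightarrow>
    (\<integral>x. eta q (g x) ((\<integral>x. g x \<partial>M) / measure M (space M)) \<partial>M) \<le> C * D\<^sup>2"
proof -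
  define \<mu> where "\<mu> = measure M (space M)"
  define p where "p = q / s"
  have \<mu>: "\<mu> > 0" using M by (simp add: \<mu>_def)
  have p: "p > 0" "q \<ge> 1" using s r by (auto simp: p_def)
  obtain K where K: "K \<ge> 0" "\<And>z. z \<ge> 0 \<Longrightarrow> bregman q (z powr (1/s)) \<le> K * ((z - 1)\<^sup>2 + \<bar>z - 1\<bar> powr r)"
    using bregman_upper_bound[OF s, of q r] r by auto
  define A where "A = 2 powr p * (\<mu> + 1) * 2"
  have A: "A > 0" using \<mu> by (simp add: A_def)
  define \<delta> where "\<delta> = min 1 (A powr (-1/p))"
  have \<delta>: "0 < \<delta>" "\<delta> \<le> 1" using A by (auto simp: \<delta>_def)
  have \<delta>p: "A * x powr p \<le> 1" if "0 \<le> x" "x \<le> \<delta>" for x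
  proof -
    have "x powr p \<le> (A powr (-1/p)) powr p"
      using that p by (intro powr_mono2) (auto simp: \<delta>_def)
    also have "\<dots> = A powr (-1)" using p by (simp only: powr_powr) simp
    also have "\<dots> = 1 / A" using A by (simp add: powr_neg_one)
    finally show ?thesis using A by (simp add: field_simps)
  qed
  define a where "a = (1/2) / (2 powr p * \<mu>)"
  define b where "b = 2 powr p * (\<mu> + 2) / \<mu>"
  have ab: "a > 0" "b > 0" using \<mu> by (auto simp: a_def b_def)
  define C1 where "C1 = K * b * (\<mu> + 1) * ((a powr (1/p)) powr (-2) + (a powr (1/p)) powr (-r))"
  define C2 where "C2 = 1 / (q - 1) / \<delta>\<^sup>2"
  define C3 where "C3 = (r / (r * s - 1) + \<mu> powr (r * s - 1) *
    (2 powr r * (1 + \<mu> * ((2 powr p * (\<mu> + 2) / \<mu>) powr (r/p)))) / (r * s - 1)) / \<delta>\<^sup>2"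
  define C where "C = \<bar>C1\<bar> + \<bar>C2\<bar> + \<bar>C3\<bar> + 1"
  have bound: "(\<integral>x. eta q (g x) ((\<integral>x. g x \<partial>M) / measure M (space M)) \<partial>M) \<le> C * D\<^sup>2"
    if n: "near_constant_power M q s r c D g" for g c D
  proof -
    interpret near_constant_power M q s r c D g by (rule n)
    let ?e = "\<integral>x. eta q (g x) ((\<integral>x. g x \<partial>M) / measure M (space M)) \<partial>M"
    have mono: "?e \<le> Z * D\<^sup>2 \<Longrightarrow> Z \<le> C \<Longrightarrow> ?e \<le> C * D\<^sup>2" for Z
      by (meson mult_right_mono order_trans zero_le_power2)
    show ?thesis
    proof (cases "D \<le> \<delta>")
      case True
      have D1: "A * D powr p \<le> 1" "D \<le> 1" using True \<delta>p[of D] cD \<delta> by auto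
      have "1 \<le> 2 powr p * (\<mu> * c powr p) + A * D powr p / 2"
      proof -
        have "A * D powr p / 2 = 2 powr p * ((\<mu> + 1) * D powr p)" by (simp add: A_def)
        then show ?thesis using constant_lower[folded \<mu>_def p_def] by (simp only: distrib_left)
      qed
      then have ca: "a \<le> c powr p" using D1 \<mu> by (simp add: a_def field_simps)
      have "D powr p \<le> 1" using D1(2) cD p unfolding p_def by (intro powr_le1) auto
      then have "2 powr p * (1 + (\<mu> + 1) * D powr p) \<le> 2 powr p * (1 + (\<mu> + 1) * 1)"
        using \<mu> by (intro mult_left_mono add_left_mono) auto
      then have "\<mu> * c powr p \<le> 2 powr p * (\<mu> + 2)"
        using constant_upper by (simp add: \<mu>_def p_def algebra_simps)
      then have cb: "c powr p \<le> b" using \<mu> by (simp add: b_def field_simps)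
      have "?e \<le> C1 * D\<^sup>2"
        using entropy_le_small_osc[OF K ab(1) _ _ D1(2), of b] ca cb
        by (simp add: C1_def \<mu>_def p_def)
      then show ?thesis by (rule mono) (auto simp: C_def)
    next
      case False
      show ?thesis
      proof (cases "q = 1")
        case True
        have "?e \<le> C3 * D\<^sup>2"
          using entropy_le_large_osc_log[OF True \<delta>] False by (simp add: C3_def \<mu>_def p_def)
        then show ?thesis by (rule mono) (auto simp: C_def)
      next
        case q: False
        then have q1: "q > 1" using r by auto
        have "\<delta>\<^sup>2 \<le> D\<^sup>2" using False \<delta> by (intro power_mono) auto
        then have "1 \<le> D\<^sup>2 / \<delta>\<^sup>2" using \<delta> by simp
        then have "1 / (q - 1) * 1 \<le> 1 / (q - 1) * (D\<^sup>2 / \<delta>\<^sup>2)"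
          using q1 by (intro mult_left_mono) auto
        then have "?e \<le> C2 * D\<^sup>2" using entropy_le_large_osc_power[OF q1] by (simp add: C2_def)
        then show ?thesis by (rule mono) (auto simp: C_def)
      qed
    qed
  qed
  moreover have "C > 0" by (simp add: C_def add_nonneg_pos)
  ultimately show ?thesis by blast
qed

lemma eta_scale:
  assumes "N > 0" "y \<ge> 0" "m \<ge> 0"
  shows "eta q (y / N) (m / N) = eta q y m / N powr q"
  using assms by (simp add: eta_def powr_divide diff_divide_distrib mult.commute)

text \<open>
Both sides of the desired inequality are homogeneous of degree \<open>q\<close> in \<open>g\<close>, which reduces it to the
normalised situation.
\<close>

lemma entropy_inequality:
  fixes M :: "'a measure"
  assumes M: "finite_measure M" "0 < measure M (space M)"
    and s: "0 < s" and r: "2 \<le> r" "(q = 1 \<and> q / s < r) \<or> (1 < q \<and> q / s \<le> r)"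
  shows "\<exists>C>0. \<forall>g c D. g \<in> borel_measurable M \<and> (\<forall>x. 0 \<le> g x) \<and> integrable M (\<lambda>x. g x powr q) \<and>
      0 \<le> c \<and> 0 < D \<and> integrable M (\<lambda>x. \<bar>g x powr s - c\<bar> powr r) \<and>
      (\<integral>x. \<bar>g x powr s - c\<bar> powr r \<partial>M) \<le> D powr r \<longrightarrow>
    integrable M (\<lambda>x. eta q (g x) ((\<integral>x. g x \<partial>M) / measure M (space M))) \<and>
    (\<integral>x. eta q (g x) ((\<integral>x. g x \<partial>M) / measure M (space M)) \<partial>M) \<le>
      C * ((\<integral>x. g x powr q \<partial>M) powr (1/q)) powr (q - 2 * s) * D\<^sup>2"
proof -
  interpret finite_measure M by (rule M)
  have q: "q \<ge> 1" using r by auto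
  obtain C where C: "C > 0" and norm: "\<And>g c D. near_constant_power M q s r c D g \<Longrightarrow>
    (\<integral>x. eta q (g x) ((\<integral>x. g x \<partial>M) / measure M (space M)) \<partial>M) \<le> C * D\<^sup>2"
    using entropy_le_normalised[OF assms] by blast
  have main: "integrable M (\<lambda>x. eta q (g x) ((\<integral>x. g x \<partial>M) / measure M (space M))) \<and>
    (\<integral>x. eta q (g x) ((\<integral>x. g x \<partial>M) / measure M (space M)) \<partial>M) \<le>
      C * ((\<integral>x. g x powr q \<partial>M) powr (1/q)) powr (q - 2 * s) * D\<^sup>2"
    if g: "g \<in> borel_measurable M" "\<And>x. 0 \<le> g x" "integrable M (\<lambda>x. g x powr q)"
      and cD: "0 \<le> c" "0 < D" and osc: "integrable M (\<lambda>x. \<bar>g x powr s - c\<bar> powr r)"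
      "(\<integral>x. \<bar>g x powr s - c\<bar> powr r \<partial>M) \<le> D powr r" for g c D
  proof -
    define avg where "avg = (\<integral>x. g x \<partial>M) / measure M (space M)"
    define N where "N = (\<integral>x. g x powr q \<partial>M) powr (1/q)"
    have avg0: "avg \<ge> 0" using g(2) by (auto simp: avg_def)
    have "integrable M (\<lambda>x. eta q (g x) avg) \<and>
      (\<integral>x. eta q (g x) avg \<partial>M) \<le> C * N powr (q - 2 * s) * D\<^sup>2"
    proof (cases "N = 0")
      case True
      then have "(\<integral>x. g x powr q \<partial>M) = 0" by (simp add: N_def)
      then have "AE x in M. g x powr q = 0"
        using integral_nonneg_eq_0_iff_AE[OF g(3)] by simp
      then have g0: "AE x in M. g x = 0" by simp
      then have "(\<integral>x. g x \<partial>M) = 0" by (rule integral_eq_zero_AE)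
      then have "avg = 0" by (simp add: avg_def)
      then have e0: "AE x in M. eta q (g x) avg = 0" using g0 by (auto simp: eta_def)
      then have "integrable M (\<lambda>x. eta q (g x) avg) \<longleftrightarrow> integrable M (\<lambda>x. 0 :: real)"
        using g(1) by (intro integrable_cong_AE) (auto simp: eta_def)
      then show ?thesis using True integral_eq_zero_AE[OF e0] by simp
    next
      case False
      then have N: "N > 0" by (simp add: N_def)
      have Nq: "N powr q = (\<integral>x. g x powr q \<partial>M)" using q by (simp add: N_def powr_powr)
      have scaled: "near_constant_power M q s r (c / N powr s) (D / N powr s) (\<lambda>x. g x / N)"
      proof unfold_locales
        have e: "\<bar>(g x / N) powr s - c / N powr s\<bar> powr r = \<bar>g x powr s - c\<bar> powr r / (N powr s) powr r" for x
        proof -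
          have "(g x / N) powr s - c / N powr s = (g x powr s - c) / N powr s"
            by (simp add: powr_divide diff_divide_distrib)
          then show ?thesis by (simp add: abs_divide powr_divide)
        qed
        show "integrable M (\<lambda>x. \<bar>(g x / N) powr s - c / N powr s\<bar> powr r)"
          unfolding e using osc by simp
        show "(\<integral>x. \<bar>(g x / N) powr s - c / N powr s\<bar> powr r \<partial>M) \<le> (D / N powr s) powr r"
          unfolding e using osc(2) by (simp add: powr_divide divide_right_mono)
        show "(\<integral>x. (g x / N) powr q \<partial>M) = 1"
          using N by (simp add: powr_divide Nq[symmetric])
        show "integrable M (\<lambda>x. (g x / N) powr q)" using g(3) by (simp add: powr_divide)
        show "(\<lambda>x. g x / N) \<in> borel_measurable M" using g(1) by simp
      qed (use M s r g cD N in auto)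
      have avgN: "(\<integral>x. g x / N \<partial>M) / measure M (space M) = avg / N"
        by (simp add: avg_def)
      have etaN: "eta q (g x / N) (avg / N) = eta q (g x) avg / N powr q" for x
        using eta_scale[OF N g(2) avg0] by simp
      have "integrable M (\<lambda>x. eta q (g x) avg / N powr q)"
        using near_constant_power.eta_integrable[OF scaled] unfolding avgN etaN by simp
      from integrable_mult_right[OF this, of "N powr q"]
      have int: "integrable M (\<lambda>x. eta q (g x) avg)" using N by simp
      have "(\<integral>x. eta q (g x) avg \<partial>M) / N powr q \<le> C * (D / N powr s)\<^sup>2"
        using norm[OF scaled] unfolding avgN etaN by simp
      then have "(\<integral>x. eta q (g x) avg \<partial>M) \<le> C * (D / N powr s)\<^sup>2 * N powr q"
        using N by (simp add: field_simps)
      also have "\<dots> = C * N powr (q - 2 * s) * D\<^sup>2"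
        using N by (simp add: powr_diff power_divide mult.commute[of 2] powr_powr[symmetric] del: powr_powr)
      finally have "(\<integral>x. eta q (g x) avg \<partial>M) \<le> C * N powr (q - 2 * s) * D\<^sup>2" .
      then show ?thesis using int by simp
    qed
    then show ?thesis unfolding avg_def N_def .
  qed
  show ?thesis using C main by (intro exI[of _ C]) blast
qed

section \<open>Transport of mass along segments\<close>

lemma nn_integral_lborel_affine:
  fixes f :: "'a::euclidean_space \<Rightarrow> ennreal"
  assumes [measurable]: "f \<in> borel_measurable borel" and t: "t > 0"
  shows "ennreal (t ^ DIM('a)) * (\<integral>\<^sup>+x. f (a + t *\<^sub>R x) \<partial>lborel) = (\<integral>\<^sup>+x. f x \<partial>lborel)"
proof -
  have "(\<integral>\<^sup>+x. f x \<partial>lborel) = (\<integral>\<^sup>+x. f x \<partial>density (distr lborel borel (\<lambda>x. a + t *\<^sub>R x)) (\<lambda>_. ennreal (\<bar>t\<bar> ^ DIM('a))))"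
    using lborel_affine[of t a] t by simp
  also have "\<dots> = ennreal (t ^ DIM('a)) * (\<integral>\<^sup>+x. f (a + t *\<^sub>R x) \<partial>lborel)"
    using t by (simp add: nn_integral_density nn_integral_distr nn_integral_cmult)
  finally show ?thesis by simp
qed

lemma nn_integral_lborel_affine_inverse:
  fixes f :: "'a::euclidean_space \<Rightarrow> ennreal"
  assumes "f \<in> borel_measurable borel" and t: "t > 0"
  shows "(\<integral>\<^sup>+x. f (a + t *\<^sub>R x) \<partial>lborel) = ennreal ((1 / t) ^ DIM('a)) * (\<integral>\<^sup>+x. f x \<partial>lborel)"
proof -
  have "ennreal ((1 / t) ^ DIM('a)) * (\<integral>\<^sup>+x. f x \<partial>lborel) =
    ennreal ((1 / t) ^ DIM('a)) * ennreal (t ^ DIM('a)) * (\<integral>\<^sup>+x. f (a + t *\<^sub>R x) \<partial>lborel)"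
    unfolding nn_integral_lborel_affine[OF assms, of a, symmetric] by (simp add: mult.assoc)
  also have "ennreal ((1 / t) ^ DIM('a)) * ennreal (t ^ DIM('a)) = 1"
    using t by (simp add: ennreal_mult[symmetric] power_mult_distrib[symmetric])
  finally show ?thesis by simp
qed

text \<open>
The two regimes meet at \<open>t0 = e powr (1/n)\<close>, and each contributes at most \<open>t0\<close>.
\<close>

lemma nn_integral_min_power_le:
  fixes e n :: real
  assumes e: "0 < e" "e \<le> 1" and n: "2 \<le> n"
  shows "(\<integral>\<^sup>+t. ennreal (min 1 (e * t powr (-n))) * indicator {0..1} t \<partial>lborel) \<le> ennreal (2 * e powr (1/n))"
proof -
  define t0 where "t0 = e powr (1/n)"
  have t0: "0 < t0" "t0 \<le> 1" using e n by (auto simp: t0_def powr_le1)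
  have et0: "e = t0 powr n" using e n by (simp add: t0_def powr_powr)
  have "(\<integral>\<^sup>+t. ennreal (min 1 (e * t powr (-n))) * indicator {0..1} t \<partial>lborel) \<le>
    (\<integral>\<^sup>+t. indicator {0..t0} t + ennreal (e * t powr (-n)) * indicator {t0..1} t \<partial>lborel)"
    by (intro nn_integral_mono) (auto simp: indicator_def min_def ennreal_leI split: if_splits intro!: add_increasing2)
  also have "\<dots> = (\<integral>\<^sup>+t. indicator {0..t0} t \<partial>lborel) + (\<integral>\<^sup>+t. ennreal (e * t powr (-n)) * indicator {t0..1} t \<partial>lborel)"
    by (rule nn_integral_add) auto
  also have "(\<integral>\<^sup>+t. ennreal (e * t powr (-n)) * indicator {t0..1} t \<partial>lborel) =
     ennreal (- (e / (n - 1)) * 1 powr (1 - n) - (- (e / (n - 1)) * t0 powr (1 - n)))"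
  proof (rule nn_integral_FTC_Icc)
    fix t assume "t \<in> {t0..1}"
    then have "t > 0" using t0 by simp
    then have "((\<lambda>t. t powr (1 - n)) has_real_derivative (1 - n) * t powr (1 - n - 1)) (at t)"
      by (auto intro!: derivative_eq_intros)
    from DERIV_cmult[OF this, of "- (e / (n - 1))"]
    show "((\<lambda>t. - (e / (n - 1)) * t powr (1 - n)) has_real_derivative e * t powr - n) (at t)"
    proof (rule DERIV_cong)
      have "- (e / (n - 1)) * ((1 - n) * X) = e * X" for X
        using n by (simp add: field_simps)
      then show "- (e / (n - 1)) * ((1 - n) * t powr (1 - n - 1)) = e * t powr - n" by simp
    qed
  qed (use t0 e n in auto)
  also have "(\<integral>\<^sup>+t. indicator {0..t0} t \<partial>lborel) = ennreal t0"
    using t0 by simp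
  also have "ennreal t0 + ennreal (- (e / (n - 1)) * 1 powr (1 - n) - (- (e / (n - 1)) * t0 powr (1 - n)))
     \<le> ennreal t0 + ennreal t0"
  proof (intro add_left_mono ennreal_leI)
    have "e * t0 powr (1 - n) = t0" using t0 by (simp add: et0 powr_add[symmetric])
    then have "- (e / (n - 1)) * 1 powr (1 - n) - (- (e / (n - 1)) * t0 powr (1 - n)) = (t0 - e) / (n - 1)"
      by (simp add: diff_divide_distrib)
    also have "\<dots> \<le> t0 / 1" using e n t0 by (intro frac_le) auto
    finally show "- (e / (n - 1)) * 1 powr (1 - n) - (- (e / (n - 1)) * t0 powr (1 - n)) \<le> t0" by simp
  qed
  also have "\<dots> = ennreal (2 * e powr (1/n))"
    using t0 by (simp add: ennreal_plus[symmetric] t0_def del: ennreal_plus)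
  finally show ?thesis .
qed

text \<open>
For fixed \<open>t\<close> the point \<open>x + t (y - x)\<close> is an affine image of \<open>y\<close> with ratio \<open>t\<close> and of \<open>x\<close> with
ratio \<open>1 - t\<close>. Integrating \<open>y\<close> first and \<open>x\<close> last costs \<open>t\<close> to the power \<open>- DIM('a)\<close> and the measure
of \<open>E\<close>; the other order costs \<open>1 - t\<close> to the same power and the measure of \<open>Z\<close>. The first bound is
good for \<open>t\<close> near \<open>1\<close>, the second for \<open>t\<close> near \<open>0\<close>.
\<close>

lemma segment_transport_slice:
  fixes E Z :: "'a::euclidean_space set" and f :: "'a \<Rightarrow> ennreal"
  assumes [measurable]: "E \<in> sets borel" "Z \<in> sets borel" "f \<in> borel_measurable borel"
    and n: "real DIM('a) \<le> n" and V: "0 < V" "emeasure lborel E \<le> ennreal V" "emeasure lborel Z \<le> ennreal V"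
    and t: "0 < t" "t < 1"
  shows "(\<integral>\<^sup>+x. \<integral>\<^sup>+y. indicator E x * indicator Z y * f (x + t *\<^sub>R (y - x)) \<partial>lborel \<partial>lborel)
    \<le> ennreal (2 ^ DIM('a) * V * min 1 (measure lborel E / V * t powr (-n))) * (\<integral>\<^sup>+x. f x \<partial>lborel)"
    (is "?I \<le> _ * ?F")
proof -
  have Efin: "emeasure lborel E = ennreal (measure lborel E)"
    using V by (intro emeasure_eq_ennreal_measure) (auto simp: top_unique)
  have EV: "measure lborel E \<le> V" using V Efin by (simp add: ennreal_le_iff)
  have by_y: "?I \<le> ennreal (measure lborel E * (1 / t) ^ DIM('a)) * ?F"
  proof -
    have "?I \<le> (\<integral>\<^sup>+x. indicator E x * (\<integral>\<^sup>+y. f ((x - t *\<^sub>R x) + t *\<^sub>R y) \<partial>lborel) \<partial>lborel)"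
    proof (rule nn_integral_mono)
      fix x
      have "(\<integral>\<^sup>+y. indicator E x * indicator Z y * f (x + t *\<^sub>R (y - x)) \<partial>lborel)
        \<le> (\<integral>\<^sup>+y. indicator E x * f ((x - t *\<^sub>R x) + t *\<^sub>R y) \<partial>lborel)"
        by (intro nn_integral_mono) (auto simp: indicator_def algebra_simps)
      also have "\<dots> = indicator E x * (\<integral>\<^sup>+y. f ((x - t *\<^sub>R x) + t *\<^sub>R y) \<partial>lborel)"
        by (rule nn_integral_cmult) measurable
      finally show "(\<integral>\<^sup>+y. indicator E x * indicator Z y * f (x + t *\<^sub>R (y - x)) \<partial>lborel) \<le> \<dots>" .
    qed
    also have "\<dots> = (\<integral>\<^sup>+x. indicator E x * (ennreal ((1 / t) ^ DIM('a)) * ?F) \<partial>lborel)"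
      by (subst nn_integral_lborel_affine_inverse[OF _ t(1)]) auto
    also have "\<dots> = emeasure lborel E * (ennreal ((1 / t) ^ DIM('a)) * ?F)"
      by (subst nn_integral_multc) auto
    also have "\<dots> = ennreal (measure lborel E * (1 / t) ^ DIM('a)) * ?F"
      using t unfolding Efin by (simp add: ennreal_mult mult.assoc)
    finally show ?thesis .
  qed
  have by_x: "?I \<le> ennreal (V * (1 / (1 - t)) ^ DIM('a)) * ?F"
  proof -
    have "?I = (\<integral>\<^sup>+y. \<integral>\<^sup>+x. indicator E x * indicator Z y * f (x + t *\<^sub>R (y - x)) \<partial>lborel \<partial>lborel)"
      by (rule lborel_pair.Fubini') measurable
    also have "\<dots> \<le> (\<integral>\<^sup>+y. indicator Z y * (\<integral>\<^sup>+x. f (t *\<^sub>R y + (1 - t) *\<^sub>R x) \<partial>lborel) \<partial>lborel)"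
    proof (rule nn_integral_mono)
      fix y
      have "(\<integral>\<^sup>+x. indicator E x * indicator Z y * f (x + t *\<^sub>R (y - x)) \<partial>lborel)
        \<le> (\<integral>\<^sup>+x. indicator Z y * f (t *\<^sub>R y + (1 - t) *\<^sub>R x) \<partial>lborel)"
        by (intro nn_integral_mono) (auto simp: indicator_def algebra_simps)
      also have "\<dots> = indicator Z y * (\<integral>\<^sup>+x. f (t *\<^sub>R y + (1 - t) *\<^sub>R x) \<partial>lborel)"
        by (rule nn_integral_cmult) measurable
      finally show "(\<integral>\<^sup>+x. indicator E x * indicator Z y * f (x + t *\<^sub>R (y - x)) \<partial>lborel) \<le> \<dots>" .
    qed
    also have "\<dots> = (\<integral>\<^sup>+y. indicator Z y * (ennreal ((1 / (1 - t)) ^ DIM('a)) * ?F) \<partial>lborel)"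
      using t by (subst nn_integral_lborel_affine_inverse) auto
    also have "\<dots> = emeasure lborel Z * (ennreal ((1 / (1 - t)) ^ DIM('a)) * ?F)"
      by (subst nn_integral_multc) auto
    also have "\<dots> \<le> ennreal V * (ennreal ((1 / (1 - t)) ^ DIM('a)) * ?F)"
      using V by (intro mult_right_mono) auto
    also have "\<dots> = ennreal (V * (1 / (1 - t)) ^ DIM('a)) * ?F"
      using t V by (simp add: ennreal_mult mult.assoc)
    finally show ?thesis .
  qed
  have tn: "(1 / t) ^ DIM('a) \<le> t powr (-n)"
  proof -
    have "(1 / t) ^ DIM('a) = t powr (- real DIM('a))"
      using t by (simp add: powr_minus powr_realpow field_simps)
    also have "\<dots> \<le> t powr (-n)" using n t by (intro powr_mono') auto
    finally show ?thesis .
  qed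
  have first: "measure lborel E * (1 / t) ^ DIM('a) \<le> 2 ^ DIM('a) * V * (measure lborel E / V * t powr (-n))"
  proof -
    have "measure lborel E * (1 / t) ^ DIM('a) \<le> measure lborel E * t powr (-n)"
      using tn by (intro mult_left_mono) auto
    also have "\<dots> \<le> 2 ^ DIM('a) * (measure lborel E * t powr (-n))"
      using mult_right_mono[of 1 "2 ^ DIM('a)" "measure lborel E * t powr (-n)"] by simp
    finally show ?thesis using V by (simp add: field_simps)
  qed
  have second: "measure lborel E * (1 / t) ^ DIM('a) \<le> 2 ^ DIM('a) * V \<or> V * (1 / (1 - t)) ^ DIM('a) \<le> 2 ^ DIM('a) * V"
  proof (cases "t \<le> 1/2")
    case True
    then have "(1 / (1 - t)) ^ DIM('a) \<le> 2 ^ DIM('a)" by (intro power_mono) (auto simp: field_simps)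
    then show ?thesis using V by (simp add: mult.commute)
  next
    case False
    then have "(1 / t) ^ DIM('a) \<le> 2 ^ DIM('a)" using t by (intro power_mono) (auto simp: field_simps)
    then have "measure lborel E * (1 / t) ^ DIM('a) \<le> V * 2 ^ DIM('a)"
      using EV V t by (intro mult_mono) auto
    then show ?thesis by (simp add: mult.commute)
  qed
  have "?I \<le> ennreal (2 ^ DIM('a) * V) * ?F"
    using second by_x by_y by (meson ennreal_leI mult_right_mono order_trans zero_le)
  moreover have "?I \<le> ennreal (2 ^ DIM('a) * V * (measure lborel E / V * t powr (-n))) * ?F"
    using first by_y by (meson ennreal_leI mult_right_mono order_trans zero_le)
  ultimately show ?thesis by (auto simp: min_def)
qed

text \<open>
Integrating the slices over \<open>t\<close> gains the power \<open>1/n\<close> of the measure of \<open>E\<close>. This is the weak-type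
estimate for the Riesz potential of order one, obtained without the potential. The exponent \<open>n\<close> may
be any real number above the dimension, which later treats all dimensions, including \<open>1\<close> and \<open>2\<close>,
in the same way.
\<close>

lemma segment_transport:
  fixes E Z :: "'a::euclidean_space set" and f :: "'a \<Rightarrow> ennreal"
  assumes [measurable]: "E \<in> sets borel" "Z \<in> sets borel" "f \<in> borel_measurable borel"
    and n: "real DIM('a) \<le> n" "2 \<le> n"
    and V: "0 < V" "emeasure lborel E \<le> ennreal V" "emeasure lborel Z \<le> ennreal V"
  shows "(\<integral>\<^sup>+x. \<integral>\<^sup>+y. indicator E x * indicator Z y *
      (\<integral>\<^sup>+t. f (x + t *\<^sub>R (y - x)) * indicator {0..1} t \<partial>lborel) \<partial>lborel \<partial>lborel)
    \<le> ennreal (2 * 2 ^ DIM('a) * V * (measure lborel E / V) powr (1/n)) * (\<integral>\<^sup>+x. f x \<partial>lborel)"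
    (is "?I \<le> _ * ?F")
proof (cases "measure lborel E = 0")
  case True
  have "emeasure lborel E = ennreal (measure lborel E)"
    using V by (intro emeasure_eq_ennreal_measure) (auto simp: top_unique)
  then have "E \<in> null_sets lborel" using True by auto
  then have "AE x in lborel. x \<notin> E" by (rule AE_not_in)
  then have "?I = (\<integral>\<^sup>+x. 0 \<partial>(lborel :: 'a measure))"
    by (intro nn_integral_cong_AE) (auto elim!: eventually_mono)
  then show ?thesis by simp
next
  case False
  define e where "e = measure lborel E / V"
  have "emeasure lborel E = ennreal (measure lborel E)"
    using V by (intro emeasure_eq_ennreal_measure) (auto simp: top_unique)
  then have e: "0 < e" "e \<le> 1" using V False by (auto simp: e_def ennreal_le_iff zero_less_measure_iff)
  let ?k = "\<lambda>x y t. indicator E x * indicator Z y * (f (x + t *\<^sub>R (y - x)) * indicator {0..1::real} t) :: ennreal"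
  have "?I = (\<integral>\<^sup>+x. \<integral>\<^sup>+y. \<integral>\<^sup>+t. ?k x y t \<partial>lborel \<partial>lborel \<partial>lborel)"
    by (subst nn_integral_cmult) auto
  also have "\<dots> = (\<integral>\<^sup>+x. \<integral>\<^sup>+t. \<integral>\<^sup>+y. ?k x y t \<partial>lborel \<partial>lborel \<partial>lborel)"
    by (intro nn_integral_cong lborel_pair.Fubini') measurable
  also have "\<dots> = (\<integral>\<^sup>+t. \<integral>\<^sup>+x. \<integral>\<^sup>+y. ?k x y t \<partial>lborel \<partial>lborel \<partial>lborel)"
    by (rule lborel_pair.Fubini') measurable
  also have "\<dots> \<le> (\<integral>\<^sup>+t. (ennreal (2 ^ DIM('a) * V) * ?F) * (ennreal (min 1 (e * t powr (-n))) * indicator {0..1} t) \<partial>lborel)"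
  proof (rule nn_integral_mono_AE)
    have "AE t in lborel. t \<noteq> (0::real)" "AE t in lborel. t \<noteq> (1::real)"
      by (auto intro: AE_lborel_singleton)
    then show "AE t in lborel. (\<integral>\<^sup>+x. \<integral>\<^sup>+y. ?k x y t \<partial>lborel \<partial>lborel) \<le>
      (ennreal (2 ^ DIM('a) * V) * ?F) * (ennreal (min 1 (e * t powr (-n))) * indicator {0..1} t)"
    proof eventually_elim
      case (elim t)
      show ?case
      proof (cases "t \<in> {0..1}")
        case True
        then have "0 < t" "t < 1" using elim by auto
        from segment_transport_slice[OF assms(1-3) n(1) V this]
        have "(\<integral>\<^sup>+x. \<integral>\<^sup>+y. indicator E x * indicator Z y * f (x + t *\<^sub>R (y - x)) \<partial>lborel \<partial>lborel)
          \<le> ennreal (2 ^ DIM('a) * V * min 1 (e * t powr (-n))) * ?F" unfolding e_def .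
        also have "\<dots> = (ennreal (2 ^ DIM('a) * V) * ?F) * ennreal (min 1 (e * t powr (-n)))"
          using e V by (subst ennreal_mult) (auto simp: mult_ac)
        finally show ?thesis using True by simp
      qed simp
    qed
  qed
  also have "\<dots> = (ennreal (2 ^ DIM('a) * V) * ?F) * (\<integral>\<^sup>+t. ennreal (min 1 (e * t powr (-n))) * indicator {0..1} t \<partial>lborel)"
    by (rule nn_integral_cmult) measurable
  also have "\<dots> \<le> (ennreal (2 ^ DIM('a) * V) * ?F) * ennreal (2 * e powr (1/n))"
    by (intro mult_left_mono nn_integral_min_power_le e n) auto
  also have "\<dots> = ennreal (2 * 2 ^ DIM('a) * V * e powr (1/n)) * ?F"
    using V by (simp add: ennreal_mult mult_ac)
  finally show ?thesis unfolding e_def .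
qed

section \<open>Smooth truncation\<close>

definition tent :: "real \<Rightarrow> real" where
  "tent s = max 0 (s - 1) - 2 * max 0 (s - 3/2) + max 0 (s - 2)"

text \<open>
A continuously differentiable truncation: it is constant on both sides of the interval from \<open>1\<close> to
\<open>2\<close> and rises by \<open>1/4\<close> on it. Its derivative is the \<open>tent\<close>. Combinations of squared positive parts
keep the derivative elementary, so no chain rule for Lipschitz functions is needed.
\<close>

definition truncation :: "real \<Rightarrow> real" where
  "truncation s = ((max 0 (s - 1))\<^sup>2 - 2 * (max 0 (s - 3/2))\<^sup>2 + (max 0 (s - 2))\<^sup>2) / 2"

lemma has_real_derivative_pos_part_squared:
  "((\<lambda>s. (max 0 (s - a))\<^sup>2) has_real_derivative 2 * max 0 (x - a)) (at (x::real))"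
proof (cases "x = a")
  case True
  have "((\<lambda>h. (max 0 (a + h - a))\<^sup>2 / h) \<longlongrightarrow> 0) (at 0)"
  proof (rule Lim_null_comparison)
    show "\<forall>\<^sub>F h in at 0. norm ((max 0 (a + h - a))\<^sup>2 / h) \<le> \<bar>h\<bar>"
      by (rule always_eventually) (auto simp: max_def power2_eq_square)
    show "((\<lambda>h. \<bar>h\<bar>) \<longlongrightarrow> 0) (at (0::real))" by (intro tendsto_eq_intros) auto
  qed
  then show ?thesis using True by (simp add: DERIV_def)
next
  case False
  show ?thesis
  proof (cases "x < a")
    case True
    have "((\<lambda>s. 0) has_real_derivative 0) (at x)" by simp
    moreover have "\<forall>\<^sub>F s in nhds x. (0::real) = (max 0 (s - a))\<^sup>2"
      using True by (intro eventually_nhds_in_open[of "{..<a}", THEN eventually_mono]) auto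
    ultimately show ?thesis using True
      by (subst DERIV_cong_ev[OF refl _ refl, symmetric, where f = "\<lambda>s. 0"]) auto
  next
    case False
    then have xa: "x > a" using \<open>x \<noteq> a\<close> by simp
    have "((\<lambda>s. (s - a)\<^sup>2) has_real_derivative 2 * (x - a)) (at x)"
      by (auto intro!: derivative_eq_intros)
    moreover have "\<forall>\<^sub>F s in nhds x. (s - a)\<^sup>2 = (max 0 (s - a))\<^sup>2"
      using xa by (intro eventually_nhds_in_open[of "{a<..}", THEN eventually_mono]) auto
    ultimately show ?thesis using xa
      by (subst DERIV_cong_ev[OF refl _ refl, symmetric, where f = "\<lambda>s. (s - a)\<^sup>2"]) auto
  qed
qed

lemma truncation_deriv: "(truncation has_real_derivative tent s) (at s)"
  unfolding truncation_def[abs_def] tent_def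
  by (rule derivative_eq_intros has_real_derivative_pos_part_squared refl | simp)+

lemma tent_bounds: "0 \<le> tent s" "tent s \<le> 1/2" "tent s \<noteq> 0 \<Longrightarrow> 1 < s \<and> s < 2"
  by (auto simp: tent_def max_def split: if_splits)

lemma continuous_on_tent [continuous_intros]:
  "continuous_on S f \<Longrightarrow> continuous_on S (\<lambda>x. tent (f x))"
  unfolding tent_def by (intro continuous_intros)

lemma truncation_low: "s \<le> 1 \<Longrightarrow> truncation s = 0"
  by (simp add: truncation_def max_def)

lemma truncation_high: "2 \<le> s \<Longrightarrow> truncation s = 1/4"
  by (simp add: truncation_def max_def power2_eq_square algebra_simps)


section \<open>Summation over dyadic levels\<close>

text \<open>
After normalising both sums to \<open>1\<close> all factors are at most \<open>1\<close>, so the exponent may be lowered to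
\<open>1/2\<close>, where the arithmetic-geometric mean inequality applies termwise.
\<close>

lemma sum_powr_mult_le:
  fixes x y :: "nat \<Rightarrow> real"
  assumes \<theta>: "1/2 \<le> \<theta>" and x: "\<And>k. k < N \<Longrightarrow> 0 \<le> x k" and y: "\<And>k. k < N \<Longrightarrow> 0 \<le> y k"
    and X: "0 < X" "(\<Sum>k<N. x k) \<le> X" and Y: "0 < Y" "(\<Sum>k<N. y k) \<le> Y"
  shows "(\<Sum>k<N. (x k * y k) powr \<theta>) \<le> (X * Y) powr \<theta>"
proof -
  have summand: "(x k * y k) powr \<theta> \<le> (X * Y) powr \<theta> * ((x k / X + y k / Y) / 2)" if k: "k < N" for k
  proof -
    let ?a = "x k / X" and ?b = "y k / Y"
    have "x k \<le> (\<Sum>k<N. x k)" "y k \<le> (\<Sum>k<N. y k)"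
      using k x y by (auto intro!: member_le_sum)
    then have ab: "0 \<le> ?a" "?a \<le> 1" "0 \<le> ?b" "?b \<le> 1" using X Y x y k by auto
    then have ab1: "0 \<le> ?a * ?b" "?a * ?b \<le> 1"
      by (blast intro: mult_nonneg_nonneg, blast intro: mult_le_one)
    have "(?a * ?b) powr \<theta> \<le> (?a * ?b) powr (1/2)" using \<theta> ab1 by (intro powr_mono') auto
    also have "\<dots> = sqrt (?a * ?b)" using ab1 by (simp add: powr_half_sqrt)
    also have "\<dots> \<le> (?a + ?b) / 2" using ab by (intro arith_geo_mean_sqrt) auto
    finally have "(X * Y) powr \<theta> * (?a * ?b) powr \<theta> \<le> (X * Y) powr \<theta> * ((?a + ?b) / 2)"
      by (intro mult_left_mono) auto
    moreover have "(X * Y) powr \<theta> * (?a * ?b) powr \<theta> = (x k * y k) powr \<theta>"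
      using X Y by (simp add: powr_mult[symmetric])
    ultimately show ?thesis by simp
  qed
  have "(\<Sum>k<N. (x k * y k) powr \<theta>) \<le> (\<Sum>k<N. (X * Y) powr \<theta> * ((x k / X + y k / Y) / 2))"
    using summand by (intro sum_mono) auto
  also have "\<dots> = (X * Y) powr \<theta> * (((\<Sum>k<N. x k) / X + (\<Sum>k<N. y k) / Y) / 2)"
    by (simp only: sum_distrib_left[symmetric] sum_divide_distrib[symmetric] sum.distrib)
  also have "\<dots> \<le> (X * Y) powr \<theta> * ((1 + 1) / 2)"
    using X Y by (intro mult_left_mono divide_right_mono add_mono) auto
  finally show ?thesis by simp
qed

lemma self_improving_bound:
  fixes S a Q \<theta> :: real
  assumes "0 \<le> S" "0 \<le> a" "0 \<le> Q" "0 < \<theta>" "\<theta> < 1" "S \<le> a + Q * S powr \<theta>"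
  shows "S \<le> 2 * a + (2 * Q) powr (1 / (1 - \<theta>))"
proof (cases "S \<le> 2 * a")
  case True then show ?thesis by (smt (verit) powr_ge_zero)
next
  case False
  then have S: "S > 0" "S \<le> 2 * Q * S powr \<theta>" using assms by auto
  have "S powr (1 - \<theta>) = S / S powr \<theta>" using S by (simp add: powr_diff)
  also have "\<dots> \<le> 2 * Q" using S by (simp add: divide_le_eq)
  finally have "(S powr (1 - \<theta>)) powr (1 / (1 - \<theta>)) \<le> (2 * Q) powr (1 / (1 - \<theta>))"
    using assms by (intro powr_mono2) auto
  then have "S \<le> (2 * Q) powr (1 / (1 - \<theta>))" using S assms by (simp add: powr_powr)
  then show ?thesis using assms by simp
qed

text \<open>
Here \<open>a k\<close> stands for the measure of the superlevel set at height \<open>2 ^ k * \<theta>\<close> and \<open>\<delta> k\<close> for the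
energy in the dyadic layer above it. With \<open>b k = (2 ^ k * \<theta>) powr r * a k\<close> the hypothesis becomes
\<open>b (k + 1) \<le> const * (\<delta> k * b k) powr w\<close> precisely because \<open>r / w = 2 + r\<close>. Summing gives
\<open>S \<le> b 0 + const * (D\<^sup>2 * S) powr w\<close> for the sum \<open>S\<close>, and since \<open>w < 1\<close> this bounds \<open>S\<close> by
itself. This is Maz'ya's truncation argument; it reaches the critical exponent because the layers
share the total energy.
\<close>

lemma dyadic_level_sum:
  fixes a \<delta> :: "nat \<Rightarrow> real" and n \<theta> C D :: real
  assumes n: "2 < n" and C: "0 \<le> C" and D: "0 < D" and \<theta>: "0 < \<theta>"
    and a: "\<And>k. 0 \<le> a k" and \<delta>: "\<And>k. 0 \<le> \<delta> k" "(\<Sum>k<N. \<delta> k) \<le> D\<^sup>2"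
    and step: "\<And>k. k < N \<Longrightarrow> (2 ^ k * \<theta>)\<^sup>2 * a (Suc k) powr (2 - 2/n) \<le> C * \<delta> k * a k"
  defines "r \<equiv> 2 * n / (n - 2)" and "w \<equiv> n / (2 * (n - 1))"
  shows "(\<Sum>k\<le>N. (2 ^ k * \<theta>) powr r * a k) \<le>
    2 * (\<theta> powr r * a 0) + (2 * 2 powr r * C powr w) powr (1 / (1 - w)) * D powr r"
proof -
  have w: "1/2 \<le> w" "0 < w" "w < 1" using n by (auto simp: w_def field_simps)
  have rw: "r / w = 2 + r" "w * (2 - 2/n) = 1" "2 * w / (1 - w) = r"
  proof -
    have "1 - w = (n - 2) / (2 * (n - 1))" using n by (simp add: w_def field_simps)
    then show "2 * w / (1 - w) = r" using n by (simp add: w_def r_def)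
  qed (use n in \<open>auto simp: r_def w_def field_simps\<close>)
  define b where "b = (\<lambda>k. (2 ^ k * \<theta>) powr r * a k)"
  have b0: "b k \<ge> 0" for k using a by (simp add: b_def)
  define S where "S = (\<Sum>k\<le>N. b k)"
  have S0: "S \<ge> 0" using b0 by (simp add: S_def sum_nonneg)
  have next_term: "b (Suc k) \<le> 2 powr r * C powr w * (\<delta> k * b k) powr w" if k: "k < N" for k
  proof -
    define \<tau> where "\<tau> = 2 ^ k * \<theta>"
    have \<tau>: "\<tau> > 0" using \<theta> by (simp add: \<tau>_def)
    have "a (Suc k) powr (2 - 2/n) \<le> C * \<delta> k * a k / \<tau>\<^sup>2"
      using step[OF k, folded \<tau>_def] \<tau> by (simp add: pos_le_divide_eq mult.commute)
    then have "(a (Suc k) powr (2 - 2/n)) powr w \<le> (C * \<delta> k * a k / \<tau>\<^sup>2) powr w"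
      using w by (intro powr_mono2) auto
    then have "a (Suc k) \<le> (C * \<delta> k * a k / \<tau>\<^sup>2) powr w"
      unfolding powr_powr using a[of "Suc k"] rw(2) by (simp add: mult.commute)
    then have "b (Suc k) \<le> (2 * \<tau>) powr r * (C * \<delta> k * a k / \<tau>\<^sup>2) powr w"
      unfolding b_def \<tau>_def by (simp add: mult.assoc mult_left_mono)
    also have "(2 * \<tau>) powr r = 2 powr r * (\<tau> powr (2 + r)) powr w"
      using w unfolding rw(1)[symmetric] powr_powr by (simp add: powr_mult)
    also have "2 powr r * (\<tau> powr (2 + r)) powr w * (C * \<delta> k * a k / \<tau>\<^sup>2) powr w =
      2 powr r * (C * (\<delta> k * b k)) powr w"
    proof -
      have "\<tau> powr (2 + r) * (C * \<delta> k * a k / \<tau>\<^sup>2) = C * (\<delta> k * b k)"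
        using \<tau> by (simp add: b_def \<tau>_def[symmetric] powr_add)
      then show ?thesis by (simp add: powr_mult[symmetric])
    qed
    finally show ?thesis by (simp add: powr_mult)
  qed
  show ?thesis
  proof (cases "S = 0")
    case True
    have "0 \<le> 2 * (\<theta> powr r * a 0) + (2 * 2 powr r * C powr w) powr (1 / (1 - w)) * D powr r"
      using a by (intro add_nonneg_nonneg mult_nonneg_nonneg) auto
    then show ?thesis using True unfolding S_def b_def by simp
  next
    case False
    then have S: "S > 0" using S0 by simp
    have "(\<Sum>k<N. b k) \<le> S" unfolding S_def using b0 by (intro sum_mono2) auto
    then have "(\<Sum>k<N. (\<delta> k * b k) powr w) \<le> (D\<^sup>2 * S) powr w"
      using w \<delta> b0 S D by (intro sum_powr_mult_le) auto
    moreover have "S = b 0 + (\<Sum>k<N. b (Suc k))"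
      unfolding S_def by (simp add: sum.atMost_shift)
    moreover have "(\<Sum>k<N. b (Suc k)) \<le> 2 powr r * C powr w * (\<Sum>k<N. (\<delta> k * b k) powr w)"
      unfolding sum_distrib_left using next_term by (intro sum_mono) auto
    ultimately have "S \<le> b 0 + 2 powr r * C powr w * (D\<^sup>2 * S) powr w"
      by (smt (verit) mult_left_mono mult_nonneg_nonneg powr_ge_zero)
    then have "S \<le> b 0 + (2 powr r * C powr w * (D\<^sup>2) powr w) * S powr w"
      by (simp add: powr_mult mult.assoc)
    then have "S \<le> 2 * b 0 + (2 * (2 powr r * C powr w * (D\<^sup>2) powr w)) powr (1 / (1 - w))"
      using S0 b0 w by (intro self_improving_bound) auto
    also have "(2 * (2 powr r * C powr w * (D\<^sup>2) powr w)) powr (1 / (1 - w)) =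
      (2 * 2 powr r * C powr w) powr (1 / (1 - w)) * ((D\<^sup>2) powr w) powr (1 / (1 - w))"
      by (simp add: powr_mult mult.assoc)
    also have "((D\<^sup>2) powr w) powr (1 / (1 - w)) = D powr r"
    proof -
      have "D\<^sup>2 = D powr 2" using D by simp
      then have "((D\<^sup>2) powr w) powr (1 / (1 - w)) = D powr (2 * w / (1 - w))"
        by (simp only: powr_powr) simp
      then show ?thesis using rw(3) by simp
    qed
    finally show ?thesis unfolding S_def b_def by simp
  qed
qed

section \<open>The Poincare-Sobolev inequality for smooth functions on star-shaped sets\<close>

text \<open>
An open set \<open>U\<close> of measure at most \<open>V\<close> that is star-shaped with respect to every point of the set
\<open>B\<close> of measure at least \<open>\<beta>\<close>. All estimates below depend on \<open>U\<close> and \<open>B\<close> only through \<open>n\<close>, \<open>R\<close>, \<open>V\<close>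
and \<open>\<beta>\<close>, hence hold with the same constants along the exhaustion of a star-shaped set by smaller copies.
\<close>

locale star_region =
  fixes U B :: "'a::euclidean_space set" and n R V \<beta> :: real
  assumes U: "open U" and B: "B \<in> sets borel" "B \<subseteq> U"
    and star: "\<And>x y t. x \<in> U \<Longrightarrow> y \<in> B \<Longrightarrow> t \<in> {0..1} \<Longrightarrow> x + t *\<^sub>R (y - x) \<in> U"
    and R: "\<And>x y. x \<in> U \<Longrightarrow> y \<in> B \<Longrightarrow> norm (y - x) \<le> R" "0 < R"
    and V: "0 < V" "emeasure lborel U \<le> ennreal V"
    and \<beta>: "0 < \<beta>" "\<beta> \<le> measure lborel B"
    and n: "real DIM('a) \<le> n" "2 < n"
begin

lemma finite_measure_subset: "A \<subseteq> U \<Longrightarrow> emeasure lborel A \<le> ennreal V"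
  using V U by (intro order_trans[OF emeasure_mono[of A U lborel]]) auto

lemma emeasure_subset: 
  "A \<subseteq> U \<Longrightarrow> emeasure lborel A = ennreal (measure lborel A)"
  using finite_measure_subset[of A] by (intro emeasure_eq_ennreal_measure) (auto simp: top_unique)

lemma measure_le_V: "A \<subseteq> U \<Longrightarrow> measure lborel A \<le> V"
  using finite_measure_subset[of A] emeasure_subset[of A] V by (simp add: ennreal_le_iff)

lemma Uborel [measurable]: "U \<in> sets borel" using U by simp

end

locale smooth_on_star = star_region U B n R V \<beta> for U B :: "'a::euclidean_space set" and n R V \<beta> +
  fixes v :: "'a \<Rightarrow> real" and F :: "'a \<Rightarrow> 'a"
  assumes deriv: "\<And>x. x \<in> U \<Longrightarrow> (v has_derivative (\<lambda>h. F x \<bullet> h)) (at x)"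
    and F: "continuous_on U F"
begin

lemma v_cont: "continuous_on U v"
  using deriv by (meson continuous_at_imp_continuous_on has_derivative_continuous)

lemma level_sets_borel [measurable]:
  "{x\<in>U. a \<le> v x} \<in> sets borel" "{x\<in>U. a < v x \<and> v x < b} \<in> sets borel" "{x\<in>U. v x \<le> a} \<in> sets borel"
  "{x\<in>B. v x \<le> a} \<in> sets borel" "{x\<in>U. v x < a} \<in> sets borel"
proof -
  have m: "(\<lambda>x. if x \<in> U then v x else 0) \<in> borel_measurable borel"
    using v_cont by (intro borel_measurable_continuous_on_if) auto
  have "{x\<in>U. a \<le> v x} = U \<inter> {x. a \<le> (if x \<in> U then v x else 0)}"
     "{x\<in>U. a < v x \<and> v x < b} = U \<inter> {x. a < (if x \<in> U then v x else 0) \<and> (if x \<in> U then v x else 0) < b}"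
     "{x\<in>U. v x \<le> a} = U \<inter> {x. (if x \<in> U then v x else 0) \<le> a}"
     "{x\<in>U. v x < a} = U \<inter> {x. (if x \<in> U then v x else 0) < a}"
     "{x\<in>B. v x \<le> a} = B \<inter> {x. (if x \<in> U then v x else 0) \<le> a}" using B by auto
  then show "{x\<in>U. a \<le> v x} \<in> sets borel" "{x\<in>U. a < v x \<and> v x < b} \<in> sets borel" "{x\<in>U. v x \<le> a} \<in> sets borel"
    "{x\<in>B. v x \<le> a} \<in> sets borel" "{x\<in>U. v x < a} \<in> sets borel"
    using m B by (simp_all add: sets.Int)
qed

lemma gradient_on_borel [measurable]:
  assumes "A \<in> sets borel" "A \<subseteq> U"
  shows "(\<lambda>x. indicator A x * ennreal (norm (F x))) \<in> borel_measurable borel"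
proof -
  have m: "(\<lambda>x. if x \<in> U then F x else 0) \<in> borel_measurable borel"
    using F by (intro borel_measurable_continuous_on_if) auto
  have "(\<lambda>x. indicator A x * ennreal (norm (F x))) = (\<lambda>x. indicator A x * ennreal (norm (if x \<in> U then F x else 0)))"
    using assms by (intro ext) (auto split: split_indicator)
  then show ?thesis using m assms by simp
qed

text \<open>
On the way from \<open>x\<close>, where \<open>v \<ge> 2 \<theta>\<close>, to \<open>y\<close>, where \<open>v \<le> 0\<close>, the truncation of \<open>v / \<theta>\<close> drops by
\<open>1/4\<close>, and only the part of the segment in the layer \<open>A\<close> contributes to the drop.
\<close>

lemma truncated_rise_along_segment:
  assumes \<theta>: "0 < \<theta>" and x: "x \<in> U" "2 * \<theta> \<le> v x" and y: "y \<in> B" "v y \<le> 0"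
  defines "A \<equiv> {x\<in>U. \<theta> < v x \<and> v x < 2 * \<theta>}"
  shows "ennreal (1/4) \<le> ennreal (R / (2 * \<theta>)) *
    (\<integral>\<^sup>+t. (indicator A (x + t *\<^sub>R (y - x)) * ennreal (norm (F (x + t *\<^sub>R (y - x))))) * indicator {0..1} t \<partial>lborel)"
proof -
  let ?z = "\<lambda>t. x + t *\<^sub>R (y - x)"
  let ?h = "\<lambda>t. truncation (v (?z t) / \<theta>)"
  let ?h' = "\<lambda>t. tent (v (?z t) / \<theta>) * ((F (?z t) \<bullet> (y - x)) / \<theta>)"
  have zU: "?z t \<in> U" if "t \<in> {0..1}" for t using star x y that by auto
  have vz: "((\<lambda>t. v (?z t)) has_real_derivative (F (?z t) \<bullet> (y - x))) (at t)" if "t \<in> {0..1}" for t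
  proof -
    have "(?z has_derivative (\<lambda>h. h *\<^sub>R (y - x))) (at t)"
      by (auto intro!: derivative_eq_intros)
    from has_derivative_compose[OF this deriv[OF zU[OF that]]]
    show ?thesis by (simp add: has_field_derivative_def mult_commute_abs)
  qed
  have dh: "(?h has_vector_derivative ?h' t) (at t within {0..1})" if "t \<in> {0..1}" for t
  proof -
    have "(?h has_real_derivative ?h' t) (at t)"
      by (rule DERIV_chain2[OF truncation_deriv DERIV_cdivide[OF vz[OF that]]])
    then show ?thesis
      by (simp add: has_real_derivative_iff_has_vector_derivative has_vector_derivative_at_within)
  qed
  have cz: "continuous_on {0..1} ?z" by (intro continuous_intros)
  have ch: "continuous_on {0..1} ?h'"
    by (intro continuous_intros continuous_on_compose2[OF v_cont cz] continuous_on_compose2[OF F cz])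
      (use \<theta> zU in auto)
  have hb: "has_bochner_integral lborel (\<lambda>t. indicator {0..1} t *\<^sub>R ?h' t) (?h 1 - ?h 0)"
    using dh by (intro has_bochner_integral_FTC_Icc ch) auto
  have "?h 1 = 0" "?h 0 = 1/4"
    using x y \<theta> by (auto simp: truncation_low truncation_high field_simps divide_le_0_iff intro!: truncation_low truncation_high)
  then have eq: "norm (\<integral>t. indicator {0..1} t *\<^sub>R ?h' t \<partial>lborel) = 1/4"
    using has_bochner_integral_integral_eq[OF hb] by (simp only:) simp
  have "ennreal (1/4) \<le> (\<integral>\<^sup>+t. ennreal (norm (indicator {0..1} t *\<^sub>R ?h' t)) \<partial>lborel)"
    unfolding eq[symmetric] using hb by (intro integral_norm_bound_ennreal) (blast intro: integrable.intros)
  also have "\<dots> \<le> (\<integral>\<^sup>+t. ennreal (R / (2 * \<theta>)) * ((indicator A (?z t) * ennreal (norm (F (?z t)))) * indicator {0..1} t) \<partial>lborel)"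
  proof (rule nn_integral_mono)
    fix t :: real
    show "ennreal (norm (indicator {0..1} t *\<^sub>R ?h' t)) \<le>
      ennreal (R / (2 * \<theta>)) * ((indicator A (?z t) * ennreal (norm (F (?z t)))) * indicator {0..1} t)"
    proof (cases "t \<in> {0..1} \<and> tent (v (?z t) / \<theta>) \<noteq> 0")
      case True
      then have tA: "?z t \<in> A" using tent_bounds(3)[of "v (?z t) / \<theta>"] zU \<theta> by (auto simp: A_def field_simps)
      have "\<bar>F (?z t) \<bullet> (y - x)\<bar> \<le> norm (F (?z t)) * R"
        using Cauchy_Schwarz_ineq2[of "F (?z t)" "y - x"] R(1)[OF x(1) y(1)]
        by (meson mult_left_mono norm_ge_zero order_trans)
      then have "\<bar>?h' t\<bar> \<le> (1/2) * (norm (F (?z t)) * R / \<theta>)"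
        using tent_bounds(1,2)[of "v (?z t) / \<theta>"] \<theta>
        unfolding abs_mult abs_divide by (intro mult_mono) (auto simp: divide_right_mono)
      then have "norm (?h' t) \<le> R / (2 * \<theta>) * norm (F (?z t))" by (simp add: field_simps)
      then have "ennreal (norm (?h' t)) \<le> ennreal (R / (2 * \<theta>)) * ennreal (norm (F (?z t)))"
        using R \<theta> by (subst ennreal_mult[symmetric]) (auto intro: ennreal_leI)
      then show ?thesis using tA True by simp
    qed auto
  qed
  also have "\<dots> = ennreal (R / (2 * \<theta>)) * (\<integral>\<^sup>+t. (indicator A (?z t) * ennreal (norm (F (?z t)))) * indicator {0..1} t \<partial>lborel)"
  proof (rule nn_integral_cmult)
    have "A \<in> sets borel" "A \<subseteq> U" by (auto simp: A_def)
    from measurable_compose[OF _ gradient_on_borel[OF this], of ?z lborel]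
    show "(\<lambda>t. (indicator A (?z t) * ennreal (norm (F (?z t)))) * indicator {0..1} t) \<in> borel_measurable lborel"
      by measurable
  qed
  finally show ?thesis .
qed

text \<open>
The rise along segments, integrated over all \<open>x\<close> in the superlevel set and all \<open>y\<close> in the half of
\<open>B\<close> on which \<open>v\<close> is nonpositive. The transport estimate turns the triple integral into the integral
of the gradient over the layer, times a power of the measure of the superlevel set.
\<close>

lemma level_set_isoperimetry:
  assumes \<theta>: "0 < \<theta>" and half: "\<beta> / 2 \<le> measure lborel {y\<in>B. v y \<le> 0}"
  shows "ennreal (\<theta> * measure lborel {x\<in>U. 2 * \<theta> \<le> v x} powr (1 - 1/n)) \<le>
    ennreal (8 * R * 2 ^ DIM('a) * V powr (1 - 1/n) / \<beta>) *
    (\<integral>\<^sup>+x. indicator {x\<in>U. \<theta> < v x \<and> v x < 2 * \<theta>} x * ennreal (norm (F x)) \<partial>lborel)"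
proof -
  define E where "E = {x\<in>U. 2 * \<theta> \<le> v x}"
  define Z where "Z = {y\<in>B. v y \<le> 0}"
  define A where "A = {x\<in>U. \<theta> < v x \<and> v x < 2 * \<theta>}"
  define f where "f = (\<lambda>x. indicator A x * ennreal (norm (F x)))"
  have [measurable]: "E \<in> sets borel" "Z \<in> sets borel" "A \<in> sets borel" by (auto simp: E_def Z_def A_def)
  have sub: "E \<subseteq> U" "Z \<subseteq> U" "A \<subseteq> U" using B by (auto simp: E_def Z_def A_def)
  have [measurable]: "f \<in> borel_measurable borel" unfolding f_def using sub by (intro gradient_on_borel) auto
  show ?thesis
  proof (cases "measure lborel E = 0")
    case True then show ?thesis by (simp add: E_def)
  next
    case False
    define m where "m = measure lborel E"
    have m: "m > 0" using False by (simp add: m_def zero_less_measure_iff)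
    define I where "I = (\<integral>\<^sup>+x. f x \<partial>lborel)"
    have "ennreal (1/4 * (m * measure lborel Z)) = ennreal m * (ennreal (measure lborel Z) * ennreal (1/4))"
    proof -
      have "1/4 * (m * measure lborel Z) = m * (measure lborel Z * (1/4))" by simp
      then show ?thesis using m by (simp only: ennreal_mult' less_imp_le measure_nonneg)
    qed
    also have "\<dots> = (\<integral>\<^sup>+x. indicator E x * (\<integral>\<^sup>+y. indicator Z y * ennreal (1/4) \<partial>lborel) \<partial>lborel)"
      using sub by (simp add: nn_integral_multc emeasure_subset m_def)
    also have "\<dots> = (\<integral>\<^sup>+x. \<integral>\<^sup>+y. indicator E x * indicator Z y * ennreal (1/4) \<partial>lborel \<partial>lborel)"
      by (subst nn_integral_cmult[symmetric]) (auto simp: mult.assoc)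
    also have "\<dots> \<le> (\<integral>\<^sup>+x. \<integral>\<^sup>+y. ennreal (R / (2 * \<theta>)) * (indicator E x * indicator Z y *
      (\<integral>\<^sup>+t. f (x + t *\<^sub>R (y - x)) * indicator {0..1} t \<partial>lborel)) \<partial>lborel \<partial>lborel)"
    proof (intro nn_integral_mono)
      fix x y
      show "indicator E x * indicator Z y * ennreal (1/4) \<le> ennreal (R / (2 * \<theta>)) * (indicator E x * indicator Z y *
        (\<integral>\<^sup>+t. f (x + t *\<^sub>R (y - x)) * indicator {0..1} t \<partial>lborel))"
      proof (cases "x \<in> E \<and> y \<in> Z")
        case True
        then show ?thesis using truncated_rise_along_segment[OF \<theta>, of x y]
          by (simp add: E_def Z_def f_def A_def)
      qed auto
    qed
    also have "\<dots> = ennreal (R / (2 * \<theta>)) * (\<integral>\<^sup>+x. \<integral>\<^sup>+y. indicator E x * indicator Z y *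
      (\<integral>\<^sup>+t. f (x + t *\<^sub>R (y - x)) * indicator {0..1} t \<partial>lborel) \<partial>lborel \<partial>lborel)"
    proof -
      have "(\<integral>\<^sup>+x. \<integral>\<^sup>+y. ennreal (R / (2 * \<theta>)) * (indicator E x * indicator Z y *
        (\<integral>\<^sup>+t. f (x + t *\<^sub>R (y - x)) * indicator {0..1} t \<partial>lborel)) \<partial>lborel \<partial>lborel) =
        (\<integral>\<^sup>+x. ennreal (R / (2 * \<theta>)) * (\<integral>\<^sup>+y. indicator E x * indicator Z y *
        (\<integral>\<^sup>+t. f (x + t *\<^sub>R (y - x)) * indicator {0..1} t \<partial>lborel) \<partial>lborel) \<partial>lborel)"
        by (intro nn_integral_cong nn_integral_cmult) measurable
      also have "\<dots> = ennreal (R / (2 * \<theta>)) * (\<integral>\<^sup>+x. \<integral>\<^sup>+y. indicator E x * indicator Z y *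
        (\<integral>\<^sup>+t. f (x + t *\<^sub>R (y - x)) * indicator {0..1} t \<partial>lborel) \<partial>lborel \<partial>lborel)"
        by (rule nn_integral_cmult) measurable
      finally show ?thesis .
    qed
    also have "\<dots> \<le> ennreal (R / (2 * \<theta>)) * (ennreal (2 * 2 ^ DIM('a) * V * (m / V) powr (1/n)) * I)"
      unfolding I_def m_def using n V(1)
      by (intro mult_left_mono segment_transport finite_measure_subset sub) auto
    finally have le: "ennreal (1/4 * (m * measure lborel Z)) \<le> \<dots>" .
    show ?thesis
    proof (cases "I = \<infinity>")
      case True
      have "8 * R * 2 ^ DIM('a) * V powr (1 - 1/n) / \<beta> > 0" using R V \<beta> by simp
      then show ?thesis using True R V \<beta> by (auto simp: I_def f_def A_def ennreal_mult_top)
    next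
      case False
      then obtain i where i: "I = ennreal i" "i \<ge> 0" by (cases I) auto
      define P where "P = m powr (1/n)"
      define Q where "Q = V powr (1 - 1/n)"
      define T :: real where "T = 2 ^ DIM('a)"
      have PQ: "P > 0" "Q > 0" using m V by (auto simp: P_def Q_def)
      have VPQ: "V * (m / V) powr (1/n) = Q * P"
        using V m by (simp add: powr_divide powr_diff P_def Q_def)
      have "1/4 * (m * measure lborel Z) \<le> R / (2 * \<theta>) * (2 * T * V * (m / V) powr (1/n) * i)"
        using le R V \<theta> i unfolding T_def by (simp add: ennreal_mult[symmetric] ennreal_le_iff)
      also have "\<dots> = R / (2 * \<theta>) * (2 * T * (V * (m / V) powr (1/n)) * i)" by simp
      also have "\<dots> = R / \<theta> * (T * (Q * P) * i)" unfolding VPQ by simp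
      finally have "1/4 * (m * measure lborel Z) \<le> R / \<theta> * (T * (Q * P) * i)" .
      moreover have "1/4 * (m * (\<beta> / 2)) \<le> 1/4 * (m * measure lborel Z)"
        using half m unfolding Z_def by (intro mult_left_mono) auto
      moreover have "m * \<beta> / 8 = 1/4 * (m * (\<beta> / 2))" by simp
      ultimately have "m * \<beta> / 8 \<le> R / \<theta> * (T * (Q * P) * i)" by linarith
      then have "\<theta> * m \<le> (8 * R * T * Q / \<beta> * i) * P"
        using \<theta> \<beta> by (simp add: field_simps)
      then have "\<theta> * (m / P) \<le> 8 * R * T * Q / \<beta> * i"
        using PQ by (simp add: pos_divide_le_eq)
      moreover have "m / P = m powr (1 - 1/n)" using m by (simp add: powr_diff P_def)
      ultimately have "\<theta> * m powr (1 - 1/n) \<le> 8 * R * 2 ^ DIM('a) * V powr (1 - 1/n) / \<beta> * i"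
        by (simp add: T_def Q_def)
      then have "ennreal (\<theta> * m powr (1 - 1/n)) \<le> ennreal (8 * R * 2 ^ DIM('a) * V powr (1 - 1/n) / \<beta>) * I"
        unfolding i(1) using R V \<beta> i by (subst ennreal_mult[symmetric]) (auto intro: ennreal_leI)
      then show ?thesis by (simp add: m_def E_def I_def f_def A_def)
    qed
  qed
qed

lemma dirichlet_level_estimate:
  assumes \<theta>: "0 < \<theta>" and half: "\<beta> / 2 \<le> measure lborel {y\<in>B. v y \<le> 0}"
    and \<Delta>: "0 \<le> \<Delta>" "(\<integral>\<^sup>+x. indicator {x\<in>U. \<theta> < v x \<and> v x < 2 * \<theta>} x * (ennreal (norm (F x)))\<^sup>2 \<partial>lborel) = ennreal \<Delta>"
  shows "\<theta>\<^sup>2 * measure lborel {x\<in>U. 2 * \<theta> \<le> v x} powr (2 - 2/n) \<le>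
    (8 * R * 2 ^ DIM('a) * V powr (1 - 1/n) / \<beta>)\<^sup>2 * \<Delta> * measure lborel {x\<in>U. \<theta> \<le> v x}"
proof -
  define A where "A = {x\<in>U. \<theta> < v x \<and> v x < 2 * \<theta>}"
  define m where "m = measure lborel {x\<in>U. 2 * \<theta> \<le> v x}"
  define C where "C = 8 * R * 2 ^ DIM('a) * V powr (1 - 1/n) / \<beta>"
  define I where "I = (\<integral>\<^sup>+x. indicator A x * ennreal (norm (F x)) \<partial>lborel)"
  have C: "C \<ge> 0" using R V \<beta> by (simp add: C_def)
  have A[measurable]: "A \<in> sets borel" "A \<subseteq> U" by (auto simp: A_def)
  note gradient_on_borel[OF A, measurable]
  have "I\<^sup>2 = (\<integral>\<^sup>+x. (indicator A x * ennreal (norm (F x))) * indicator A x \<partial>lborel)\<^sup>2"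
    unfolding I_def by (intro arg_cong[where f="\<lambda>x. x\<^sup>2"] nn_integral_cong) (auto simp: indicator_def)
  also have "\<dots> \<le> (\<integral>\<^sup>+x. (indicator A x * ennreal (norm (F x)))\<^sup>2 \<partial>lborel) * (\<integral>\<^sup>+x. (indicator A x)\<^sup>2 \<partial>lborel)"
    by (rule Cauchy_Schwarz_nn_integral) measurable
  also have "(\<integral>\<^sup>+x. (indicator A x * ennreal (norm (F x)))\<^sup>2 \<partial>lborel) = ennreal \<Delta>"
    unfolding \<Delta>(2)[symmetric] A_def by (intro nn_integral_cong) (auto simp: indicator_def)
  also have "(\<integral>\<^sup>+x. (indicator A x)\<^sup>2 \<partial>lborel) = (\<integral>\<^sup>+x. indicator A x \<partial>(lborel::'a measure))"
    by (intro nn_integral_cong) (auto simp: indicator_def)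
  also have "\<dots> = ennreal (measure lborel A)" using A by (simp add: emeasure_subset)
  also have "ennreal \<Delta> * ennreal (measure lborel A) = ennreal (\<Delta> * measure lborel A)"
    using \<Delta> by (simp add: ennreal_mult)
  finally have I2: "I\<^sup>2 \<le> ennreal (\<Delta> * measure lborel A)" .
  then have "I \<noteq> \<infinity>" by (auto simp: power2_eq_square top_unique)
  then obtain i where i: "I = ennreal i" "i \<ge> 0" by (cases I) auto
  have i2: "i\<^sup>2 \<le> \<Delta> * measure lborel A"
    using I2 i \<Delta> by (simp add: ennreal_power ennreal_le_iff)
  have "measure lborel A \<le> measure lborel {x\<in>U. \<theta> \<le> v x}"
    by (intro measure_mono_fmeasurable fmeasurableI) (auto simp: A_def intro: le_less_trans[OF finite_measure_subset])
  then have i3: "i\<^sup>2 \<le> \<Delta> * measure lborel {x\<in>U. \<theta> \<le> v x}"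
    using i2 \<Delta> by (meson mult_left_mono order_trans)
  have "\<theta> * m powr (1 - 1/n) \<le> C * i"
    using level_set_isoperimetry[OF \<theta> half] C i
    unfolding m_def[symmetric] C_def[symmetric] A_def[symmetric] I_def[symmetric]
    by (simp add: ennreal_mult[symmetric] ennreal_le_iff)
  then have "(\<theta> * m powr (1 - 1/n))\<^sup>2 \<le> (C * i)\<^sup>2" using \<theta> by (intro power_mono) auto
  also have "(C * i)\<^sup>2 \<le> C\<^sup>2 * (\<Delta> * measure lborel {x\<in>U. \<theta> \<le> v x})"
    unfolding power_mult_distrib using i3 by (intro mult_left_mono) auto
  also have "(\<theta> * m powr (1 - 1/n))\<^sup>2 = \<theta>\<^sup>2 * m powr (2 - 2/n)"
  proof -
    have "2 - 2/n = (1 - 1/n) + (1 - 1/n)" by simp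
    then show ?thesis by (simp only: power_mult_distrib power2_eq_square powr_add mult_ac)
  qed
  finally show ?thesis by (simp add: m_def C_def mult_ac)
qed

end

context star_region
begin

definition exponent :: real where "exponent = 2 * n / (n - 2)"

definition level_const :: real where
  "level_const = (8 * R * 2 ^ DIM('a) * V powr (1 - 1/n) / \<beta>)\<^sup>2"

definition half_const :: real where
  "half_const = 2 powr exponent *
    (2 * 2 powr exponent * level_const powr (n / (2 * (n - 1)))) powr (1 / (1 - n / (2 * (n - 1))))"

end

context smooth_on_star
begin

lemma positive_part_dyadic:
  fixes \<theta> :: real
  assumes \<theta>: "0 < \<theta>" and bdd: "\<And>x. x \<in> U \<Longrightarrow> v x < 2 ^ Suc N * \<theta>" and r: "0 < r"
  shows "(\<integral>\<^sup>+x. indicator U x * ennreal ((max 0 (v x)) powr r) \<partial>lborel) \<le>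
    ennreal (\<theta> powr r * V + (\<Sum>k\<le>N. (2 ^ Suc k * \<theta>) powr r * measure lborel {x\<in>U. 2 ^ k * \<theta> \<le> v x}))"
proof -
  let ?L = "\<lambda>k. {x\<in>U. 2 ^ k * \<theta> \<le> v x}"
  let ?h = "\<lambda>x. ennreal (\<theta> powr r) * indicator U x + (\<Sum>k\<le>N. ennreal ((2 ^ Suc k * \<theta>) powr r) * indicator (?L k) x)"
  have pt: "indicator U x * ennreal ((max 0 (v x)) powr r) \<le> ?h x" for x
  proof (cases "x \<in> U")
    case xU: True
    show ?thesis
    proof (cases "v x < \<theta>")
      case True
      then have "(max 0 (v x)) powr r \<le> \<theta> powr r" using \<theta> r by (intro powr_mono2) auto
      then show ?thesis using xU by (auto intro!: add_increasing2 ennreal_leI)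
    next
      case False
      define k where "k = (LEAST k. v x < 2 ^ Suc k * \<theta>)"
      have k: "v x < 2 ^ Suc k * \<theta>" unfolding k_def by (rule LeastI[of _ N]) (rule bdd[OF xU])
      have kN: "k \<le> N" unfolding k_def by (rule Least_le) (rule bdd[OF xU])
      have "2 ^ k * \<theta> \<le> v x"
      proof (cases k)
        case 0 then show ?thesis using False by simp
      next
        case (Suc j)
        then have "\<not> v x < 2 ^ Suc j * \<theta>" using not_less_Least[of j "\<lambda>k. v x < 2 ^ Suc k * \<theta>"] by (simp add: k_def)
        then show ?thesis using Suc by simp
      qed
      then have "x \<in> ?L k" using xU by simp
      have "(max 0 (v x)) powr r \<le> (2 ^ Suc k * \<theta>) powr r" using k \<theta> r by (intro powr_mono2) auto
      then have "indicator U x * ennreal ((max 0 (v x)) powr r) \<le> ennreal ((2 ^ Suc k * \<theta>) powr r) * indicator (?L k) x"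
        using xU \<open>x \<in> ?L k\<close> by (simp add: ennreal_leI)
      also have "\<dots> \<le> (\<Sum>k\<le>N. ennreal ((2 ^ Suc k * \<theta>) powr r) * indicator (?L k) x)"
        using kN by (intro member_le_sum) auto
      finally show ?thesis by (auto intro: add_increasing)
    qed
  qed auto
  have "(\<integral>\<^sup>+x. indicator U x * ennreal ((max 0 (v x)) powr r) \<partial>lborel) \<le> (\<integral>\<^sup>+x. ?h x \<partial>lborel)"
    by (intro nn_integral_mono pt)
  also have "\<dots> = ennreal (\<theta> powr r) * emeasure lborel U + (\<Sum>k\<le>N. ennreal ((2 ^ Suc k * \<theta>) powr r) * emeasure lborel (?L k))"
  proof -
    have "(\<integral>\<^sup>+x. ?h x \<partial>lborel) = (\<integral>\<^sup>+x. ennreal (\<theta> powr r) * indicator U x \<partial>lborel) +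
      (\<integral>\<^sup>+x. (\<Sum>k\<le>N. ennreal ((2 ^ Suc k * \<theta>) powr r) * indicator (?L k) x) \<partial>lborel)"
      by (rule nn_integral_add) measurable
    also have "(\<integral>\<^sup>+x. (\<Sum>k\<le>N. ennreal ((2 ^ Suc k * \<theta>) powr r) * indicator (?L k) x) \<partial>lborel) =
      (\<Sum>k\<le>N. \<integral>\<^sup>+x. ennreal ((2 ^ Suc k * \<theta>) powr r) * indicator (?L k) x \<partial>lborel)"
      by (rule nn_integral_sum) measurable
    finally show ?thesis by (simp add: nn_integral_cmult_indicator)
  qed
  also have "\<dots> \<le> ennreal (\<theta> powr r) * ennreal V + (\<Sum>k\<le>N. ennreal ((2 ^ Suc k * \<theta>) powr r) * ennreal (measure lborel (?L k)))"
    using V by (intro add_mono sum_mono mult_left_mono) (auto simp: emeasure_subset)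
  also have "\<dots> = ennreal (\<theta> powr r * V + (\<Sum>k\<le>N. (2 ^ Suc k * \<theta>) powr r * measure lborel (?L k)))"
    using V by (simp add: ennreal_mult[symmetric] sum_nonneg ennreal_plus[symmetric] del: ennreal_plus)
  finally show ?thesis .
qed

text \<open>
The dyadic levels start at an arbitrary height \<open>\<theta> > 0\<close>, because a sum over all negative powers of
\<open>2\<close> would have no first term. What lies below \<open>\<theta>\<close> is of order \<open>\<theta> powr exponent\<close> and disappears
as \<open>\<theta>\<close> tends to \<open>0\<close>.
\<close>

lemma positive_part_bound:
  assumes half: "\<beta> / 2 \<le> measure lborel {y\<in>B. v y \<le> 0}" and bdd: "\<And>x. x \<in> U \<Longrightarrow> v x \<le> K"
    and D: "0 < D" "(\<integral>\<^sup>+x. indicator U x * (ennreal (norm (F x)))\<^sup>2 \<partial>lborel) \<le> ennreal (D\<^sup>2)"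
  shows "(\<integral>\<^sup>+x. indicator U x * ennreal ((max 0 (v x)) powr exponent) \<partial>lborel) \<le>
    ennreal (half_const * D powr exponent)"
proof -
  define r where "r = exponent"
  have r: "0 < r" using n by (simp add: r_def exponent_def)
  define L where "L = (\<integral>\<^sup>+x. indicator U x * ennreal ((max 0 (v x)) powr r) \<partial>lborel)"
  note gradient_on_borel[OF Uborel order_refl, measurable]
  have bound: "L \<le> ennreal (\<theta> powr r * V * (1 + 2 powr r * 2) + half_const * D powr r)" if \<theta>: "0 < \<theta>" for \<theta>
  proof -
    obtain N where "K / \<theta> < 2 ^ N" using real_arch_pow[of 2 "K / \<theta>"] by auto
    then have "K < 2 ^ N * \<theta>" using \<theta> by (simp add: field_simps)
    then have N: "v x < 2 ^ Suc N * \<theta>" if "x \<in> U" for x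
    proof -
      have "2 ^ N * \<theta> \<le> 2 ^ Suc N * \<theta>" using \<theta> by simp
      then show ?thesis using bdd[OF that] \<open>K < 2 ^ N * \<theta>\<close> by linarith
    qed
    define a where "a = (\<lambda>k::nat. measure lborel {x\<in>U. 2 ^ k * \<theta> \<le> v x})"
    let ?A = "\<lambda>k::nat. {x\<in>U. 2 ^ k * \<theta> < v x \<and> v x < 2 * (2 ^ k * \<theta>)}"
    let ?\<delta> = "\<lambda>k. \<integral>\<^sup>+x. indicator (?A k) x * (ennreal (norm (F x)))\<^sup>2 \<partial>lborel"
    have meas: "(\<lambda>x. indicator (?A k) x * (ennreal (norm (F x)))\<^sup>2) \<in> borel_measurable borel" for k
    proof -
      have "(\<lambda>x. (indicator (?A k) x * ennreal (norm (F x)))\<^sup>2) \<in> borel_measurable borel"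
        unfolding power2_eq_square
        by (intro borel_measurable_times_ennreal gradient_on_borel level_sets_borel) auto
      moreover have "(\<lambda>x. (indicator (?A k) x * ennreal (norm (F x)))\<^sup>2) = (\<lambda>x. indicator (?A k) x * (ennreal (norm (F x)))\<^sup>2)"
        by (intro ext) (auto split: split_indicator)
      ultimately show ?thesis by (simp only:)
    qed
    have sum_le: "(\<Sum>k<N. ?\<delta> k) \<le> ennreal (D\<^sup>2)"
    proof -
      define A where "A = ?A"
      have disj: "disjoint_family_on A {..<N}"
      proof -
        have "A j \<inter> A k = {}" if "j < k" for j k
        proof -
          have "(2::real) ^ Suc j \<le> 2 ^ k" using that by (intro power_increasing) auto
          then have "2 ^ Suc j * \<theta> \<le> 2 ^ k * \<theta>" using \<theta> by (intro mult_right_mono) auto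
          then have "2 * (2 ^ j * \<theta>) \<le> 2 ^ k * \<theta>" by simp
          then show ?thesis unfolding A_def by fastforce
        qed
        then have "A j \<inter> A k = {}" if "j \<noteq> k" for j k
          using that by (cases j k rule: linorder_cases) (blast+)
        then show ?thesis by (simp add: disjoint_family_on_def)
      qed
      have AU: "A k \<subseteq> U" for k by (auto simp: A_def)
      have "(\<Sum>k<N. ?\<delta> k) = (\<integral>\<^sup>+x. (\<Sum>k<N. indicator (A k) x * (ennreal (norm (F x)))\<^sup>2) \<partial>lborel)"
        unfolding A_def by (rule nn_integral_sum[symmetric]) (simp only: measurable_lborel1 measurable_lborel2 meas)
      also have "\<dots> \<le> (\<integral>\<^sup>+x. indicator U x * (ennreal (norm (F x)))\<^sup>2 \<partial>lborel)"
      proof (rule nn_integral_mono)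
        fix x
        have "(\<Sum>k<N. indicator (A k) x) = (indicator (\<Union>k<N. A k) x :: ennreal)"
          using disj by (intro indicator_UN_disjoint[symmetric]) auto
        also have "\<dots> \<le> indicator U x" using AU by (auto split: split_indicator)
        finally show "(\<Sum>k<N. indicator (A k) x * (ennreal (norm (F x)))\<^sup>2) \<le> indicator U x * (ennreal (norm (F x)))\<^sup>2"
          unfolding sum_distrib_right[symmetric] by (rule mult_right_mono) simp
      qed
      finally show ?thesis using D(2) by (rule order_trans)
    qed
    have fin: "?\<delta> k = ennreal (enn2real (?\<delta> k))" for k
    proof -
      have "?\<delta> k \<le> (\<integral>\<^sup>+x. indicator U x * (ennreal (norm (F x)))\<^sup>2 \<partial>lborel)"
        by (intro nn_integral_mono) (auto simp: indicator_def)
      also note D(2)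
      finally show ?thesis by (intro ennreal_enn2real[symmetric]) (auto simp: less_top[symmetric] top_unique)
    qed
    define B where "B = (2 * 2 powr r * level_const powr (n / (2 * (n - 1)))) powr (1 / (1 - n / (2 * (n - 1))))"
    have half_const: "half_const = 2 powr r * B" by (simp add: half_const_def B_def r_def)
    have dyadic: "(\<Sum>k\<le>N. (2 ^ k * \<theta>) powr r * a k) \<le> 2 * (\<theta> powr r * a 0) + B * D powr r"
      unfolding B_def r_def exponent_def
    proof (rule dyadic_level_sum[where \<delta> = "\<lambda>k. enn2real (?\<delta> k)"])
      have "(\<Sum>k<N. ?\<delta> k) = (\<Sum>k<N. ennreal (enn2real (?\<delta> k)))"
        by (rule sum.cong[OF refl fin])
      also have "\<dots> = ennreal (\<Sum>k<N. enn2real (?\<delta> k))" by (rule sum_ennreal) simp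
      finally have "ennreal (\<Sum>k<N. enn2real (?\<delta> k)) \<le> ennreal (D\<^sup>2)" using sum_le by (simp only:)
      then show "(\<Sum>k<N. enn2real (?\<delta> k)) \<le> D\<^sup>2" by (subst (asm) ennreal_le_iff) auto
      fix k
      have "0 < 2 ^ k * \<theta>" using \<theta> by simp
      from dirichlet_level_estimate[OF this half _ fin]
      show "(2 ^ k * \<theta>)\<^sup>2 * a (Suc k) powr (2 - 2/n) \<le> level_const * enn2real (?\<delta> k) * a k"
        unfolding a_def level_const_def by (simp add: mult.assoc)
    qed (use n D \<theta> in \<open>auto simp: a_def level_const_def\<close>)
    have S: "2 powr r * (\<Sum>k\<le>N. (2 ^ k * \<theta>) powr r * a k) \<le> 2 powr r * (2 * (\<theta> powr r * a 0)) + half_const * D powr r"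
      using mult_left_mono[OF dyadic, of "2 powr r"] unfolding half_const by (simp only: distrib_left mult.assoc powr_ge_zero)
    have "a 0 \<le> V" unfolding a_def by (intro measure_le_V) auto
    then have "2 powr r * (2 * (\<theta> powr r * a 0)) \<le> 2 powr r * (2 * (\<theta> powr r * V))"
      by (intro mult_left_mono) auto
    moreover have "(\<Sum>k\<le>N. (2 ^ Suc k * \<theta>) powr r * a k) = 2 powr r * (\<Sum>k\<le>N. (2 ^ k * \<theta>) powr r * a k)"
    proof -
      have "(2 ^ Suc k * \<theta>) powr r * a k = 2 powr r * ((2 ^ k * \<theta>) powr r * a k)" for k
        by (simp only: power_Suc mult.assoc powr_mult)
      then show ?thesis by (simp only: sum_distrib_left)
    qed
    moreover have "\<theta> powr r * V * (1 + 2 powr r * 2) = \<theta> powr r * V + 2 powr r * (2 * (\<theta> powr r * V))"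
      by (simp add: algebra_simps)
    ultimately have "\<theta> powr r * V + (\<Sum>k\<le>N. (2 ^ Suc k * \<theta>) powr r * a k) \<le>
      \<theta> powr r * V * (1 + 2 powr r * 2) + half_const * D powr r"
      using S by linarith
    with positive_part_dyadic[OF \<theta> N r] show ?thesis
      unfolding L_def a_def by (meson ennreal_leI order_trans)
  qed
  have "((\<lambda>\<theta>. ennreal (\<theta> powr r * V * (1 + 2 powr r * 2) + half_const * D powr r)) \<longlongrightarrow>
     ennreal (0 * V * (1 + 2 powr r * 2) + half_const * D powr r)) (at_right 0)"
    using r by (intro tendsto_intros tendsto_ennrealI tendsto_zero_powrI[where b=r])
       (auto simp: eventually_at_filter)
  then have "L \<le> ennreal (0 * V * (1 + 2 powr r * 2) + half_const * D powr r)"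
    by (rule tendsto_lowerbound) (auto intro!: eventually_at_rightI[of 0 1] bound)
  then show ?thesis by (simp add: L_def r_def)
qed

end


text \<open>
The median is the infimum of the levels below which at least half of \<open>B\<close> lies. Continuity of the measure
from above gives the first inequality, continuity from below the second one.
\<close>

lemma median_exists:
  fixes f :: "'a \<Rightarrow> real"
  assumes B: "B \<in> sets M" "emeasure M B \<noteq> \<infinity>" "0 < measure M B"
    and f: "\<And>c. {x\<in>B. f x \<le> c} \<in> sets M" and K: "\<And>x. x \<in> B \<Longrightarrow> \<bar>f x\<bar> \<le> K"
  shows "\<exists>c. measure M B / 2 \<le> measure M {x\<in>B. f x \<le> c} \<and> measure M B / 2 \<le> measure M {x\<in>B. c \<le> f x}"
proof -
  define m where "m = (\<lambda>c. measure M {x\<in>B. f x \<le> c})"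
  have fin: "emeasure M A \<noteq> \<infinity>" if "A \<subseteq> B" for A
    using emeasure_mono[OF that B(1)] B(2) by (auto simp: top_unique)
  have fm: "{x\<in>B. f x \<le> c} \<in> fmeasurable M" for c
    by (intro fmeasurableI f) (use fin[of "{x\<in>B. f x \<le> c}"] in \<open>auto simp: less_top[symmetric]\<close>)
  have mono: "m c \<le> m c'" if "c \<le> c'" for c c'
    unfolding m_def using that by (intro measure_mono_fmeasurable f fm) auto
  define S where "S = {c. measure M B / 2 \<le> m c}"
  have KS: "K \<in> S"
  proof -
    have "{x\<in>B. f x \<le> K} = B" using K by force
    then show ?thesis using B by (simp add: S_def m_def)
  qed
  have lower: "- K - 1 \<le> c" if "c \<in> S" for c
  proof (rule ccontr)
    assume "\<not> - K - 1 \<le> c"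
    then have "{x\<in>B. f x \<le> c} = {}" using K by force
    then have "m c = 0" by (simp only: m_def measure_empty)
    then show False using that B by (simp add: S_def)
  qed
  define c where "c = Inf S"
  have bdd: "bdd_below S" using lower by (auto simp: bdd_below_def)
  have above: "measure M B / 2 \<le> m c'" if "c < c'" for c'
  proof -
    obtain d where "d \<in> S" "d < c'" using \<open>c < c'\<close> KS cInf_lessD[of S c'] by (auto simp: c_def)
    then show ?thesis using mono[of d c'] by (auto simp: S_def)
  qed
  have below: "m c' < measure M B / 2" if "c' < c" for c'
    using that cInf_lower[OF _ bdd, of c'] by (force simp: S_def c_def)
  have "measure M B / 2 \<le> measure M {x\<in>B. f x \<le> c}"
  proof -
    let ?A = "\<lambda>j. {x\<in>B. f x \<le> c + 1 / real (Suc j)}"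
    have "(\<lambda>j. measure M (?A j)) \<longlonglongrightarrow> measure M (\<Inter>j. ?A j)"
    proof (rule Lim_measure_decseq)
      show "decseq ?A"
      proof (rule decseq_SucI)
        fix j :: nat
        have "1 / real (Suc (Suc j)) \<le> 1 / real (Suc j)" by (intro divide_left_mono) auto
        then show "?A (Suc j) \<subseteq> ?A j" by fastforce
      qed
    qed (use f fin in auto)
    moreover have "(\<Inter>j. ?A j) = {x\<in>B. f x \<le> c}"
    proof (intro set_eqI iffI)
      fix x assume x: "x \<in> (\<Inter>j. ?A j)"
      then have "f x \<le> c + 1 / real (Suc j)" for j by blast
      moreover have "(\<lambda>j. c + 1 / real (Suc j)) \<longlonglongrightarrow> c + 0"
        by (intro tendsto_intros LIMSEQ_Suc lim_1_over_n)
      ultimately have "f x \<le> c + 0" by (intro LIMSEQ_le_const) auto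
      then show "x \<in> {x\<in>B. f x \<le> c}" using x by auto
    qed (auto intro: add_increasing2)
    ultimately show ?thesis
      using above by (intro LIMSEQ_le_const[where X="\<lambda>j. measure M (?A j)"]) (auto simp: m_def)
  qed
  moreover have "measure M B / 2 \<le> measure M {x\<in>B. c \<le> f x}"
  proof -
    let ?A = "\<lambda>j. {x\<in>B. f x \<le> c - 1 / real (Suc j)}"
    have lim: "(\<lambda>j. measure M (?A j)) \<longlonglongrightarrow> measure M (\<Union>j. ?A j)"
    proof (rule Lim_measure_incseq)
      show "incseq ?A"
      proof (rule incseq_SucI)
        fix j :: nat
        have "1 / real (Suc (Suc j)) \<le> 1 / real (Suc j)" by (intro divide_left_mono) auto
        then show "?A j \<subseteq> ?A (Suc j)" by fastforce
      qed
      show "emeasure M (\<Union>j. ?A j) \<noteq> \<infinity>" by (rule fin) auto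
    qed (use f in auto)
    have Un: "(\<Union>j. ?A j) = {x\<in>B. f x < c}"
    proof (intro set_eqI iffI)
      fix x assume x: "x \<in> {x\<in>B. f x < c}"
      then have "0 < c - f x" by simp
      then obtain j where "1 / real (Suc j) < c - f x" using nat_approx_posE by blast
      then show "x \<in> (\<Union>j. ?A j)" using x by (auto intro!: exI[of _ j])
    next
      fix x assume "x \<in> (\<Union>j. ?A j)"
      then obtain j where "x \<in> B" "f x \<le> c - 1 / real (Suc j)" by auto
      moreover have "0 < 1 / real (Suc j)" by simp
      ultimately show "x \<in> {x\<in>B. f x < c}" by (auto intro: le_less_trans)
    qed
    have "measure M (\<Union>j. ?A j) \<le> measure M B / 2"
    proof (rule LIMSEQ_le_const2[OF lim])
      have "measure M (?A j) \<le> measure M B / 2" for j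
        using below[of "c - 1 / real (Suc j)"] by (simp add: m_def)
      then show "\<exists>N. \<forall>j\<ge>N. measure M (?A j) \<le> measure M B / 2" by blast
    qed
    moreover have "(\<Union>j. ?A j) \<in> sets M" using f by auto
    then have "measure M (B - {x\<in>B. f x < c}) = measure M B - measure M {x\<in>B. f x < c}"
      unfolding Un using B fin[of "{x\<in>B. f x < c}"] by (intro measure_Diff) auto
    moreover have "B - {x\<in>B. f x < c} = {x\<in>B. c \<le> f x}" by auto
    ultimately show ?thesis unfolding Un by simp
  qed
  ultimately show ?thesis by blast
qed

text \<open>
Subtracting the median over \<open>B\<close> makes both \<open>v - c\<close> and \<open>c - v\<close> nonpositive on half of \<open>B\<close>, so the
one-sided bound applies to the positive and the negative part of \<open>v - c\<close>.
\<close>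

lemma (in smooth_on_star) poincare_sobolev_smooth:
  assumes bdd: "\<And>x. x \<in> U \<Longrightarrow> \<bar>v x\<bar> \<le> K"
    and D: "0 < D" "(\<integral>\<^sup>+x. indicator U x * (ennreal (norm (F x)))\<^sup>2 \<partial>lborel) \<le> ennreal (D\<^sup>2)"
  shows "\<exists>c. (\<integral>\<^sup>+x. indicator U x * ennreal (\<bar>v x - c\<bar> powr exponent) \<partial>lborel) \<le>
    ennreal (2 * half_const * D powr exponent)"
proof -
  have mB: "0 < measure lborel B" using \<beta> by simp
  have "emeasure lborel B \<noteq> \<infinity>" using emeasure_subset[OF B(2)] by simp
  then obtain c where c: "measure lborel B / 2 \<le> measure lborel {x\<in>B. v x \<le> c}"
    "measure lborel B / 2 \<le> measure lborel {x\<in>B. c \<le> v x}"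
    using median_exists[of B lborel v K] B mB bdd by auto
  interpret above: smooth_on_star U B n R V \<beta> "\<lambda>x. v x - c" F
  proof unfold_locales
    fix x assume "x \<in> U"
    then show "((\<lambda>x. v x - c) has_derivative (\<lambda>h. F x \<bullet> h)) (at x)"
      by (auto intro!: derivative_eq_intros deriv)
  qed (rule F)
  interpret below: smooth_on_star U B n R V \<beta> "\<lambda>x. c - v x" "\<lambda>x. - F x"
  proof unfold_locales
    fix x assume "x \<in> U"
    then show "((\<lambda>x. c - v x) has_derivative (\<lambda>h. - F x \<bullet> h)) (at x)"
      by (auto intro!: derivative_eq_intros deriv)
  qed (intro continuous_intros F)
  have m: "(\<lambda>x. if x \<in> U then v x else 0) \<in> borel_measurable borel"
    using v_cont by (intro borel_measurable_continuous_on_if) auto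
  have meas: "(\<lambda>x. indicator U x * ennreal ((max 0 (g (v x))) powr exponent)) \<in> borel_measurable borel"
    if "g \<in> borel_measurable borel" for g :: "real \<Rightarrow> real"
  proof -
    have "(\<lambda>x. indicator U x * ennreal ((max 0 (g (if x \<in> U then v x else 0))) powr exponent)) \<in> borel_measurable borel"
      using measurable_compose[OF m that] by measurable
    moreover have "(\<lambda>x. indicator U x * ennreal ((max 0 (g (if x \<in> U then v x else 0))) powr exponent)) =
      (\<lambda>x. indicator U x * ennreal ((max 0 (g (v x))) powr exponent))"
      by (intro ext) (auto split: split_indicator)
    ultimately show ?thesis by (simp only:)
  qed
  let ?p = "\<lambda>x. indicator U x * ennreal ((max 0 (v x - c)) powr exponent)"
  let ?m = "\<lambda>x. indicator U x * ennreal ((max 0 (c - v x)) powr exponent)"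
  have "(\<integral>\<^sup>+x. indicator U x * ennreal (\<bar>v x - c\<bar> powr exponent) \<partial>lborel) \<le> (\<integral>\<^sup>+x. ?p x + ?m x \<partial>lborel)"
    by (intro nn_integral_mono) (auto split: split_indicator simp: abs_if max_def)
  also have "\<dots> = (\<integral>\<^sup>+x. ?p x \<partial>lborel) + (\<integral>\<^sup>+x. ?m x \<partial>lborel)"
    using meas[of "\<lambda>t. t - c"] meas[of "\<lambda>t. c - t"] by (intro nn_integral_add) auto
  also have "\<dots> \<le> ennreal (half_const * D powr exponent) + ennreal (half_const * D powr exponent)"
  proof (rule add_mono)
    show "(\<integral>\<^sup>+x. ?p x \<partial>lborel) \<le> ennreal (half_const * D powr exponent)"
    proof (rule above.positive_part_bound[OF _ _ D])
      show "\<beta> / 2 \<le> measure lborel {y\<in>B. v y - c \<le> 0}" using c(1) \<beta> by simp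
      show "v x - c \<le> K - c" if "x \<in> U" for x using bdd[OF that] by simp
    qed
    show "(\<integral>\<^sup>+x. ?m x \<partial>lborel) \<le> ennreal (half_const * D powr exponent)"
    proof (rule below.positive_part_bound[OF _ _ D(1)])
      show "\<beta> / 2 \<le> measure lborel {y\<in>B. c - v y \<le> 0}" using c(2) \<beta> by simp
      show "c - v x \<le> c + K" if "x \<in> U" for x using bdd[OF that] by simp
    qed (use D in simp)
  qed
  also have "\<dots> = ennreal (2 * half_const * D powr exponent)"
    by (simp add: ennreal_plus[symmetric] half_const_def del: ennreal_plus)
  finally show ?thesis by blast
qed

section \<open>Bump functions and mollifiers\<close>

text \<open>
The usual flat function \<open>exp (- 1 / t)\<close> and its quotients by powers of \<open>t\<close>. This family is closed
under differentiation up to linear combinations.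
\<close>

definition flat_exp :: "nat \<Rightarrow> real \<Rightarrow> real" where
  "flat_exp n t = (if 0 < t then inverse t ^ n * exp (- inverse t) else 0)"

lemma flat_exp_nonneg: "0 \<le> flat_exp n t"
  by (simp add: flat_exp_def)

lemma flat_exp_tendsto_zero: "(flat_exp n \<longlongrightarrow> 0) (at 0)"
proof -
  have "((\<lambda>t::real. inverse t ^ n / exp (inverse t)) \<longlongrightarrow> 0) (at_right 0)"
    using filterlim_compose[OF tendsto_power_div_exp_0 filterlim_inverse_at_top_right, of n] .
  then have "(flat_exp n \<longlongrightarrow> 0) (at_right 0)"
  proof (rule Lim_transform_eventually)
    show "\<forall>\<^sub>F t in at_right 0. inverse t ^ n / exp (inverse t) = flat_exp n t"
      by (rule eventually_at_rightI[of 0 1]) (auto simp: flat_exp_def exp_minus divide_inverse)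
  qed
  moreover have "(flat_exp n \<longlongrightarrow> 0) (at_left 0)"
  proof (rule Lim_transform_eventually[OF tendsto_const])
    show "\<forall>\<^sub>F t in at_left 0. 0 = flat_exp n t"
      by (rule eventually_at_leftI[of "-1" 0]) (auto simp: flat_exp_def)
  qed
  ultimately show ?thesis by (simp add: filterlim_at_split)
qed

lemma flat_exp_deriv:
  "(flat_exp n has_real_derivative (- real n * flat_exp (n + 1) t + flat_exp (n + 2) t)) (at t)"
proof -
  consider "t > 0" | "t < 0" | "t = 0" by linarith
  then show ?thesis
  proof cases
    case 1
    have inv: "(inverse has_real_derivative - (inverse t)\<^sup>2) (at t)"
      using 1 DERIV_inverse[of t] by (simp add: power2_eq_square)
    have eq: "real n * (- (inverse t)\<^sup>2 * inverse t ^ (n - Suc 0)) * exp (- inverse t) +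
      exp (- inverse t) * - (- (inverse t)\<^sup>2) * inverse t ^ n =
      - real n * flat_exp (n + 1) t + flat_exp (n + 2) t"
      using 1 by (cases n) (simp_all add: flat_exp_def power2_eq_square algebra_simps)
    have d: "((\<lambda>t. inverse t ^ n * exp (- inverse t)) has_real_derivative
      - real n * flat_exp (n + 1) t + flat_exp (n + 2) t) (at t)"
      by (rule DERIV_cong[OF DERIV_mult[OF DERIV_power[OF inv, of n] DERIV_chain2[OF DERIV_exp DERIV_minus[OF inv]]] eq])
    have ev: "\<forall>\<^sub>F s in nhds t. inverse s ^ n * exp (- inverse s) = flat_exp n s"
      using 1 by (intro eventually_nhds_in_open[of "{0<..}", THEN eventually_mono]) (auto simp: flat_exp_def)
    show ?thesis by (rule DERIV_cong_ev[OF refl ev refl, THEN iffD1, OF d])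
  next
    case 2
    have d: "((\<lambda>t. 0) has_real_derivative (- real n * flat_exp (n + 1) t + flat_exp (n + 2) t)) (at t)"
      using 2 by (simp add: flat_exp_def)
    have ev: "\<forall>\<^sub>F s in nhds t. 0 = flat_exp n s"
      using 2 by (intro eventually_nhds_in_open[of "{..<0}", THEN eventually_mono]) (auto simp: flat_exp_def)
    show ?thesis by (rule DERIV_cong_ev[OF refl ev refl, THEN iffD1, OF d])
  next
    case 3
    have eq: "(\<lambda>h. (flat_exp n (0 + h) - flat_exp n 0) / h) = flat_exp (n + 1)"
    proof
      fix h :: real
      show "(flat_exp n (0 + h) - flat_exp n 0) / h = flat_exp (n + 1) h"
        by (cases "0 < h") (simp_all add: flat_exp_def divide_inverse mult_ac)
    qed
    have "- real n * flat_exp (n + 1) 0 + flat_exp (n + 2) 0 = 0" by (simp add: flat_exp_def)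
    then show ?thesis using flat_exp_tendsto_zero[of "n + 1"] unfolding 3 DERIV_def eq by (simp only:)
  qed
qed

lemma continuous_on_flat_exp [continuous_intros]:
  "continuous_on S f \<Longrightarrow> continuous_on S (\<lambda>x. flat_exp n (f x))"
proof -
  assume f: "continuous_on S f"
  have "continuous_on UNIV (flat_exp n)"
    by (intro continuous_at_imp_continuous_on ballI) (rule DERIV_isCont[OF flat_exp_deriv])
  from continuous_on_compose2[OF this f] show ?thesis by simp
qed

text \<open>
An algebra of functions that contains the bump functions and is closed under partial derivatives.
Membership therefore gives derivatives of all orders at once.
\<close>

inductive bump_algebra :: "('a::euclidean_space \<Rightarrow> real) \<Rightarrow> bool" where
  const: "bump_algebra (\<lambda>x. c)"
| linear: "bump_algebra (\<lambda>x. x \<bullet> b)"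
| bump: "bump_algebra (\<lambda>x. flat_exp n (e - (x - a) \<bullet> (x - a)))"
| add: "bump_algebra f \<Longrightarrow> bump_algebra g \<Longrightarrow> bump_algebra (\<lambda>x. f x + g x)"
| mult: "bump_algebra f \<Longrightarrow> bump_algebra g \<Longrightarrow> bump_algebra (\<lambda>x. f x * g x)"

lemma bump_has_derivative:
  "((\<lambda>x. flat_exp n (e - (x - a) \<bullet> (x - a))) has_derivative
    (\<lambda>h. (- real n * flat_exp (n + 1) (e - (x - a) \<bullet> (x - a)) + flat_exp (n + 2) (e - (x - a) \<bullet> (x - a))) *
      (- 2 * ((x - a) \<bullet> h)))) (at x)"
proof -
  have "((\<lambda>x. e - (x - a) \<bullet> (x - a)) has_derivative (\<lambda>h. - 2 * ((x - a) \<bullet> h))) (at x)"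
    by (auto intro!: derivative_eq_intros simp: inner_commute algebra_simps)
  from has_derivative_compose[OF this flat_exp_deriv[unfolded has_field_derivative_def]]
  show ?thesis by simp
qed

lemma bump_algebra_deriv:
  "bump_algebra f \<Longrightarrow> \<exists>f'. (\<forall>x. (f has_derivative f' x) (at x)) \<and> (\<forall>b. bump_algebra (\<lambda>x. f' x b))"
proof (induction rule: bump_algebra.induct)
  case (const c)
  show ?case by (rule exI[of _ "\<lambda>x h. 0"]) (auto intro: bump_algebra.const)
next
  case (linear b)
  show ?case by (rule exI[of _ "\<lambda>x h. h \<bullet> b"])
    (auto intro!: bump_algebra.const derivative_eq_intros)
next
  case (bump n e a)
  let ?f = "\<lambda>x h. (- real n * flat_exp (n + 1) (e - (x - a) \<bullet> (x - a)) + flat_exp (n + 2) (e - (x - a) \<bullet> (x - a))) *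
      (- 2 * ((x - a) \<bullet> h))"
  have "bump_algebra (\<lambda>x. ?f x b)" for b
  proof -
    have "bump_algebra (\<lambda>x. (- real n * flat_exp (n + 1) (e - (x - a) \<bullet> (x - a)) + flat_exp (n + 2) (e - (x - a) \<bullet> (x - a))) *
      (- 2 * (x \<bullet> b + (- (a \<bullet> b)))))"
      by (intro bump_algebra.intros)
    then show ?thesis by (simp add: inner_diff_left)
  qed
  then show ?case using bump_has_derivative by (intro exI[of _ ?f]) blast
next
  case (add f g)
  then obtain f' g' where "\<And>x. (f has_derivative f' x) (at x)" "\<And>b. bump_algebra (\<lambda>x. f' x b)"
     "\<And>x. (g has_derivative g' x) (at x)" "\<And>b. bump_algebra (\<lambda>x. g' x b)" by blast
  then show ?case by (intro exI[of _ "\<lambda>x h. f' x h + g' x h"]) (auto intro: bump_algebra.add has_derivative_add)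
next
  case (mult f g)
  then obtain f' g' where *: "\<And>x. (f has_derivative f' x) (at x)" "\<And>b. bump_algebra (\<lambda>x. f' x b)"
     "\<And>x. (g has_derivative g' x) (at x)" "\<And>b. bump_algebra (\<lambda>x. g' x b)" by blast
  then show ?case using mult by (intro exI[of _ "\<lambda>x h. f x * g' x h + f' x h * g x"])
    (auto intro!: bump_algebra.add bump_algebra.mult has_derivative_mult)
qed

lemma bump_algebra_Ck: "bump_algebra f \<Longrightarrow> Ck k f"
proof (induction k arbitrary: f)
  case 0
  then obtain f' where "\<And>x. (f has_derivative f' x) (at x)" using bump_algebra_deriv by blast
  then show ?case by (auto intro!: continuous_at_imp_continuous_on has_derivative_continuous)
next
  case (Suc k)
  then obtain f' where *: "\<And>x. (f has_derivative f' x) (at x)" "\<And>b. bump_algebra (\<lambda>x. f' x b)"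
    using bump_algebra_deriv by blast
  have "partial_deriv b f = (\<lambda>x. f' x b)" for b
    using frechet_derivative_at[OF *(1)] by (auto simp: fun_eq_iff)
  then show ?case using * Suc.IH by (auto simp: differentiable_def)
qed

definition bump :: "real \<Rightarrow> 'a::euclidean_space \<Rightarrow> real" where
  "bump \<epsilon> z = flat_exp 0 (\<epsilon>\<^sup>2 - z \<bullet> z)"

lemma bump_continuous: "continuous_on S (bump \<epsilon>)"
  unfolding bump_def[abs_def] by (intro continuous_intros)

lemma bump_borel [measurable]: "bump \<epsilon> \<in> borel_measurable borel"
  using bump_continuous by (rule borel_measurable_continuous_onI)

lemma bump_outside: "0 \<le> \<epsilon> \<Longrightarrow> \<epsilon> \<le> norm z \<Longrightarrow> bump \<epsilon> z = 0"
  by (simp add: bump_def flat_exp_def dot_square_norm power_mono not_less)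

lemma bump_inside: "norm z < \<epsilon> \<Longrightarrow> bump \<epsilon> z > 0"
  by (simp add: bump_def flat_exp_def dot_square_norm power_strict_mono)

lemma bump_mass_pos_finite:
  assumes "0 < \<epsilon>"
  shows "integrable lborel (bump \<epsilon> :: 'a::euclidean_space \<Rightarrow> real)" "0 < (\<integral>z. bump \<epsilon> (z::'a) \<partial>lborel)"
proof -
  have "integrable lborel (\<lambda>z::'a. indicator (cball 0 \<epsilon>) z *\<^sub>R bump \<epsilon> z)"
    by (rule borel_integrable_compact[OF compact_cball bump_continuous])
  also have "(\<lambda>z::'a. indicator (cball 0 \<epsilon>) z *\<^sub>R bump \<epsilon> z) = bump \<epsilon>"
    using assms by (auto simp: fun_eq_iff indicator_def bump_outside)
  finally show int: "integrable lborel (bump \<epsilon> :: 'a \<Rightarrow> real)" .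
  have nn: "0 \<le> bump \<epsilon> z" for z :: 'a by (simp add: bump_def flat_exp_nonneg)
  have "(\<integral>z. bump \<epsilon> (z::'a) \<partial>lborel) \<noteq> 0"
  proof
    assume "(\<integral>z. bump \<epsilon> (z::'a) \<partial>lborel) = 0"
    then have ae: "AE z in lborel. bump \<epsilon> (z::'a) = 0"
      using integral_nonneg_eq_0_iff_AE[OF int] nn by simp
    have "AE z in lborel. z \<notin> ball (0::'a) \<epsilon>"
      using ae by eventually_elim (use bump_inside in fastforce)
    then have "emeasure lborel (ball (0::'a) \<epsilon>) = 0"
      by (subst (asm) AE_iff_measurable[of "ball 0 \<epsilon>"]) auto
    moreover have "emeasure lborel (ball (0::'a) \<epsilon>) \<noteq> 0"
      using assms content_ball_pos[of \<epsilon> "0::'a"] by (metis measure_def enn2real_0 measure_completion less_irrefl sets_lborel open_ball borel_open)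
    ultimately show False by simp
  qed
  then show "0 < (\<integral>z. bump \<epsilon> (z::'a) \<partial>lborel)" using nn by (simp add: less_le)
qed

definition mollifier :: "real \<Rightarrow> 'a::euclidean_space \<Rightarrow> real" where
  "mollifier \<epsilon> z = bump \<epsilon> z / (\<integral>z. bump \<epsilon> (z::'a) \<partial>lborel)"

definition mollifier_grad :: "real \<Rightarrow> 'a::euclidean_space \<Rightarrow> 'a" where
  "mollifier_grad \<epsilon> z = (- 2 * flat_exp 2 (\<epsilon>\<^sup>2 - z \<bullet> z) / (\<integral>z. bump \<epsilon> (z::'a) \<partial>lborel)) *\<^sub>R z"

context
  fixes \<epsilon> :: real
  assumes \<epsilon>: "0 < \<epsilon>"
begin

lemma mollifier_nonneg: "0 \<le> mollifier \<epsilon> (z::'a::euclidean_space)"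
  using bump_mass_pos_finite(2)[OF \<epsilon>, where 'a='a] by (simp add: mollifier_def bump_def flat_exp_nonneg)

lemma mollifier_outside: "\<epsilon> \<le> norm z \<Longrightarrow> mollifier \<epsilon> z = 0"
  using \<epsilon> by (simp add: mollifier_def bump_outside)

lemma mollifier_even: "mollifier \<epsilon> (x - y) = mollifier \<epsilon> (y - x)"
  by (simp add: mollifier_def bump_def inner_diff_left inner_diff_right inner_commute algebra_simps)

lemma mollifier_borel [measurable]: "mollifier \<epsilon> \<in> borel_measurable borel"
  unfolding mollifier_def[abs_def] by measurable

lemma mollifier_mass: "(\<integral>\<^sup>+z. ennreal (mollifier \<epsilon> (z::'a::euclidean_space)) \<partial>lborel) = 1"
proof -
  note b = bump_mass_pos_finite[OF \<epsilon>, where 'a='a]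
  have "integrable lborel (mollifier \<epsilon> :: 'a \<Rightarrow> real)"
    unfolding mollifier_def[abs_def] using b by simp
  then have "(\<integral>\<^sup>+z. ennreal (mollifier \<epsilon> (z::'a)) \<partial>lborel) = ennreal (\<integral>z. mollifier \<epsilon> (z::'a) \<partial>lborel)"
    using mollifier_nonneg by (intro nn_integral_eq_integral) auto
  also have "(\<integral>z. mollifier \<epsilon> (z::'a) \<partial>lborel) = 1"
    using b(2) by (simp add: mollifier_def)
  finally show ?thesis by simp
qed

lemma mollifier_has_derivative:
  "(mollifier \<epsilon> has_derivative (\<lambda>h. mollifier_grad \<epsilon> z \<bullet> h)) (at (z::'a::euclidean_space))"
proof -
  have "((\<lambda>z. bump \<epsilon> z / (\<integral>z. bump \<epsilon> (z::'a) \<partial>lborel)) has_derivative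
    (\<lambda>h. flat_exp 2 (\<epsilon>\<^sup>2 - z \<bullet> z) * (- 2 * (z \<bullet> h)) / (\<integral>z. bump \<epsilon> (z::'a) \<partial>lborel))) (at z)"
    using bump_has_derivative[of 0 "\<epsilon>\<^sup>2" 0 z] bump_mass_pos_finite(2)[OF \<epsilon>, where 'a='a]
    unfolding bump_def[abs_def] by (auto intro!: derivative_eq_intros simp: numeral_2_eq_2)
  then show ?thesis unfolding mollifier_def[abs_def] mollifier_grad_def by (simp add: mult_ac)
qed

lemma mollifier_grad_continuous: "continuous_on S (mollifier_grad \<epsilon> :: 'a::euclidean_space \<Rightarrow> 'a)"
  unfolding mollifier_grad_def[abs_def] using bump_mass_pos_finite(2)[OF \<epsilon>, where 'a='a]
  by (intro continuous_intros) auto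

lemma mollifier_continuous: "continuous_on S (mollifier \<epsilon> :: 'a::euclidean_space \<Rightarrow> real)"
  unfolding mollifier_def[abs_def] using bump_mass_pos_finite(2)[OF \<epsilon>, where 'a='a]
  by (intro continuous_intros bump_continuous) auto

lemma mollifier_grad_borel [measurable]: "mollifier_grad \<epsilon> \<in> borel_measurable borel"
  using mollifier_grad_continuous by (rule borel_measurable_continuous_onI)

lemma mollifier_grad_outside: "mollifier_grad \<epsilon> z = 0" if "\<epsilon> \<le> norm z"
proof -
  have "\<epsilon>\<^sup>2 \<le> (norm z)\<^sup>2" using \<epsilon> that by (intro power_mono) auto
  then show ?thesis by (simp add: mollifier_grad_def flat_exp_def dot_square_norm)
qed

lemma mollifier_test_function:
  fixes x :: "'a::euclidean_space"
  assumes "cball x \<epsilon> \<subseteq> \<Omega>"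
  shows "test_function \<Omega> (\<lambda>y. mollifier \<epsilon> (y - x))"
proof -
  let ?Z = "\<integral>z. bump \<epsilon> (z::'a) \<partial>lborel"
  have "bump_algebra (\<lambda>y. flat_exp 0 (\<epsilon>\<^sup>2 - (y - x) \<bullet> (y - x)) * (1 / ?Z))"
    by (intro bump_algebra.intros)
  then have "bump_algebra (\<lambda>y. mollifier \<epsilon> (y - x))"
    by (simp add: mollifier_def bump_def)
  then have "Ck k (\<lambda>y. mollifier \<epsilon> (y - x))" for k by (rule bump_algebra_Ck)
  moreover have "{y. mollifier \<epsilon> (y - x) \<noteq> 0} \<subseteq> cball x \<epsilon>"
    using mollifier_outside by (force simp: dist_norm norm_minus_commute)
  then have "closure {y. mollifier \<epsilon> (y - x) \<noteq> 0} \<subseteq> cball x \<epsilon>"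
    by (intro closure_minimal) auto
  moreover from this have "compact (closure {y. mollifier \<epsilon> (y - x) \<noteq> 0})"
    by (meson bounded_cball bounded_subset closed_closure compact_eq_bounded_closed)
  ultimately show ?thesis using assms by (auto simp: test_function_def)
qed

lemma partial_deriv_mollifier_shift:
  "partial_deriv b (\<lambda>y. mollifier \<epsilon> (y - x)) y = mollifier_grad \<epsilon> (y - x) \<bullet> b"
proof -
  have "((\<lambda>y. y - x) has_derivative (\<lambda>h. h)) (at y)" by (auto intro!: derivative_eq_intros)
  from has_derivative_compose[OF this mollifier_has_derivative]
  show ?thesis using frechet_derivative_at by metis
qed

end

lemma uniformly_continuous_compact_support:
  fixes f :: "'a::euclidean_space \<Rightarrow> 'b::real_normed_vector"
  assumes f: "continuous_on UNIV f" and R: "\<And>z. R \<le> norm z \<Longrightarrow> f z = 0" and e: "0 < e"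
  shows "\<exists>d>0. \<forall>z w. norm (z - w) < d \<longrightarrow> norm (f z - f w) < e"
proof -
  have "uniformly_continuous_on (cball 0 (R + 1)) f"
    using f by (intro compact_uniformly_continuous continuous_on_subset[OF f]) auto
  then obtain d where d: "d > 0" "\<And>z w. z \<in> cball 0 (R + 1) \<Longrightarrow> w \<in> cball 0 (R + 1) \<Longrightarrow> dist w z < d \<Longrightarrow> dist (f w) (f z) < e"
    using e unfolding uniformly_continuous_on_def by metis
  have "norm (f z - f w) < e" if zw: "norm (z - w) < min d 1" for z w
  proof (cases "norm z \<le> R + 1 \<and> norm w \<le> R + 1")
    case True
    then show ?thesis using d(2)[of w z] zw by (simp add: dist_norm)
  next
    case False
    then have "R \<le> norm z" "R \<le> norm w"
      using zw norm_triangle_ineq2[of z w] norm_triangle_ineq2[of w z] by (auto simp: norm_minus_commute)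
    then show ?thesis using R e by simp
  qed
  then show ?thesis using d by (intro exI[of _ "min d 1"]) auto
qed


lemma mollifier_mass_shift:
  fixes x y :: "'a::euclidean_space"
  assumes \<epsilon>: "0 < \<epsilon>"
  shows "(\<integral>\<^sup>+x. ennreal (mollifier \<epsilon> (x - y)) \<partial>lborel) = 1"
    "(\<integral>\<^sup>+y. ennreal (mollifier \<epsilon> (x - y)) \<partial>lborel) = 1"
proof -
  note [measurable] = mollifier_borel[OF \<epsilon>]
  have mass: "(\<integral>\<^sup>+x. ennreal (mollifier \<epsilon> (x - y)) \<partial>lborel) = 1" for y :: 'a
    using mollifier_mass[OF \<epsilon>, where 'a='a] nn_integral_lborel_affine_inverse[of "\<lambda>z. ennreal (mollifier \<epsilon> z)" 1 "-y"]
    by simp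
  then show "(\<integral>\<^sup>+x. ennreal (mollifier \<epsilon> (x - y)) \<partial>lborel) = 1" .
  show "(\<integral>\<^sup>+y. ennreal (mollifier \<epsilon> (x - y)) \<partial>lborel) = 1"
    using mass[of x] by (subst mollifier_even) (use \<epsilon> in auto)
qed

section \<open>Mollification\<close>

definition mollify :: "real \<Rightarrow> ('a::euclidean_space \<Rightarrow> real) \<Rightarrow> 'a \<Rightarrow> real" where
  "mollify \<epsilon> f x = (\<integral>y. f y * mollifier \<epsilon> (x - y) \<partial>lborel)"

definition mollify_grad :: "real \<Rightarrow> ('a::euclidean_space \<Rightarrow> real) \<Rightarrow> 'a \<Rightarrow> 'a" where
  "mollify_grad \<epsilon> f x = (\<integral>y. f y *\<^sub>R mollifier_grad \<epsilon> (x - y) \<partial>lborel)"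

lemma integrable_times_bounded:
  fixes f :: "'a \<Rightarrow> real" and k :: "'a \<Rightarrow> 'b::{banach, second_countable_topology}"
  assumes f: "integrable M f" and k: "k \<in> borel_measurable M" "\<And>y. norm (k y) \<le> c"
  shows "integrable M (\<lambda>y. f y *\<^sub>R k y)"
    "norm (\<integral>y. f y *\<^sub>R k y \<partial>M) \<le> c * (\<integral>y. \<bar>f y\<bar> \<partial>M)"
proof -
  have [measurable]: "f \<in> borel_measurable M" using f by simp
  note [measurable] = k(1)
  have i: "integrable M (\<lambda>y. c * \<bar>f y\<bar>)" using f by simp
  have le: "norm (f y *\<^sub>R k y) \<le> c * \<bar>f y\<bar>" for y
    using mult_left_mono[OF k(2)[of y], of "\<bar>f y\<bar>"] by (simp add: mult.commute)
  show int: "integrable M (\<lambda>y. f y *\<^sub>R k y)"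
  proof (rule Bochner_Integration.integrable_bound[OF i])
    show "AE y in M. norm (f y *\<^sub>R k y) \<le> norm (c * \<bar>f y\<bar>)"
      by (rule AE_I2) (simp only: real_norm_def, rule order_trans[OF le abs_ge_self])
  qed measurable
  have "norm (\<integral>y. f y *\<^sub>R k y \<partial>M) \<le> (\<integral>y. norm (f y *\<^sub>R k y) \<partial>M)" by (rule integral_norm_bound)
  also have "\<dots> \<le> (\<integral>y. c * \<bar>f y\<bar> \<partial>M)" using le by (intro integral_mono i integrable_norm int) auto
  finally show "norm (\<integral>y. f y *\<^sub>R k y \<partial>M) \<le> c * (\<integral>y. \<bar>f y\<bar> \<partial>M)" by simp
qed

lemma bounded_compact_support:
  fixes f :: "'a::euclidean_space \<Rightarrow> 'b::real_normed_vector"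
  assumes f: "continuous_on UNIV f" and R: "\<And>z. R \<le> norm z \<Longrightarrow> f z = 0"
  shows "\<exists>c\<ge>0. \<forall>z. norm (f z) \<le> c"
proof -
  have "compact (f ` cball 0 R)" by (intro compact_continuous_image continuous_on_subset[OF f]) auto
  then obtain c where c: "\<And>z. z \<in> cball 0 R \<Longrightarrow> norm (f z) \<le> c"
    by (meson compact_imp_bounded bounded_iff image_eqI)
  have "norm (f z) \<le> \<bar>c\<bar>" for z
    using c[of z] R[of z] by (cases "norm z \<le> R") auto
  then show ?thesis by (intro exI[of _ "\<bar>c\<bar>"]) auto
qed

context
  fixes \<epsilon> :: real and f :: "'a::euclidean_space \<Rightarrow> real"
  assumes \<epsilon>: "0 < \<epsilon>" and f: "integrable lborel f"
begin

lemma mollify_integrands: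
  "integrable lborel (\<lambda>y. f y * mollifier \<epsilon> (x - y))"
  "integrable lborel (\<lambda>y. f y *\<^sub>R mollifier_grad \<epsilon> (x - y))"
proof -
  obtain c1 where c1: "\<And>z::'a. norm (mollifier \<epsilon> z) \<le> c1"
    using bounded_compact_support[OF mollifier_continuous[OF \<epsilon>] mollifier_outside[OF \<epsilon>]] by blast
  obtain c2 where c2: "\<And>z::'a. norm (mollifier_grad \<epsilon> z) \<le> c2"
    using bounded_compact_support[OF mollifier_grad_continuous[OF \<epsilon>] mollifier_grad_outside[OF \<epsilon>]] by blast
  note [measurable] = mollifier_borel[OF \<epsilon>] mollifier_grad_borel[OF \<epsilon>]
  show "integrable lborel (\<lambda>y. f y * mollifier \<epsilon> (x - y))"
    using integrable_times_bounded(1)[OF f, of "\<lambda>y. mollifier \<epsilon> (x - y)" c1] c1 by simp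
  show "integrable lborel (\<lambda>y. f y *\<^sub>R mollifier_grad \<epsilon> (x - y))"
    using integrable_times_bounded(1)[OF f, of "\<lambda>y. mollifier_grad \<epsilon> (x - y)" c2] c2 by simp
qed

lemma mollify_grad_continuous: "continuous_on S (mollify_grad \<epsilon> f)"
proof -
  note [measurable] = mollifier_grad_borel[OF \<epsilon>]
  define A where "A = (\<integral>y. \<bar>f y\<bar> \<partial>lborel) + 1"
  have A: "A > 0" unfolding A_def by (intro add_nonneg_pos) auto
  have "\<exists>d>0. \<forall>x'. dist x' x < d \<longrightarrow> dist (mollify_grad \<epsilon> f x') (mollify_grad \<epsilon> f x) < e" if e: "e > 0" for x e
  proof -
    have "0 < e / A" using e A by simp
    from uniformly_continuous_compact_support[OF mollifier_grad_continuous[OF \<epsilon>] mollifier_grad_outside[OF \<epsilon>] this]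
    obtain d where d: "d > 0" "\<And>z w::'a. norm (z - w) < d \<Longrightarrow> norm (mollifier_grad \<epsilon> z - mollifier_grad \<epsilon> w) < e / A"
      by blast
    have "dist (mollify_grad \<epsilon> f x') (mollify_grad \<epsilon> f x) < e" if "dist x' x < d" for x'
    proof -
      have "mollify_grad \<epsilon> f x' - mollify_grad \<epsilon> f x =
        (\<integral>y. f y *\<^sub>R (mollifier_grad \<epsilon> (x' - y) - mollifier_grad \<epsilon> (x - y)) \<partial>lborel)"
        unfolding mollify_grad_def scaleR_diff_right
        by (rule Bochner_Integration.integral_diff[symmetric]) (rule mollify_integrands)+
      moreover have "norm (\<integral>y. f y *\<^sub>R (mollifier_grad \<epsilon> (x' - y) - mollifier_grad \<epsilon> (x - y)) \<partial>lborel) \<le>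
        e / A * (\<integral>y. \<bar>f y\<bar> \<partial>lborel)"
        using d(2) that by (intro integrable_times_bounded(2)[OF f]) (auto intro!: less_imp_le simp: dist_norm)
      moreover have "e / A * (\<integral>y. \<bar>f y\<bar> \<partial>lborel) < e / A * A"
        using e A by (intro mult_strict_left_mono) (auto simp: A_def)
      ultimately show ?thesis using A by (simp add: dist_norm)
    qed
    then show ?thesis using d(1) by blast
  qed
  then have "continuous_on UNIV (mollify_grad \<epsilon> f)" unfolding continuous_on_iff by blast
  then show ?thesis by (rule continuous_on_subset) simp
qed

text \<open>
The gradient of the mollifier is uniformly continuous, so its first-order Taylor remainder is
uniformly small; integrating against \<open>f\<close> keeps the remainder small.
\<close>

lemma mollify_has_derivative:
  "(mollify \<epsilon> f has_derivative (\<lambda>h. mollify_grad \<epsilon> f x \<bullet> h)) (at x)"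
  unfolding has_derivative_at_alt
proof (intro conjI allI impI)
  show "bounded_linear ((\<bullet>) (mollify_grad \<epsilon> f x))" by (rule bounded_linear_inner_right)
next
  fix e :: real assume e: "e > 0"
  note [measurable] = mollifier_grad_borel[OF \<epsilon>] mollifier_borel[OF \<epsilon>]
  define A where "A = (\<integral>y. \<bar>f y\<bar> \<partial>lborel) + 1"
  have A: "A > 0" unfolding A_def by (intro add_nonneg_pos) auto
  have "0 < e / A" using e A by simp
  from uniformly_continuous_compact_support[OF mollifier_grad_continuous[OF \<epsilon>] mollifier_grad_outside[OF \<epsilon>] this]
  obtain d where d: "d > 0" "\<And>z w::'a. norm (z - w) < d \<Longrightarrow> norm (mollifier_grad \<epsilon> z - mollifier_grad \<epsilon> w) < e / A"
    by blast
  have taylor: "\<bar>mollifier \<epsilon> (z + h) - mollifier \<epsilon> z - mollifier_grad \<epsilon> z \<bullet> h\<bar> \<le> norm h * (e / A)"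
    if h: "norm h < d" for z h :: 'a
  proof -
    have "norm (mollifier \<epsilon> (z + h) - mollifier \<epsilon> z - mollifier_grad \<epsilon> z \<bullet> ((z + h) - z)) \<le> norm ((z + h) - z) * (e / A)"
    proof (rule differentiable_bound_linearization[where S = "ball z d" and f' = "\<lambda>x h. mollifier_grad \<epsilon> x \<bullet> h"])
      fix t :: real assume "t \<in> {0..1}"
      then have "\<bar>t\<bar> * norm h \<le> 1 * norm h" by (intro mult_right_mono) auto
      then show "z + t *\<^sub>R (z + h - z) \<in> ball z d" using h by (simp add: dist_norm)
    next
      fix x assume "x \<in> ball z d"
      then have "norm (mollifier_grad \<epsilon> x - mollifier_grad \<epsilon> z) \<le> e / A"
        using d(2)[of x z] by (simp add: dist_norm norm_minus_commute less_imp_le)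
      moreover have "onorm (\<lambda>h. mollifier_grad \<epsilon> x \<bullet> h - mollifier_grad \<epsilon> z \<bullet> h) \<le> norm (mollifier_grad \<epsilon> x - mollifier_grad \<epsilon> z)"
      proof (rule onorm_le)
        fix h
        show "norm (mollifier_grad \<epsilon> x \<bullet> h - mollifier_grad \<epsilon> z \<bullet> h) \<le> norm (mollifier_grad \<epsilon> x - mollifier_grad \<epsilon> z) * norm h"
          unfolding inner_diff_left[symmetric] by (simp add: Cauchy_Schwarz_ineq2)
      qed
      ultimately show "onorm ((\<lambda>h. mollifier_grad \<epsilon> x \<bullet> h) - (\<lambda>h. mollifier_grad \<epsilon> z \<bullet> h)) \<le> e / A"
        unfolding fun_diff_def by simp
    qed (use d(1) mollifier_has_derivative[OF \<epsilon>] in \<open>auto intro: has_derivative_at_withinI\<close>)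
    then show ?thesis by simp
  qed
  have "norm (mollify \<epsilon> f y - mollify \<epsilon> f x - mollify_grad \<epsilon> f x \<bullet> (y - x)) \<le> e * norm (y - x)"
    if y: "norm (y - x) < d" for y
  proof -
    define h where "h = y - x"
    have yh: "y - w = (x - w) + h" for w by (simp add: h_def)
    have int: "integrable lborel (\<lambda>w. (f w *\<^sub>R mollifier_grad \<epsilon> (x - w)) \<bullet> h)"
      by (intro integrable_inner_left mollify_integrands(2))
    have "mollify_grad \<epsilon> f x \<bullet> h = (\<integral>w. (f w *\<^sub>R mollifier_grad \<epsilon> (x - w)) \<bullet> h \<partial>lborel)"
      unfolding mollify_grad_def by (intro integral_inner_left[symmetric] mollify_integrands(2))
    then have "mollify \<epsilon> f y - mollify \<epsilon> f x - mollify_grad \<epsilon> f x \<bullet> h =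
      (\<integral>w. f w * mollifier \<epsilon> (y - w) - f w * mollifier \<epsilon> (x - w) - (f w *\<^sub>R mollifier_grad \<epsilon> (x - w)) \<bullet> h \<partial>lborel)"
      unfolding mollify_def using mollify_integrands(1) int
      by (simp add: Bochner_Integration.integral_diff del: inner_scaleR_left)
    also have "\<dots> = (\<integral>w. f w *\<^sub>R (mollifier \<epsilon> ((x - w) + h) - mollifier \<epsilon> (x - w) - mollifier_grad \<epsilon> (x - w) \<bullet> h) \<partial>lborel)"
      unfolding yh by (intro Bochner_Integration.integral_cong) (auto simp: algebra_simps)
    finally have eq: "mollify \<epsilon> f y - mollify \<epsilon> f x - mollify_grad \<epsilon> f x \<bullet> h =
      (\<integral>w. f w *\<^sub>R (mollifier \<epsilon> ((x - w) + h) - mollifier \<epsilon> (x - w) - mollifier_grad \<epsilon> (x - w) \<bullet> h) \<partial>lborel)" .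
    have "norm (mollify \<epsilon> f y - mollify \<epsilon> f x - mollify_grad \<epsilon> f x \<bullet> h) \<le> (norm h * (e / A)) * (\<integral>w. \<bar>f w\<bar> \<partial>lborel)"
      unfolding eq
    proof (rule integrable_times_bounded(2)[OF f])
      show "(\<lambda>w. mollifier \<epsilon> ((x - w) + h) - mollifier \<epsilon> (x - w) - mollifier_grad \<epsilon> (x - w) \<bullet> h) \<in> borel_measurable lborel"
        by measurable
      show "norm (mollifier \<epsilon> ((x - w) + h) - mollifier \<epsilon> (x - w) - mollifier_grad \<epsilon> (x - w) \<bullet> h) \<le> norm h * (e / A)" for w
        using taylor[of h "x - w"] y by (simp add: h_def)
    qed
    also have "\<dots> \<le> (norm h * (e / A)) * A"
      using e A by (intro mult_left_mono) (auto simp: A_def)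
    also have "\<dots> = e * norm h" using A by simp
    finally show ?thesis by (simp add: h_def)
  qed
  then show "\<exists>d>0. \<forall>y. norm (y - x) < d \<longrightarrow>
    norm (mollify \<epsilon> f y - mollify \<epsilon> f x - mollify_grad \<epsilon> f x \<bullet> (y - x)) \<le> e * norm (y - x)"
    using d(1) by blast
qed

end

lemma mollify_L1_le:
  fixes f :: "'a::euclidean_space \<Rightarrow> real"
  assumes \<epsilon>: "0 < \<epsilon>" and f: "f \<in> borel_measurable borel"
  shows "(\<integral>\<^sup>+x. ennreal \<bar>mollify \<epsilon> f x\<bar> \<partial>lborel) \<le> (\<integral>\<^sup>+y. ennreal \<bar>f y\<bar> \<partial>lborel)"
proof -
  note [measurable] = mollifier_borel[OF \<epsilon>] f
  have "(\<integral>\<^sup>+x. ennreal \<bar>mollify \<epsilon> f x\<bar> \<partial>lborel) \<le> (\<integral>\<^sup>+x. \<integral>\<^sup>+y. ennreal \<bar>f y\<bar> * ennreal (mollifier \<epsilon> (x - y)) \<partial>lborel \<partial>lborel)"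
  proof (rule nn_integral_mono)
    fix x
    have e: "ennreal \<bar>f y\<bar> * ennreal (mollifier \<epsilon> (x - y)) = ennreal (norm (f y * mollifier \<epsilon> (x - y)))" for y
      using mollifier_nonneg[OF \<epsilon>, of "x - y"] by (simp add: ennreal_mult abs_mult)
    show "ennreal \<bar>mollify \<epsilon> f x\<bar> \<le> (\<integral>\<^sup>+y. ennreal \<bar>f y\<bar> * ennreal (mollifier \<epsilon> (x - y)) \<partial>lborel)"
    proof (cases "integrable lborel (\<lambda>y. f y * mollifier \<epsilon> (x - y))")
      case True
      from integral_norm_bound_ennreal[OF this] show ?thesis unfolding e mollify_def by simp
    next
      case False
      then show ?thesis by (simp add: mollify_def not_integrable_integral_eq)
    qed
  qed
  also have "\<dots> = (\<integral>\<^sup>+y. \<integral>\<^sup>+x. ennreal \<bar>f y\<bar> * ennreal (mollifier \<epsilon> (x - y)) \<partial>lborel \<partial>lborel)"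
    by (rule lborel_pair.Fubini'[symmetric]) measurable
  also have "\<dots> = (\<integral>\<^sup>+y. ennreal \<bar>f y\<bar> \<partial>lborel)"
    by (intro nn_integral_cong) (subst nn_integral_cmult, auto simp: mollifier_mass_shift(1)[OF \<epsilon>])
  finally show ?thesis .
qed

section \<open>Convergence and energy of mollifications\<close>

text \<open>
The Cauchy-Schwarz inequality for the probability density given by the mollifier, followed by Tonelli.
\<close>

lemma mollify_energy_le:
  fixes N :: "'a::euclidean_space \<Rightarrow> ennreal"
  assumes \<epsilon>: "0 < \<epsilon>" and N: "N \<in> borel_measurable borel"
  shows "(\<integral>\<^sup>+x. (\<integral>\<^sup>+y. N y * ennreal (mollifier \<epsilon> (x - y)) \<partial>lborel)\<^sup>2 \<partial>lborel) \<le> (\<integral>\<^sup>+y. (N y)\<^sup>2 \<partial>lborel)"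
proof -
  note [measurable] = mollifier_borel[OF \<epsilon>] N
  have split: "ennreal (mollifier \<epsilon> z) = ennreal (sqrt (mollifier \<epsilon> z)) * ennreal (sqrt (mollifier \<epsilon> z))" for z :: 'a
    using mollifier_nonneg[OF \<epsilon>, of z] by (simp add: ennreal_mult[symmetric])
  have "(\<integral>\<^sup>+x. (\<integral>\<^sup>+y. N y * ennreal (mollifier \<epsilon> (x - y)) \<partial>lborel)\<^sup>2 \<partial>lborel) \<le>
    (\<integral>\<^sup>+x. \<integral>\<^sup>+y. (N y)\<^sup>2 * ennreal (mollifier \<epsilon> (x - y)) \<partial>lborel \<partial>lborel)"
  proof (rule nn_integral_mono)
    fix x :: 'a
    have "(\<integral>\<^sup>+y. N y * ennreal (mollifier \<epsilon> (x - y)) \<partial>lborel)\<^sup>2 =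
      (\<integral>\<^sup>+y. (N y * ennreal (sqrt (mollifier \<epsilon> (x - y)))) * ennreal (sqrt (mollifier \<epsilon> (x - y))) \<partial>lborel)\<^sup>2"
      by (subst split) (simp only: mult.assoc)
    also have "\<dots> \<le> (\<integral>\<^sup>+y. (N y * ennreal (sqrt (mollifier \<epsilon> (x - y))))\<^sup>2 \<partial>lborel) *
       (\<integral>\<^sup>+y. (ennreal (sqrt (mollifier \<epsilon> (x - y))))\<^sup>2 \<partial>lborel)"
      by (rule Cauchy_Schwarz_nn_integral) measurable
    also have "\<dots> = (\<integral>\<^sup>+y. (N y)\<^sup>2 * ennreal (mollifier \<epsilon> (x - y)) \<partial>lborel) * 1"
      unfolding power_mult_distrib unfolding power2_eq_square[of "ennreal (sqrt _)"] split[symmetric]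
        mollifier_mass_shift(2)[OF \<epsilon>] ..
    finally show "(\<integral>\<^sup>+y. N y * ennreal (mollifier \<epsilon> (x - y)) \<partial>lborel)\<^sup>2 \<le>
      (\<integral>\<^sup>+y. (N y)\<^sup>2 * ennreal (mollifier \<epsilon> (x - y)) \<partial>lborel)" by simp
  qed
  also have "\<dots> = (\<integral>\<^sup>+y. \<integral>\<^sup>+x. (N y)\<^sup>2 * ennreal (mollifier \<epsilon> (x - y)) \<partial>lborel \<partial>lborel)"
    by (rule lborel_pair.Fubini'[symmetric]) measurable
  also have "\<dots> = (\<integral>\<^sup>+y. (N y)\<^sup>2 \<partial>lborel)"
    by (intro nn_integral_cong) (subst nn_integral_cmult, auto simp: mollifier_mass_shift(1)[OF \<epsilon>])
  finally show ?thesis .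
qed

definition L1_approx_continuous :: "('a::euclidean_space \<Rightarrow> real) \<Rightarrow> bool" where
  "L1_approx_continuous f \<longleftrightarrow> (\<forall>e>0. \<exists>g R. continuous_on UNIV g \<and> (\<forall>z. R \<le> norm z \<longrightarrow> g z = 0) \<and>
    (\<integral>\<^sup>+x. ennreal \<bar>f x - g x\<bar> \<partial>lborel) < ennreal e)"

text \<open>
Inner regularity is applied to Lebesgue measure restricted to \<open>A\<close>, which is a finite measure.
\<close>

lemma compact_inner_approx:
  fixes A :: "'a::euclidean_space set"
  assumes A: "A \<in> sets borel" "emeasure lborel A < \<infinity>" and e: "0 < e"
  shows "\<exists>K. compact K \<and> K \<subseteq> A \<and> emeasure lborel (A - K) < ennreal e"
proof -
  define M where "M = density lborel (indicator A :: 'a \<Rightarrow> ennreal)"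
  have MB: "emeasure M B = emeasure lborel (A \<inter> B)" if "B \<in> sets borel" for B
  proof -
    have "emeasure M B = (\<integral>\<^sup>+x. indicator A x * indicator B x \<partial>lborel)"
      unfolding M_def using A that by (intro emeasure_density) auto
    also have "\<dots> = (\<integral>\<^sup>+x. indicator (A \<inter> B) x \<partial>lborel)" by (simp only: indicator_inter_arith)
    also have "\<dots> = emeasure lborel (A \<inter> B)" using A that by (intro nn_integral_indicator) auto
    finally show ?thesis .
  qed
  have "emeasure M A = (SUP K \<in> {K. K \<subseteq> A \<and> compact K}. emeasure M K)"
    using A MB[of UNIV] by (intro inner_regular) (auto simp: M_def)
  then have sup: "emeasure lborel A = (SUP K \<in> {K. K \<subseteq> A \<and> compact K}. emeasure M K)"
    using MB[of A] A by simp
  show ?thesis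
  proof (cases "emeasure lborel A = 0")
    case True
    then show ?thesis using e by (intro exI[of _ "{}"]) auto
  next
    case False
    obtain a where a: "emeasure lborel A = ennreal a" "a > 0"
      using A(2) False by (cases "emeasure lborel A") (auto simp: less_le)
    have "ennreal (a - e) < (SUP K \<in> {K. K \<subseteq> A \<and> compact K}. emeasure M K)"
      unfolding sup[symmetric] a(1) using e a(2) by (intro ennreal_lessI) auto
    then obtain K where K: "K \<subseteq> A" "compact K" "ennreal (a - e) < emeasure M K"
      unfolding less_SUP_iff by auto
    have Kb: "K \<in> sets borel" using K by (simp add: borel_compact)
    have "emeasure M K = emeasure lborel K" using MB[OF Kb] K by (simp add: Int_absorb1)
    then have Ke: "ennreal (a - e) < emeasure lborel K" using K by simp
    have Kfin: "emeasure lborel K \<noteq> \<infinity>" using emeasure_mono[OF K(1), of lborel] A by (auto simp: top_unique)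
    then obtain k where k: "emeasure lborel K = ennreal k" "k \<ge> 0" by (cases "emeasure lborel K") auto
    have "emeasure lborel (A - K) = emeasure lborel A - emeasure lborel K"
      using A Kb K Kfin by (intro emeasure_Diff) auto
    also have "\<dots> = ennreal (a - k)" using k a by (simp add: ennreal_minus)
    also have "\<dots> < ennreal e"
    proof (rule ennreal_lessI[OF e])
      have "a - e < k"
      proof (cases "a - e \<ge> 0")
        case True then show ?thesis using Ke k by (simp add: ennreal_less_iff)
      qed (use k in simp)
      then show "a - k < e" by simp
    qed
    finally show ?thesis using K by blast
  qed
qed

lemma L1_approx_indicator:
  fixes A :: "'a::euclidean_space set"
  assumes A: "A \<in> sets borel" "emeasure lborel A < \<infinity>"
  shows "L1_approx_continuous (\<lambda>x. indicator A x *\<^sub>R c)"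
  unfolding L1_approx_continuous_def
proof (intro allI impI)
  fix e :: real assume e: "e > 0"
  define e' where "e' = e / (2 * (\<bar>c\<bar> + 1))"
  have e': "e' > 0" using e by (simp add: e'_def)
  obtain K where K: "compact K" "K \<subseteq> A" "emeasure lborel (A - K) < ennreal e'"
    using compact_inner_approx[OF A e'] by blast
  have Kb: "K \<in> sets borel" using K by (simp add: borel_compact)
  obtain T where T: "open T" "K \<subseteq> T" "emeasure lebesgue (T - K) < ennreal e'"
  proof (rule sets_lebesgue_outer_open[OF _ e'])
    show "K \<in> sets lebesgue" using Kb by simp
  qed blast
  obtain R where R: "K \<subseteq> ball 0 R" using bounded_subset_ballD[OF compact_imp_bounded[OF K(1)], of 0] by blast
  define S where "S = T \<inter> ball 0 R"
  have S: "open S" "K \<subseteq> S" using T R by (auto simp: S_def)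
  have "emeasure lborel (S - K) \<le> emeasure lborel (T - K)"
    using T Kb by (intro emeasure_mono) (auto simp: S_def)
  also have "\<dots> = emeasure lebesgue (T - K)" using T Kb by (simp add: emeasure_completion)
  finally have SK: "emeasure lborel (S - K) < ennreal e'" using T(3) by (rule le_less_trans)
  have "closed K" "closed (- S)" "K \<inter> - S = {}" using K(1) S by (auto intro: compact_imp_closed)
  from Urysohn[OF this, of "1::real" 0]
  obtain g :: "'a \<Rightarrow> real" where g: "continuous_on UNIV g" "\<And>x. g x \<in> closed_segment 1 0"
    "\<And>x. x \<in> K \<Longrightarrow> g x = 1" "\<And>x. x \<in> - S \<Longrightarrow> g x = 0"
    by blast
  have g01: "0 \<le> g x" "g x \<le> 1" for x using g(2)[of x] by (auto simp: closed_segment_eq_real_ivl)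
  have le: "ennreal \<bar>indicator A x *\<^sub>R c - c * g x\<bar> \<le> ennreal \<bar>c\<bar> * (indicator (A - K) x + indicator (S - K) x)" for x
  proof -
    have "\<bar>indicator A x - g x\<bar> \<le> (indicator (A - K) x + indicator (S - K) x :: real)"
    proof (cases "x \<in> K")
      case True
      then show ?thesis using g(3)[of x] K(2) by auto
    next
      case xK: False
      show ?thesis
      proof (cases "x \<in> A")
        case True
        then show ?thesis using xK g01[of x] by (simp add: indicator_def)
      next
        case False
        then show ?thesis using xK g01[of x] g(4)[of x] by (cases "x \<in> S") simp_all
      qed
    qed
    then have "\<bar>c\<bar> * \<bar>indicator A x - g x\<bar> \<le> \<bar>c\<bar> * (indicator (A - K) x + indicator (S - K) x)"
      by (rule mult_left_mono) simp
    then have "\<bar>indicator A x *\<^sub>R c - c * g x\<bar> \<le> \<bar>c\<bar> * (indicator (A - K) x + indicator (S - K) x)"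
    proof -
      have "indicator A x *\<^sub>R c - c * g x = c * (indicator A x - g x)" by (simp add: algebra_simps)
      then show ?thesis
        using \<open>\<bar>c\<bar> * \<bar>indicator A x - g x\<bar> \<le> \<bar>c\<bar> * (indicator (A - K) x + indicator (S - K) x)\<close>
        by (simp only: abs_mult)
    qed
    then have "ennreal \<bar>indicator A x *\<^sub>R c - c * g x\<bar> \<le> ennreal (\<bar>c\<bar> * (indicator (A - K) x + indicator (S - K) x))"
      by (rule ennreal_leI)
    also have "\<dots> = ennreal \<bar>c\<bar> * (indicator (A - K) x + indicator (S - K) x)"
      by (simp add: ennreal_mult ennreal_indicator)
    finally show ?thesis .
  qed
  have "(\<integral>\<^sup>+x. ennreal \<bar>indicator A x *\<^sub>R c - c * g x\<bar> \<partial>lborel) \<le>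
    (\<integral>\<^sup>+x. ennreal \<bar>c\<bar> * (indicator (A - K) x + indicator (S - K) x) \<partial>lborel)"
    by (intro nn_integral_mono le)
  also have "\<dots> = ennreal \<bar>c\<bar> * (emeasure lborel (A - K) + emeasure lborel (S - K))"
  proof -
    have [measurable]: "A - K \<in> sets borel" "S - K \<in> sets borel" using A Kb S by auto
    have "(\<integral>\<^sup>+x. ennreal \<bar>c\<bar> * (indicator (A - K) x + indicator (S - K) x) \<partial>lborel) =
      ennreal \<bar>c\<bar> * (\<integral>\<^sup>+x. indicator (A - K) x + indicator (S - K) x \<partial>lborel)"
      by (rule nn_integral_cmult) measurable
    also have "(\<integral>\<^sup>+x. indicator (A - K) x + indicator (S - K) x \<partial>lborel) =
      (\<integral>\<^sup>+x. indicator (A - K) x \<partial>lborel) + (\<integral>\<^sup>+x. indicator (S - K) x \<partial>lborel)"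
      by (rule nn_integral_add) measurable
    finally show ?thesis by simp
  qed
  also have "\<dots> \<le> ennreal \<bar>c\<bar> * (ennreal e' + ennreal e')"
    using K SK by (intro mult_left_mono add_mono) auto
  also have "\<dots> = ennreal (\<bar>c\<bar> * (2 * e'))" using e' by (simp add: ennreal_mult ennreal_plus[symmetric] del: ennreal_plus)
  also have "\<dots> < ennreal e"
  proof (rule ennreal_lessI[OF e])
    have "k * (2 * (e / (2 * (k + 1)))) = e * (k / (k + 1))" if "0 \<le> k" for k :: real
      using that by (simp add: field_simps)
    then have "\<bar>c\<bar> * (2 * e') = e * (\<bar>c\<bar> / (\<bar>c\<bar> + 1))" unfolding e'_def by simp
    also have "\<dots> < e * 1" using e by (intro mult_strict_left_mono) auto
    finally show "\<bar>c\<bar> * (2 * e') < e" by simp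
  qed
  finally have "(\<integral>\<^sup>+x. ennreal \<bar>indicator A x *\<^sub>R c - c * g x\<bar> \<partial>lborel) < ennreal e" .
  moreover have "continuous_on UNIV (\<lambda>x. c * g x)" using g(1) by (intro continuous_intros)
  moreover have "\<forall>z. R \<le> norm z \<longrightarrow> c * g z = 0" using g(4) by (auto simp: S_def)
  ultimately show "\<exists>g R. continuous_on UNIV g \<and> (\<forall>z. R \<le> norm z \<longrightarrow> g z = 0) \<and>
    (\<integral>\<^sup>+x. ennreal \<bar>indicator A x *\<^sub>R c - g x\<bar> \<partial>lborel) < ennreal e" by blast
qed

text \<open>
Density of compactly supported continuous functions, by induction over the construction of
integrable functions from indicators; an indicator is squeezed between a compact and a bounded open
set and replaced by an Urysohn function.
\<close>

lemma integrable_L1_approx_continuous: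
  fixes f :: "'a::euclidean_space \<Rightarrow> real"
  assumes "integrable lborel f"
  shows "L1_approx_continuous f"
  using assms
proof (induction rule: integrable_induct)
  case (base A c)
  then show ?case by (intro L1_approx_indicator) auto
next
  case (add f1 f2)
  have [measurable]: "f1 \<in> borel_measurable borel" "f2 \<in> borel_measurable borel"
    using borel_measurable_integrable[OF add.hyps(1)] borel_measurable_integrable[OF add.hyps(2)] by auto
  show ?case unfolding L1_approx_continuous_def
  proof (intro allI impI)
    fix e :: real assume "e > 0"
    then have e2: "e / 2 > 0" by simp
    obtain g1 R1 where g1: "continuous_on UNIV g1" "\<And>z. R1 \<le> norm z \<Longrightarrow> g1 z = 0"
      "(\<integral>\<^sup>+x. ennreal \<bar>f1 x - g1 x\<bar> \<partial>lborel) < ennreal (e/2)"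
      using add.IH(1) e2 unfolding L1_approx_continuous_def by blast
    obtain g2 R2 where g2: "continuous_on UNIV g2" "\<And>z. R2 \<le> norm z \<Longrightarrow> g2 z = 0"
      "(\<integral>\<^sup>+x. ennreal \<bar>f2 x - g2 x\<bar> \<partial>lborel) < ennreal (e/2)"
      using add.IH(2) e2 unfolding L1_approx_continuous_def by blast
    note [measurable] = borel_measurable_continuous_onI[OF g1(1)] borel_measurable_continuous_onI[OF g2(1)]
    have "(\<integral>\<^sup>+x. ennreal \<bar>f1 x + f2 x - (g1 x + g2 x)\<bar> \<partial>lborel) \<le>
      (\<integral>\<^sup>+x. ennreal \<bar>f1 x - g1 x\<bar> + ennreal \<bar>f2 x - g2 x\<bar> \<partial>lborel)"
      by (intro nn_integral_mono) (simp add: ennreal_plus[symmetric] ennreal_leI del: ennreal_plus)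
    also have "\<dots> = (\<integral>\<^sup>+x. ennreal \<bar>f1 x - g1 x\<bar> \<partial>lborel) + (\<integral>\<^sup>+x. ennreal \<bar>f2 x - g2 x\<bar> \<partial>lborel)"
      by (rule nn_integral_add) measurable
    also have "\<dots> < ennreal (e/2) + ennreal (e/2)"
      by (rule add_strict_mono[OF g1(3) g2(3)])
    also have "\<dots> = ennreal e" using e2 by (simp add: ennreal_plus[symmetric] del: ennreal_plus)
    finally show "\<exists>g R. continuous_on UNIV g \<and> (\<forall>z. R \<le> norm z \<longrightarrow> g z = 0) \<and>
      (\<integral>\<^sup>+x. ennreal \<bar>f1 x + f2 x - g x\<bar> \<partial>lborel) < ennreal e"
      using g1(1,2) g2(1,2)
      by (intro exI[of _ "\<lambda>x. g1 x + g2 x"] exI[of _ "max R1 R2"]) (auto intro!: continuous_intros)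
  qed
next
  case (lim f s)
  have [measurable]: "f \<in> borel_measurable borel" "s i \<in> borel_measurable borel" for i
    using borel_measurable_integrable[OF lim.hyps(4)] borel_measurable_integrable[OF lim.hyps(1)] by auto
  have "(\<lambda>i. (\<integral>\<^sup>+x. norm (f x - s i x) \<partial>lborel)) \<longlonglongrightarrow> 0"
  proof (rule nn_integral_dominated_convergence_norm[where w = "\<lambda>x. 2 * norm (f x)"])
    have "(\<integral>\<^sup>+x. ennreal (2 * norm (f x)) \<partial>lborel) = 2 * (\<integral>\<^sup>+x. ennreal (norm (f x)) \<partial>lborel)"
      by (simp add: ennreal_mult nn_integral_cmult)
    also have "\<dots> < \<infinity>" using lim.hyps(4) by (simp add: integrable_iff_bounded ennreal_mult_less_top)
    finally show "(\<integral>\<^sup>+x. ennreal (2 * norm (f x)) \<partial>lborel) < \<infinity>" .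
  qed (use lim.hyps in auto)
  note limit = this
  show ?case unfolding L1_approx_continuous_def
  proof (intro allI impI)
    fix e :: real assume "e > 0"
    then have e2: "e / 2 > 0" by simp
    then have "\<forall>\<^sub>F i in sequentially. (\<integral>\<^sup>+x. norm (f x - s i x) \<partial>lborel) < ennreal (e/2)"
      by (intro order_tendstoD(2)[OF limit]) simp
    then obtain i where i: "(\<integral>\<^sup>+x. norm (f x - s i x) \<partial>lborel) < ennreal (e/2)"
      by (auto simp: eventually_sequentially)
    obtain g R where g: "continuous_on UNIV g" "\<And>z. R \<le> norm z \<Longrightarrow> g z = 0"
      "(\<integral>\<^sup>+x. ennreal \<bar>s i x - g x\<bar> \<partial>lborel) < ennreal (e/2)"
      using lim.IH[of i] e2 unfolding L1_approx_continuous_def by blast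
    note [measurable] = borel_measurable_continuous_onI[OF g(1)]
    have "(\<integral>\<^sup>+x. ennreal \<bar>f x - g x\<bar> \<partial>lborel) \<le>
      (\<integral>\<^sup>+x. ennreal (norm (f x - s i x)) + ennreal \<bar>s i x - g x\<bar> \<partial>lborel)"
      by (intro nn_integral_mono) (simp add: ennreal_plus[symmetric] ennreal_leI del: ennreal_plus)
    also have "\<dots> = (\<integral>\<^sup>+x. ennreal (norm (f x - s i x)) \<partial>lborel) + (\<integral>\<^sup>+x. ennreal \<bar>s i x - g x\<bar> \<partial>lborel)"
      by (rule nn_integral_add) measurable
    also have "\<dots> < ennreal (e/2) + ennreal (e/2)"
      by (rule add_strict_mono[OF i g(3)])
    also have "\<dots> = ennreal e" using e2 by (simp add: ennreal_plus[symmetric] del: ennreal_plus)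
    finally show "\<exists>g R. continuous_on UNIV g \<and> (\<forall>z. R \<le> norm z \<longrightarrow> g z = 0) \<and>
      (\<integral>\<^sup>+x. ennreal \<bar>f x - g x\<bar> \<partial>lborel) < ennreal e" using g by blast
  qed
qed


text \<open>
Mollification is a contraction of \<open>L\<close> of order one and converges uniformly on a continuous function
of compact support, so a three-term estimate through such an approximation suffices.
\<close>

lemma mollify_L1_tendsto:
  fixes f :: "'a::euclidean_space \<Rightarrow> real"
  assumes f: "integrable lborel f" and e: "0 < e"
  shows "\<exists>\<epsilon>0>0. \<forall>\<epsilon>. 0 < \<epsilon> \<and> \<epsilon> \<le> \<epsilon>0 \<longrightarrow> (\<integral>\<^sup>+x. ennreal \<bar>mollify \<epsilon> f x - f x\<bar> \<partial>lborel) \<le> ennreal e"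
proof -
  have e3: "e / 3 > 0" using e by simp
  obtain g R where g: "continuous_on UNIV g" "\<And>z. R \<le> norm z \<Longrightarrow> g z = 0"
    "(\<integral>\<^sup>+x. ennreal \<bar>f x - g x\<bar> \<partial>lborel) < ennreal (e/3)"
    using integrable_L1_approx_continuous[OF f] e3 unfolding L1_approx_continuous_def by blast
  have [measurable]: "f \<in> borel_measurable borel" "g \<in> borel_measurable borel"
    using borel_measurable_integrable[OF f] borel_measurable_continuous_onI[OF g(1)] by auto
  have "integrable lborel (\<lambda>x. f x - g x)"
    using g(3) by (intro integrableI_bounded) (auto simp: less_top[symmetric] top_unique)
  note fg = this
  have gi: "integrable lborel g" using Bochner_Integration.integrable_diff[OF f fg] by simp
  define m where "m = measure lborel (cball (0::'a) (\<bar>R\<bar> + 1)) + 1"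
  have m: "m > 0" unfolding m_def by (intro add_nonneg_pos) auto
  \<comment> \<open>The mollified difference is at most \<open>\<kappa>\<close> and lives on a ball of measure less than \<open>m\<close>.\<close>
  define \<kappa> where "\<kappa> = e / 3 / m"
  have \<kappa>: "\<kappa> > 0" using e m by (simp add: \<kappa>_def)
  obtain d where d: "d > 0" "\<And>z w. norm (z - w) < d \<Longrightarrow> norm (g z - g w) < \<kappa>"
    using uniformly_continuous_compact_support[OF g(1,2) \<kappa>] by blast
  have "(\<integral>\<^sup>+x. ennreal \<bar>mollify \<epsilon> f x - f x\<bar> \<partial>lborel) \<le> ennreal e" if \<epsilon>: "0 < \<epsilon>" "\<epsilon> \<le> min (d/2) 1" for \<epsilon>
  proof -
    note [measurable] = mollifier_borel[OF \<epsilon>(1)]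
    have meas: "mollify \<epsilon> h \<in> borel_measurable borel" if "integrable lborel h" for h :: "'a \<Rightarrow> real"
      using mollify_has_derivative[OF \<epsilon>(1) that]
      by (intro borel_measurable_continuous_onI continuous_at_imp_continuous_on) (auto intro: has_derivative_continuous)
    note [measurable] = meas[OF fg] meas[OF gi]
    have ptw: "\<bar>mollify \<epsilon> g x - g x\<bar> \<le> \<kappa> * indicator (cball 0 (\<bar>R\<bar> + 1)) x" for x
    proof -
      have mi: "integrable lborel (\<lambda>y. mollifier \<epsilon> (x - y))" "(\<integral>y. mollifier \<epsilon> (x - y) \<partial>lborel) = 1"
      proof -
        show "integrable lborel (\<lambda>y. mollifier \<epsilon> (x - y))"
          using mollifier_nonneg[OF \<epsilon>(1)] mollifier_mass_shift(2)[OF \<epsilon>(1), of x]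
          by (intro integrableI_nonneg) auto
        show "(\<integral>y. mollifier \<epsilon> (x - y) \<partial>lborel) = 1"
          using mollifier_nonneg[OF \<epsilon>(1)] mollifier_mass_shift(2)[OF \<epsilon>(1), of x]
          by (subst integral_eq_nn_integral) auto
      qed
      have eq: "mollify \<epsilon> g x - g x = (\<integral>y. g y * mollifier \<epsilon> (x - y) - g x * mollifier \<epsilon> (x - y) \<partial>lborel)"
        unfolding mollify_def using mollify_integrands(1)[OF \<epsilon>(1) gi] mi by simp
      have "\<bar>mollify \<epsilon> g x - g x\<bar> \<le> (\<integral>y. (\<kappa> * indicator (cball 0 (\<bar>R\<bar> + 1)) x) * mollifier \<epsilon> (x - y) \<partial>lborel)"
        unfolding eq
      proof (rule integral_abs_bound_integral)
        fix y
        show "\<bar>g y * mollifier \<epsilon> (x - y) - g x * mollifier \<epsilon> (x - y)\<bar> \<le>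
          (\<kappa> * indicator (cball 0 (\<bar>R\<bar> + 1)) x) * mollifier \<epsilon> (x - y)"
        proof (cases "\<epsilon> \<le> norm (x - y)")
          case True
          then show ?thesis using mollifier_outside[OF \<epsilon>(1) True] by simp
        next
          case False
          have "\<bar>g y - g x\<bar> \<le> \<kappa> * indicator (cball 0 (\<bar>R\<bar> + 1)) x"
          proof (cases "x \<in> cball 0 (\<bar>R\<bar> + 1)")
            case True
            have "norm (y - x) < d" using False \<epsilon> d(1) by (simp add: norm_minus_commute)
            then show ?thesis using d(2)[of y x] True by simp
          next
            case out: False
            then have "norm x > \<bar>R\<bar> + 1" by simp
            moreover have "norm x - norm y \<le> norm (x - y)" by (rule norm_triangle_ineq2)
            ultimately have "R \<le> norm x" "R \<le> norm y" using False \<epsilon>(2) by linarith+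
            then show ?thesis using g(2) out by simp
          qed
          then have "\<bar>g y - g x\<bar> * mollifier \<epsilon> (x - y) \<le> (\<kappa> * indicator (cball 0 (\<bar>R\<bar> + 1)) x) * mollifier \<epsilon> (x - y)"
            using mollifier_nonneg[OF \<epsilon>(1)] by (rule mult_right_mono)
          moreover have "\<bar>g y * mollifier \<epsilon> (x - y) - g x * mollifier \<epsilon> (x - y)\<bar> = \<bar>g y - g x\<bar> * mollifier \<epsilon> (x - y)"
            using mollifier_nonneg[OF \<epsilon>(1), of "x - y"]
            by (simp only: left_diff_distrib[symmetric] abs_mult abs_of_nonneg)
          ultimately show ?thesis by (simp only:)
        qed
      qed (use mollify_integrands(1)[OF \<epsilon>(1) gi] mi in auto)
      then show ?thesis using mi by simp
    qed
    have t1: "(\<integral>\<^sup>+x. ennreal \<bar>mollify \<epsilon> (\<lambda>x. f x - g x) x\<bar> \<partial>lborel) \<le> ennreal (e/3)"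
      by (rule order_trans[OF mollify_L1_le[OF \<epsilon>(1)] less_imp_le[OF g(3)]]) measurable
    have t2: "(\<integral>\<^sup>+x. ennreal \<bar>mollify \<epsilon> g x - g x\<bar> \<partial>lborel) \<le> ennreal (e/3)"
    proof -
      have "(\<integral>\<^sup>+x. ennreal \<bar>mollify \<epsilon> g x - g x\<bar> \<partial>lborel) \<le> (\<integral>\<^sup>+x. ennreal \<kappa> * indicator (cball (0::'a) (\<bar>R\<bar> + 1)) x \<partial>lborel)"
      proof (intro nn_integral_mono)
        fix x
        have "ennreal \<bar>mollify \<epsilon> g x - g x\<bar> \<le> ennreal (\<kappa> * indicator (cball 0 (\<bar>R\<bar> + 1)) x)"
          using ptw by (rule ennreal_leI)
        then show "ennreal \<bar>mollify \<epsilon> g x - g x\<bar> \<le> ennreal \<kappa> * indicator (cball 0 (\<bar>R\<bar> + 1)) x"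
          using \<kappa> by (simp add: ennreal_mult ennreal_indicator)
      qed
      also have "\<dots> = ennreal \<kappa> * emeasure lborel (cball (0::'a) (\<bar>R\<bar> + 1))"
        by (intro nn_integral_cmult_indicator) auto
      also have "emeasure lborel (cball (0::'a) (\<bar>R\<bar> + 1)) = ennreal (m - 1)"
        unfolding m_def using emeasure_lborel_cball_finite[of "0::'a" "\<bar>R\<bar> + 1"]
        by (simp add: emeasure_eq_ennreal_measure)
      also have "ennreal \<kappa> * ennreal (m - 1) \<le> ennreal \<kappa> * ennreal m"
        by (intro mult_left_mono ennreal_leI) auto
      also have "\<dots> = ennreal (e/3)" using \<kappa> m by (simp add: ennreal_mult[symmetric] \<kappa>_def)
      finally show ?thesis .
    qed
    have t3: "(\<integral>\<^sup>+x. ennreal \<bar>f x - g x\<bar> \<partial>lborel) \<le> ennreal (e/3)" using g(3) by simp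
    have "(\<integral>\<^sup>+x. ennreal \<bar>mollify \<epsilon> f x - f x\<bar> \<partial>lborel) \<le>
      (\<integral>\<^sup>+x. ennreal \<bar>mollify \<epsilon> (\<lambda>x. f x - g x) x\<bar> + (ennreal \<bar>mollify \<epsilon> g x - g x\<bar> + ennreal \<bar>f x - g x\<bar>) \<partial>lborel)"
    proof (rule nn_integral_mono)
      fix x
      have "mollify \<epsilon> (\<lambda>x. f x - g x) x = mollify \<epsilon> f x - mollify \<epsilon> g x"
        unfolding mollify_def left_diff_distrib
        by (intro Bochner_Integration.integral_diff mollify_integrands \<epsilon>(1) f gi)
      then have "\<bar>mollify \<epsilon> f x - f x\<bar> \<le> \<bar>mollify \<epsilon> (\<lambda>x. f x - g x) x\<bar> + (\<bar>mollify \<epsilon> g x - g x\<bar> + \<bar>f x - g x\<bar>)"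
        by linarith
      from ennreal_leI[OF this]
      show "ennreal \<bar>mollify \<epsilon> f x - f x\<bar> \<le> ennreal \<bar>mollify \<epsilon> (\<lambda>x. f x - g x) x\<bar> +
        (ennreal \<bar>mollify \<epsilon> g x - g x\<bar> + ennreal \<bar>f x - g x\<bar>)" by simp
    qed
    also have "\<dots> = (\<integral>\<^sup>+x. ennreal \<bar>mollify \<epsilon> (\<lambda>x. f x - g x) x\<bar> \<partial>lborel) +
      (\<integral>\<^sup>+x. ennreal \<bar>mollify \<epsilon> g x - g x\<bar> + ennreal \<bar>f x - g x\<bar> \<partial>lborel)"
      by (rule nn_integral_add) measurable
    also have "(\<integral>\<^sup>+x. ennreal \<bar>mollify \<epsilon> g x - g x\<bar> + ennreal \<bar>f x - g x\<bar> \<partial>lborel) =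
      (\<integral>\<^sup>+x. ennreal \<bar>mollify \<epsilon> g x - g x\<bar> \<partial>lborel) + (\<integral>\<^sup>+x. ennreal \<bar>f x - g x\<bar> \<partial>lborel)"
      by (rule nn_integral_add) measurable
    also have "(\<integral>\<^sup>+x. ennreal \<bar>mollify \<epsilon> (\<lambda>x. f x - g x) x\<bar> \<partial>lborel) +
      ((\<integral>\<^sup>+x. ennreal \<bar>mollify \<epsilon> g x - g x\<bar> \<partial>lborel) + (\<integral>\<^sup>+x. ennreal \<bar>f x - g x\<bar> \<partial>lborel))
      \<le> ennreal (e/3) + (ennreal (e/3) + ennreal (e/3))"
      by (intro add_mono t1 t2 t3)
    also have "\<dots> = ennreal e" using e by (simp add: ennreal_plus[symmetric] del: ennreal_plus)
    finally show ?thesis .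
  qed
  then show ?thesis using d(1) by (intro exI[of _ "min (d/2) 1"]) auto
qed

section \<open>Smooth approximation of functions with a weak gradient\<close>

text \<open>
The notion of \<open>weak_gradient\<close> for Borel functions on the whole space, integrated against \<open>lborel\<close>.
Fubini's theorem is available for \<open>lborel\<close>, whereas functions that are merely Lebesgue measurable
need not be measurable for the product of Borel algebras.
\<close>

definition borel_gradient :: "'a::euclidean_space set \<Rightarrow> ('a \<Rightarrow> real) \<Rightarrow> ('a \<Rightarrow> 'a) \<Rightarrow> bool" where
  "borel_gradient \<Omega> u G \<longleftrightarrow> u \<in> borel_measurable borel \<and> G \<in> borel_measurable borel \<and>
    (\<forall>K. compact K \<and> K \<subseteq> \<Omega> \<longrightarrow> integrable lborel (\<lambda>x. indicator K x * u x) \<and>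
      integrable lborel (\<lambda>x. indicator K x *\<^sub>R G x)) \<and>
    (\<forall>\<phi> b. test_function \<Omega> \<phi> \<and> b \<in> Basis \<longrightarrow>
      (\<integral>x. u x * partial_deriv b \<phi> x \<partial>lborel) = - (\<integral>x. (G x \<bullet> b) * \<phi> x \<partial>lborel))"

text \<open>
The translated mollifier is an admissible test function as long as its support stays in \<open>\<Omega>\<close>. Hence
the gradient of the mollified function is the mollified weak gradient. The sign from the integration by
parts cancels the one from \<open>mollifier_grad\<close> being odd.
\<close>

lemma mollify_grad_eq:
  assumes G: "borel_gradient \<Omega> u G" and K: "compact K" "K \<subseteq> \<Omega>" and \<epsilon>: "0 < \<epsilon>" and x: "cball x \<epsilon> \<subseteq> K"
  shows "mollify_grad \<epsilon> (\<lambda>y. indicator K y * u y) x = (\<integral>y. mollifier \<epsilon> (x - y) *\<^sub>R (indicator K y *\<^sub>R G y) \<partial>lborel)"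
    "integrable lborel (\<lambda>y. mollifier \<epsilon> (x - y) *\<^sub>R (indicator K y *\<^sub>R G y))"
proof -
  note [measurable] = mollifier_borel[OF \<epsilon>]
  have iu: "integrable lborel (\<lambda>y. indicator K y * u y)" and iG: "integrable lborel (\<lambda>y. indicator K y *\<^sub>R G y)"
    using G K unfolding borel_gradient_def by blast+
  have [measurable]: "G \<in> borel_measurable borel" "K \<in> sets borel"
    using G K by (auto simp: borel_gradient_def borel_compact)
  obtain c where c: "c \<ge> 0" "\<And>z::'a. norm (mollifier \<epsilon> z) \<le> c"
    using bounded_compact_support[OF mollifier_continuous[OF \<epsilon>] mollifier_outside[OF \<epsilon>]] by blast
  show int: "integrable lborel (\<lambda>y. mollifier \<epsilon> (x - y) *\<^sub>R (indicator K y *\<^sub>R G y))"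
  proof (rule Bochner_Integration.integrable_bound[OF integrable_norm[OF integrable_scaleR_right[OF iG, of c]]])
    show "AE y in lborel. norm (mollifier \<epsilon> (x - y) *\<^sub>R (indicator K y *\<^sub>R G y)) \<le> norm (norm (c *\<^sub>R (indicator K y *\<^sub>R G y)))"
    proof (rule AE_I2)
      fix y
      have "norm (mollifier \<epsilon> (x - y) *\<^sub>R W) \<le> norm (norm (c *\<^sub>R W))" for W :: 'a
        using mult_right_mono[OF c(2)[of "x - y"], of "norm W"] c(1) by simp
      then show "norm (mollifier \<epsilon> (x - y) *\<^sub>R (indicator K y *\<^sub>R G y)) \<le> norm (norm (c *\<^sub>R (indicator K y *\<^sub>R G y)))" .
    qed
  qed measurable
  show "mollify_grad \<epsilon> (\<lambda>y. indicator K y * u y) x = (\<integral>y. mollifier \<epsilon> (x - y) *\<^sub>R (indicator K y *\<^sub>R G y) \<partial>lborel)"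
  proof (rule euclidean_eqI)
    fix b :: 'a assume b: "b \<in> Basis"
    let ?\<phi> = "\<lambda>y. mollifier \<epsilon> (y - x)"
    have out: "mollifier \<epsilon> (x - y) = 0" "mollifier_grad \<epsilon> (x - y) = 0" if "y \<notin> K" for y
    proof -
      have "\<epsilon> \<le> norm (x - y)" using x that by (force simp: dist_norm)
      then show "mollifier \<epsilon> (x - y) = 0" "mollifier_grad \<epsilon> (x - y) = 0"
        using mollifier_outside[OF \<epsilon>] mollifier_grad_outside[OF \<epsilon>] by auto
    qed
    have odd: "mollifier_grad \<epsilon> (y - x) = - mollifier_grad \<epsilon> (x - y)" for y
    proof -
      have "(y - x) \<bullet> (y - x) = (x - y) \<bullet> (x - y)" by (metis inner_minus_left inner_minus_right minus_diff_eq minus_minus)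
      then show ?thesis unfolding mollifier_grad_def by (simp add: scaleR_right_diff_distrib)
    qed
    have "cball x \<epsilon> \<subseteq> \<Omega>" using x K by blast
    from mollifier_test_function[OF \<epsilon> this]
    have weak: "(\<integral>y. u y * partial_deriv b ?\<phi> y \<partial>lborel) = - (\<integral>y. (G y \<bullet> b) * ?\<phi> y \<partial>lborel)"
      using G b unfolding borel_gradient_def by blast
    have "mollify_grad \<epsilon> (\<lambda>y. indicator K y * u y) x \<bullet> b =
      (\<integral>y. ((indicator K y * u y) *\<^sub>R mollifier_grad \<epsilon> (x - y)) \<bullet> b \<partial>lborel)"
      unfolding mollify_grad_def by (intro integral_inner_left[symmetric] mollify_integrands(2) \<epsilon> iu)
    also have "\<dots> = - (\<integral>y. u y * partial_deriv b ?\<phi> y \<partial>lborel)"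
      unfolding partial_deriv_mollifier_shift[OF \<epsilon>] odd integral_minus[symmetric]
      by (intro Bochner_Integration.integral_cong) (use out in \<open>auto simp: indicator_def\<close>)
    also have "\<dots> = (\<integral>y. (mollifier \<epsilon> (x - y) *\<^sub>R (indicator K y *\<^sub>R G y)) \<bullet> b \<partial>lborel)"
      unfolding weak minus_minus
      by (intro Bochner_Integration.integral_cong) (use out mollifier_even[OF \<epsilon>] in \<open>auto simp: indicator_def\<close>)
    also have "\<dots> = (\<integral>y. mollifier \<epsilon> (x - y) *\<^sub>R (indicator K y *\<^sub>R G y) \<partial>lborel) \<bullet> b"
      by (intro integral_inner_left int)
    finally show "mollify_grad \<epsilon> (\<lambda>y. indicator K y * u y) x \<bullet> b =
      (\<integral>y. mollifier \<epsilon> (x - y) *\<^sub>R (indicator K y *\<^sub>R G y) \<partial>lborel) \<bullet> b" .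
  qed
qed

text \<open>
Cutting \<open>u\<close> off outside a compact neighbourhood \<open>K\<close> of \<open>A\<close> makes it integrable on the whole space and does
not change its mollifications on \<open>A\<close> once the radius is small.
\<close>

lemma smooth_approximation:
  fixes \<Omega> A :: "'a::euclidean_space set"
  assumes G: "borel_gradient \<Omega> u G" and \<Omega>: "open \<Omega>" and A: "bounded A" "closure A \<subseteq> \<Omega>" and e: "0 < e"
  shows "\<exists>w F. (\<forall>x. (w has_derivative (\<lambda>h. F x \<bullet> h)) (at x)) \<and> continuous_on UNIV F \<and>
    (\<integral>\<^sup>+x. indicator A x * ennreal \<bar>w x - u x\<bar> \<partial>lborel) \<le> ennreal e \<and>
    (\<integral>\<^sup>+x. indicator A x * (ennreal (norm (F x)))\<^sup>2 \<partial>lborel) \<le> (\<integral>\<^sup>+x. indicator \<Omega> x * (ennreal (norm (G x)))\<^sup>2 \<partial>lborel)"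
proof -
  have cA: "compact (closure A)" using A by (simp add: compact_closure)
  obtain \<epsilon>1 where \<epsilon>1: "\<epsilon>1 > 0" "(\<Union>x\<in>closure A. cball x \<epsilon>1) \<subseteq> \<Omega>"
    using compact_subset_open_imp_cball_epsilon_subset[OF cA \<Omega> A(2)] by blast
  define K where "K = (\<Union>x\<in>closure A. \<Union>y\<in>cball 0 \<epsilon>1. {x + y})"
  have K: "compact K" unfolding K_def by (rule compact_sums'[OF cA compact_cball])
  have cbK: "cball x \<epsilon>1 \<subseteq> K" if "x \<in> closure A" for x
  proof
    fix z assume "z \<in> cball x \<epsilon>1"
    then have "z - x \<in> cball 0 \<epsilon>1" by (simp add: dist_norm norm_minus_commute)
    then show "z \<in> K" using that unfolding K_def by force
  qed
  have K\<Omega>: "K \<subseteq> \<Omega>"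
  proof
    fix z assume "z \<in> K"
    then obtain x y where "x \<in> closure A" "y \<in> cball 0 \<epsilon>1" "z = x + y" unfolding K_def by blast
    then have "z \<in> cball x \<epsilon>1" by (simp add: dist_norm)
    then show "z \<in> \<Omega>" using \<epsilon>1 \<open>x \<in> closure A\<close> by blast
  qed
  define f where "f = (\<lambda>y. indicator K y * u y)"
  have f: "integrable lborel f" using G K K\<Omega> unfolding borel_gradient_def f_def by blast
  obtain \<epsilon>0 where \<epsilon>0: "\<epsilon>0 > 0" "\<And>\<epsilon>. 0 < \<epsilon> \<Longrightarrow> \<epsilon> \<le> \<epsilon>0 \<Longrightarrow> (\<integral>\<^sup>+x. ennreal \<bar>mollify \<epsilon> f x - f x\<bar> \<partial>lborel) \<le> ennreal e"
    using mollify_L1_tendsto[OF f e] by blast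
  define \<epsilon> where "\<epsilon> = min \<epsilon>0 \<epsilon>1"
  have \<epsilon>: "0 < \<epsilon>" "\<epsilon> \<le> \<epsilon>0" "\<epsilon> \<le> \<epsilon>1" using \<epsilon>0 \<epsilon>1 by (auto simp: \<epsilon>_def)
  have AK: "cball x \<epsilon> \<subseteq> K" if "x \<in> A" for x
    using cbK[of x] that closure_subset[of A] \<epsilon>(3) by force
  have [measurable]: "G \<in> borel_measurable borel" "K \<in> sets borel"
    using G K by (auto simp: borel_gradient_def borel_compact)
  define N where "N = (\<lambda>y. indicator K y * ennreal (norm (G y)))"
  have N[measurable]: "N \<in> borel_measurable borel" unfolding N_def by measurable
  have "(\<integral>\<^sup>+x. indicator A x * ennreal \<bar>mollify \<epsilon> f x - u x\<bar> \<partial>lborel) \<le> (\<integral>\<^sup>+x. ennreal \<bar>mollify \<epsilon> f x - f x\<bar> \<partial>lborel)"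
  proof (rule nn_integral_mono)
    fix x
    show "indicator A x * ennreal \<bar>mollify \<epsilon> f x - u x\<bar> \<le> ennreal \<bar>mollify \<epsilon> f x - f x\<bar>"
    proof (cases "x \<in> A")
      case True
      have "x \<in> cball x \<epsilon>" using \<epsilon>(1) by simp
      then have "x \<in> K" using AK[OF True] by blast
      then show ?thesis using True by (simp add: f_def)
    qed simp
  qed
  also have "\<dots> \<le> ennreal e" by (rule \<epsilon>0(2)[OF \<epsilon>(1,2)])
  finally have L1: "(\<integral>\<^sup>+x. indicator A x * ennreal \<bar>mollify \<epsilon> f x - u x\<bar> \<partial>lborel) \<le> ennreal e" .
  have "(\<integral>\<^sup>+x. indicator A x * (ennreal (norm (mollify_grad \<epsilon> f x)))\<^sup>2 \<partial>lborel) \<le>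
    (\<integral>\<^sup>+x. (\<integral>\<^sup>+y. N y * ennreal (mollifier \<epsilon> (x - y)) \<partial>lborel)\<^sup>2 \<partial>lborel)"
  proof (rule nn_integral_mono)
    fix x
    show "indicator A x * (ennreal (norm (mollify_grad \<epsilon> f x)))\<^sup>2 \<le> (\<integral>\<^sup>+y. N y * ennreal (mollifier \<epsilon> (x - y)) \<partial>lborel)\<^sup>2"
    proof (cases "x \<in> A")
      case True
      note g = mollify_grad_eq[OF G K K\<Omega> \<epsilon>(1) AK[OF True], folded f_def]
      have "ennreal (norm (mollify_grad \<epsilon> f x)) \<le> (\<integral>\<^sup>+y. ennreal (norm (mollifier \<epsilon> (x - y) *\<^sub>R (indicator K y *\<^sub>R G y))) \<partial>lborel)"
        unfolding g(1) by (rule integral_norm_bound_ennreal[OF g(2)])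
      also have "\<dots> = (\<integral>\<^sup>+y. N y * ennreal (mollifier \<epsilon> (x - y)) \<partial>lborel)"
      proof (rule nn_integral_cong)
        fix y
        show "ennreal (norm (mollifier \<epsilon> (x - y) *\<^sub>R (indicator K y *\<^sub>R G y))) = N y * ennreal (mollifier \<epsilon> (x - y))"
          using mollifier_nonneg[OF \<epsilon>(1), of "x - y"]
          by (cases "y \<in> K") (auto simp: N_def ennreal_mult[symmetric] mult.commute)
      qed
      finally have "(ennreal (norm (mollify_grad \<epsilon> f x)))\<^sup>2 \<le> (\<integral>\<^sup>+y. N y * ennreal (mollifier \<epsilon> (x - y)) \<partial>lborel)\<^sup>2"
        by (intro power_mono) auto
      then show ?thesis using True by simp
    qed simp
  qed
  also have "\<dots> \<le> (\<integral>\<^sup>+y. (N y)\<^sup>2 \<partial>lborel)" by (rule mollify_energy_le[OF \<epsilon>(1) N])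
  also have "\<dots> \<le> (\<integral>\<^sup>+x. indicator \<Omega> x * (ennreal (norm (G x)))\<^sup>2 \<partial>lborel)"
    using K\<Omega> by (intro nn_integral_mono) (auto simp: N_def split: split_indicator)
  finally have "(\<integral>\<^sup>+x. indicator A x * (ennreal (norm (mollify_grad \<epsilon> f x)))\<^sup>2 \<partial>lborel) \<le>
    (\<integral>\<^sup>+x. indicator \<Omega> x * (ennreal (norm (G x)))\<^sup>2 \<partial>lborel)" .
  then show ?thesis using L1 mollify_has_derivative[OF \<epsilon>(1) f] mollify_grad_continuous[OF \<epsilon>(1) f]
    by (intro exI[of _ "mollify \<epsilon> f"] exI[of _ "mollify_grad \<epsilon> f"]) blast
qed

section \<open>Poincare-Sobolev inequality on star-shaped sets\<close>

text \<open>
The oscillation of \<open>u\<close> on a part \<open>W\<close> of \<open>\<Omega>\<close>, controlled by the energy on all of \<open>\<Omega>\<close>. Keeping the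
energy on \<open>\<Omega>\<close> makes the property stable under unions of overlapping parts.
\<close>

definition poincare_on :: "'a::euclidean_space set \<Rightarrow> real \<Rightarrow> 'a set \<Rightarrow> bool" where
  "poincare_on \<Omega> r W \<longleftrightarrow> (\<exists>C\<ge>0. \<forall>u G D. borel_gradient \<Omega> u G \<and> 0 < D \<and>
    (\<integral>\<^sup>+x. indicator \<Omega> x * (ennreal (norm (G x)))\<^sup>2 \<partial>lborel) \<le> ennreal (D\<^sup>2) \<longrightarrow>
    (\<exists>c. (\<integral>\<^sup>+x. indicator W x * ennreal (\<bar>u x - c\<bar> powr r) \<partial>lborel) \<le> ennreal (C * D powr r)))"

lemma double_integral_difference_le:
  fixes w :: "'a::euclidean_space \<Rightarrow> real"
  assumes w: "w \<in> borel_measurable borel" and A: "A \<in> sets borel" and r: "0 < r"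
    and V: "emeasure lborel A \<le> ennreal V" "0 \<le> V"
    and H: "(\<integral>\<^sup>+x. indicator A x * ennreal (\<bar>w x - c\<bar> powr r) \<partial>lborel) \<le> ennreal H" "0 \<le> H"
  shows "(\<integral>\<^sup>+x. \<integral>\<^sup>+y. indicator A x * indicator A y * ennreal (\<bar>w x - w y\<bar> powr r) \<partial>lborel \<partial>lborel) \<le>
    ennreal (2 powr r * (2 * V * H))"
proof -
  note [measurable] = w A
  let ?d = "\<lambda>x. indicator A x * ennreal (\<bar>w x - c\<bar> powr r)"
  let ?I = "\<integral>\<^sup>+x. ?d x \<partial>lborel"
  have pt: "indicator A x * indicator A y * ennreal (\<bar>w x - w y\<bar> powr r) \<le>
     ennreal (2 powr r) * (?d x * indicator A y + indicator A x * ?d y)" for x y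
  proof (cases "x \<in> A \<and> y \<in> A")
    case True
    have "\<bar>w x - w y\<bar> powr r \<le> 2 powr r * (\<bar>w x - c\<bar> powr r + \<bar>w y - c\<bar> powr r)"
      using abs_powr_add_le[OF r, of "w x - c" "c - w y"] by (simp add: abs_minus_commute)
    from ennreal_leI[OF this] show ?thesis using True by (simp add: ennreal_mult)
  qed auto
  have inner: "(\<integral>\<^sup>+y. ?d x * indicator A y + indicator A x * ?d y \<partial>lborel) =
    ?d x * emeasure lborel A + indicator A x * ?I" for x
  proof -
    have "(\<integral>\<^sup>+y. ?d x * indicator A y + indicator A x * ?d y \<partial>lborel) =
      (\<integral>\<^sup>+y. ?d x * indicator A y \<partial>lborel) + (\<integral>\<^sup>+y. indicator A x * ?d y \<partial>lborel)"
      by (rule nn_integral_add) measurable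
    also have "(\<integral>\<^sup>+y. ?d x * indicator A y \<partial>lborel) = ?d x * emeasure lborel A"
      using A by (intro nn_integral_cmult_indicator) auto
    also have "(\<integral>\<^sup>+y. indicator A x * ?d y \<partial>lborel) = indicator A x * ?I"
      by (rule nn_integral_cmult) measurable
    finally show ?thesis .
  qed
  have "(\<integral>\<^sup>+x. \<integral>\<^sup>+y. indicator A x * indicator A y * ennreal (\<bar>w x - w y\<bar> powr r) \<partial>lborel \<partial>lborel) \<le>
    (\<integral>\<^sup>+x. \<integral>\<^sup>+y. ennreal (2 powr r) * (?d x * indicator A y + indicator A x * ?d y) \<partial>lborel \<partial>lborel)"
    by (intro nn_integral_mono pt)
  also have "\<dots> = (\<integral>\<^sup>+x. ennreal (2 powr r) * (?d x * emeasure lborel A + indicator A x * ?I) \<partial>lborel)"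
  proof (rule nn_integral_cong)
    fix x
    have "(\<integral>\<^sup>+y. ennreal (2 powr r) * (?d x * indicator A y + indicator A x * ?d y) \<partial>lborel) =
      ennreal (2 powr r) * (\<integral>\<^sup>+y. ?d x * indicator A y + indicator A x * ?d y \<partial>lborel)"
      by (rule nn_integral_cmult) measurable
    then show "(\<integral>\<^sup>+y. ennreal (2 powr r) * (?d x * indicator A y + indicator A x * ?d y) \<partial>lborel) =
      ennreal (2 powr r) * (?d x * emeasure lborel A + indicator A x * ?I)"
      unfolding inner .
  qed
  also have "\<dots> = ennreal (2 powr r) * (\<integral>\<^sup>+x. ?d x * emeasure lborel A + indicator A x * ?I \<partial>lborel)"
    by (rule nn_integral_cmult) measurable
  also have "(\<integral>\<^sup>+x. ?d x * emeasure lborel A + indicator A x * ?I \<partial>lborel) =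
    (\<integral>\<^sup>+x. ?d x * emeasure lborel A \<partial>lborel) + (\<integral>\<^sup>+x. indicator A x * ?I \<partial>lborel)"
    by (rule nn_integral_add) measurable
  also have "(\<integral>\<^sup>+x. ?d x * emeasure lborel A \<partial>lborel) = ?I * emeasure lborel A"
    by (rule nn_integral_multc) measurable
  also have "(\<integral>\<^sup>+x. indicator A x * ?I \<partial>lborel) = emeasure lborel A * ?I"
    using A by (subst nn_integral_multc) auto
  also have "ennreal (2 powr r) * (?I * emeasure lborel A + emeasure lborel A * ?I) \<le>
    ennreal (2 powr r) * (ennreal H * ennreal V + ennreal V * ennreal H)"
    using V H by (intro mult_left_mono add_mono mult_mono) auto
  also have "\<dots> = ennreal (2 powr r * (2 * V * H))"
  proof -
    have "2 powr r * (2 * V * H) = 2 powr r * (H * V + V * H)" by simp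
    then show ?thesis using V H by (simp only: ennreal_mult ennreal_plus mult_nonneg_nonneg add_nonneg_nonneg powr_ge_zero)
  qed
  finally show ?thesis .
qed

text \<open>
If \<open>J\<close> exceeded twice its mean bound everywhere on \<open>U\<close>, its integral would be too large.
\<close>

lemma exists_good_base_point:
  fixes J :: "'a::euclidean_space \<Rightarrow> ennreal"
  assumes J: "J \<in> borel_measurable borel" and U: "U \<in> sets borel" "ennreal m \<le> emeasure lborel U" "0 < m"
    and H: "(\<integral>\<^sup>+y. indicator U y * J y \<partial>lborel) \<le> ennreal H" "0 < H"
  shows "\<exists>y\<in>U. J y \<le> ennreal (2 * H / m)"
proof (rule ccontr)
  assume "\<not> (\<exists>y\<in>U. J y \<le> ennreal (2 * H / m))"
  then have *: "ennreal (2 * H / m) \<le> J y" if "y \<in> U" for y using that by (meson nle_le)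
  have "ennreal (2 * H) = ennreal (2 * H / m) * ennreal m"
    using U H by (simp add: ennreal_mult[symmetric])
  also have "\<dots> \<le> ennreal (2 * H / m) * emeasure lborel U" using U by (intro mult_left_mono) auto
  also have "\<dots> = (\<integral>\<^sup>+y. ennreal (2 * H / m) * indicator U y \<partial>lborel)"
    using U by (intro nn_integral_cmult_indicator[symmetric]) auto
  also have "\<dots> \<le> (\<integral>\<^sup>+y. indicator U y * J y \<partial>lborel)"
    using * by (intro nn_integral_mono) (auto split: split_indicator)
  also have "\<dots> \<le> ennreal H" by (rule H)
  finally show False using H by (simp add: ennreal_le_iff)
qed

text \<open>
Double integrals of differences pass to the limit without any control of the additive constants of the
approximations: along a subsequence \<open>w j\<close> converges almost everywhere, and Fatou's lemma is applied
once in each variable.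
\<close>

lemma double_integral_difference_limit:
  fixes u :: "'a::euclidean_space \<Rightarrow> real" and w :: "nat \<Rightarrow> 'a \<Rightarrow> real" and A :: "nat \<Rightarrow> 'a set"
  assumes u: "u \<in> borel_measurable borel" and U: "U \<in> sets borel"
    and w: "\<And>j. w j \<in> borel_measurable borel" and A: "\<And>j. A j \<in> sets borel"
    and exh: "\<And>x. x \<in> U \<Longrightarrow> \<forall>\<^sub>F j in sequentially. x \<in> A j"
    and L1: "\<And>j. (\<integral>\<^sup>+x. indicator (A j) x * ennreal \<bar>w j x - u x\<bar> \<partial>lborel) \<le> ennreal ((1/2)^j)"
    and H: "\<And>j. (\<integral>\<^sup>+x. \<integral>\<^sup>+y. indicator (A j) x * indicator (A j) y * ennreal (\<bar>w j x - w j y\<bar> powr r) \<partial>lborel \<partial>lborel) \<le> ennreal H"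
    and r: "0 < r"
  shows "(\<integral>\<^sup>+x. \<integral>\<^sup>+y. indicator U x * indicator U y * ennreal (\<bar>u x - u y\<bar> powr r) \<partial>lborel \<partial>lborel) \<le> ennreal H"
proof -
  note [measurable] = u U w A
  let ?d = "\<lambda>j x. indicator (A j) x * (w j x - u x)"
  have dn: "ennreal (norm (?d j x)) = indicator (A j) x * ennreal \<bar>w j x - u x\<bar>" for j x
    by (auto split: split_indicator)
  have di: "integrable lborel (?d j)" for j
  proof (rule integrableI_bounded)
    show "(\<integral>\<^sup>+x. ennreal (norm (?d j x)) \<partial>lborel) < \<infinity>"
      unfolding dn by (rule le_less_trans[OF L1]) simp
  qed measurable
  have le: "(\<integral>x. norm (?d j x) \<partial>lborel) \<le> (1/2)^j" for j
  proof -
    have "ennreal (\<integral>x. norm (?d j x) \<partial>lborel) = (\<integral>\<^sup>+x. ennreal (norm (?d j x)) \<partial>lborel)"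
      using di[of j] by (intro nn_integral_eq_integral[symmetric]) auto
    also have "\<dots> \<le> ennreal ((1/2)^j)" unfolding dn by (rule L1)
    finally show ?thesis by (subst (asm) ennreal_le_iff) auto
  qed
  have "(\<lambda>j. \<integral>x. norm (?d j x) \<partial>lborel) \<longlonglongrightarrow> 0"
  proof (rule tendsto_sandwich[OF _ _ tendsto_const])
    show "(\<lambda>j. (1/2::real)^j) \<longlonglongrightarrow> 0" by (rule LIMSEQ_power_zero) simp
  qed (use le in auto)
  from tendsto_L1_AE_subseq[OF di this]
  obtain \<rho> where \<rho>: "strict_mono \<rho>" and ae: "AE x in lborel. (\<lambda>k. ?d (\<rho> k) x) \<longlonglongrightarrow> 0" by blast
  have exh\<rho>: "\<forall>\<^sub>F k in sequentially. x \<in> A (\<rho> k)" if "x \<in> U" for x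
    using eventually_subseq[OF \<rho> exh[OF that]] .
  have conv: "(\<lambda>k. w (\<rho> k) x) \<longlonglongrightarrow> u x" if "x \<in> U" "(\<lambda>k. ?d (\<rho> k) x) \<longlonglongrightarrow> 0" for x
  proof -
    have "(\<lambda>k. ?d (\<rho> k) x + u x) \<longlonglongrightarrow> 0 + u x" using that(2) by (intro tendsto_intros)
    then have "(\<lambda>k. ?d (\<rho> k) x + u x) \<longlonglongrightarrow> u x" by simp
    then show ?thesis
      by (rule Lim_transform_eventually) (use exh\<rho>[OF that(1)] in \<open>auto elim!: eventually_mono\<close>)
  qed
  let ?h = "\<lambda>k x y. indicator (A (\<rho> k)) x * indicator (A (\<rho> k)) y * ennreal (\<bar>w (\<rho> k) x - w (\<rho> k) y\<bar> powr r)"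
  let ?l = "\<lambda>x y. indicator U x * indicator U y * ennreal (\<bar>u x - u y\<bar> powr r)"
  have pt: "?l x y \<le> liminf (\<lambda>k. ?h k x y)"
    if "(\<lambda>k. ?d (\<rho> k) x) \<longlonglongrightarrow> 0" "(\<lambda>k. ?d (\<rho> k) y) \<longlonglongrightarrow> 0" for x y
  proof (cases "x \<in> U \<and> y \<in> U")
    case True
    have lim: "(\<lambda>k. ennreal (\<bar>w (\<rho> k) x - w (\<rho> k) y\<bar> powr r)) \<longlonglongrightarrow> ennreal (\<bar>u x - u y\<bar> powr r)"
      using conv[of x] conv[of y] True that r
      by (intro tendsto_ennrealI tendsto_powr' tendsto_rabs tendsto_diff tendsto_const) auto
    have ev: "\<forall>\<^sub>F k in sequentially. ennreal (\<bar>w (\<rho> k) x - w (\<rho> k) y\<bar> powr r) = ?h k x y"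
      by (rule eventually_mono[OF eventually_conj[OF exh\<rho>[OF conjunct1[OF True]] exh\<rho>[OF conjunct2[OF True]]]]) simp
    have "(\<lambda>k. ?h k x y) \<longlonglongrightarrow> ennreal (\<bar>u x - u y\<bar> powr r)"
      by (rule Lim_transform_eventually[OF lim ev])
    then have "liminf (\<lambda>k. ?h k x y) = ennreal (\<bar>u x - u y\<bar> powr r)"
      by (intro lim_imp_Liminf) auto
    then show ?thesis using True by simp
  qed auto
  have "(\<integral>\<^sup>+x. \<integral>\<^sup>+y. ?l x y \<partial>lborel \<partial>lborel) \<le> (\<integral>\<^sup>+x. \<integral>\<^sup>+y. liminf (\<lambda>k. ?h k x y) \<partial>lborel \<partial>lborel)"
  proof (rule nn_integral_mono_AE)
    show "AE x in lborel. (\<integral>\<^sup>+y. ?l x y \<partial>lborel) \<le> (\<integral>\<^sup>+y. liminf (\<lambda>k. ?h k x y) \<partial>lborel)"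
      using ae
    proof eventually_elim
      case x: (elim x)
      show ?case
      proof (rule nn_integral_mono_AE)
        show "AE y in lborel. ?l x y \<le> liminf (\<lambda>k. ?h k x y)"
          using ae by eventually_elim (rule pt[OF x])
      qed
    qed
  qed
  also have "\<dots> \<le> (\<integral>\<^sup>+x. liminf (\<lambda>k. \<integral>\<^sup>+y. ?h k x y \<partial>lborel) \<partial>lborel)"
    by (intro nn_integral_mono nn_integral_liminf) measurable
  also have "\<dots> \<le> liminf (\<lambda>k. \<integral>\<^sup>+x. \<integral>\<^sup>+y. ?h k x y \<partial>lborel \<partial>lborel)"
    by (intro nn_integral_liminf) measurable
  also have "\<dots> \<le> liminf (\<lambda>k. ennreal H)"
    by (intro Liminf_mono always_eventually allI H)
  also have "\<dots> = ennreal H" by (simp add: Liminf_const)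
  finally show ?thesis .
qed

text \<open>
Contracting \<open>U\<close> towards \<open>y0\<close> gives sets \<open>A j\<close> whose closures lie in \<open>U\<close>, because a point of the closure
can be corrected by moving the centre inside the ball. On \<open>A j\<close> the function can be mollified, all \<open>A j\<close> are
star-shaped with respect to the same ball \<open>B\<close>, and the smooth inequality holds on them with one
constant. In the limit one obtains a bound on the double integral of differences; fixing one of its two
variables at a good base point produces the constant.
\<close>

lemma poincare_on_star_shaped:
  fixes \<Omega> U :: "'a::euclidean_space set"
  assumes n: "real DIM('a) \<le> n" "2 < n" and \<Omega>: "open \<Omega>" and U: "open U" "bounded U" "U \<subseteq> \<Omega>"
    and \<sigma>: "0 < \<sigma>" "ball y0 \<sigma> \<subseteq> U"
    and star: "\<And>x y t. x \<in> U \<Longrightarrow> y \<in> ball y0 \<sigma> \<Longrightarrow> t \<in> {0..1} \<Longrightarrow> x + t *\<^sub>R (y - x) \<in> U"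
  shows "poincare_on \<Omega> (2 * n / (n - 2)) U"
proof -
  define r where "r = 2 * n / (n - 2)"
  have r: "0 < r" using n by (simp add: r_def)
  define \<tau> where "\<tau> = (\<lambda>j::nat. 1 - 1 / real (j + 2))"
  have \<tau>: "1/2 \<le> \<tau> j" "\<tau> j < 1" for j by (auto simp: \<tau>_def field_simps)
  define A where "A = (\<lambda>j. (\<lambda>x. (1 - \<tau> j) *\<^sub>R y0 + \<tau> j *\<^sub>R x) ` U)"
  define B where "B = ball y0 (\<sigma>/2)"
  have y0: "y0 \<in> ball y0 \<sigma>" using \<sigma> by simp
  have Aopen: "open (A j)" for j
    unfolding A_def using \<tau>(1)[of j] U(1) by (intro open_affinity) auto
  have AU: "A j \<subseteq> U" for j
  proof
    fix z assume "z \<in> A j"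
    then obtain x where x: "x \<in> U" "z = (1 - \<tau> j) *\<^sub>R y0 + \<tau> j *\<^sub>R x" unfolding A_def by blast
    then have "z = x + (1 - \<tau> j) *\<^sub>R (y0 - x)" by (simp add: algebra_simps)
    then show "z \<in> U" using star[OF x(1) y0, of "1 - \<tau> j"] \<tau>[of j] by simp
  qed
  have clA: "closure (A j) \<subseteq> U" for j
  proof
    fix z assume "z \<in> closure (A j)"
    moreover have "(1 - \<tau> j) * \<sigma> > 0" using \<tau>[of j] \<sigma> by simp
    ultimately obtain v where v: "v \<in> A j" "dist v z < (1 - \<tau> j) * \<sigma>"
      unfolding closure_approachable by blast
    then obtain x where x: "x \<in> U" "v = (1 - \<tau> j) *\<^sub>R y0 + \<tau> j *\<^sub>R x" unfolding A_def by blast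
    define y where "y = y0 + (1 / (1 - \<tau> j)) *\<^sub>R (z - v)"
    have "norm (y - y0) = dist v z / (1 - \<tau> j)"
      using \<tau>[of j] by (simp add: y_def dist_norm norm_minus_commute)
    also have "\<dots> < \<sigma>" using v(2) \<tau>[of j] by (simp add: pos_divide_less_eq mult.commute)
    finally have "y \<in> ball y0 \<sigma>" by (simp add: dist_norm norm_minus_commute)
    then have "x + (1 - \<tau> j) *\<^sub>R (y - x) \<in> U" using x star[OF x(1), of y "1 - \<tau> j"] \<tau>[of j] by simp
    moreover have "(1 - \<tau> j) *\<^sub>R y = (1 - \<tau> j) *\<^sub>R y0 + (z - v)" using \<tau>[of j] by (simp add: y_def scaleR_add_right)
    then have "x + (1 - \<tau> j) *\<^sub>R (y - x) = z" using x(2) by (simp add: algebra_simps)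
    ultimately show "z \<in> U" by simp
  qed
  have preimage: "\<exists>y'\<in>ball y0 \<sigma>. y = (1 - \<tau> j) *\<^sub>R y0 + \<tau> j *\<^sub>R y'" if "y \<in> B" for y j
  proof -
    let ?y = "y0 + (1 / \<tau> j) *\<^sub>R (y - y0)"
    have "norm (y - y0) / \<tau> j < \<sigma>"
    proof -
      have "norm (y - y0) < \<sigma>/2" using that by (simp add: B_def dist_norm norm_minus_commute)
      moreover have "\<sigma>/2 \<le> \<sigma> * \<tau> j" using \<tau>(1)[of j] \<sigma> by (simp add: mult_left_mono[of "1/2" "\<tau> j" \<sigma>, simplified])
      ultimately show ?thesis using \<tau>(1)[of j] by (simp add: pos_divide_less_eq)
    qed
    then have "?y \<in> ball y0 \<sigma>" using \<tau>(1)[of j] by (simp add: dist_norm)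
    moreover have "y = (1 - \<tau> j) *\<^sub>R y0 + \<tau> j *\<^sub>R ?y" using \<tau>(1)[of j] by (simp add: algebra_simps)
    ultimately show ?thesis by blast
  qed
  have BA: "B \<subseteq> A j" for j using preimage[of _ j] \<sigma>(2) unfolding A_def by blast
  have starA: "x + t *\<^sub>R (y - x) \<in> A j" if xy: "x \<in> A j" "y \<in> B" "t \<in> {0..1}" for x y t j
  proof -
    obtain x' where x': "x' \<in> U" "x = (1 - \<tau> j) *\<^sub>R y0 + \<tau> j *\<^sub>R x'" using xy(1) unfolding A_def by blast
    obtain y' where y': "y' \<in> ball y0 \<sigma>" "y = (1 - \<tau> j) *\<^sub>R y0 + \<tau> j *\<^sub>R y'" using preimage[OF xy(2)] by blast
    have "x + t *\<^sub>R (y - x) = (1 - \<tau> j) *\<^sub>R y0 + \<tau> j *\<^sub>R (x' + t *\<^sub>R (y' - x'))"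
      unfolding x'(2) y'(2) by (simp add: algebra_simps)
    then show ?thesis using star[OF x'(1) y'(1) xy(3)] unfolding A_def by blast
  qed
  have exh: "\<forall>\<^sub>F j in sequentially. x \<in> A j" if "x \<in> U" for x
  proof -
    have l1: "\<tau> \<longlonglongrightarrow> 1 - 0"
      unfolding \<tau>_def using LIMSEQ_ignore_initial_segment[OF lim_1_over_n, of 2]
      by (intro tendsto_intros) auto
    have "(\<lambda>j. y0 + (1 / \<tau> j) *\<^sub>R (x - y0)) \<longlonglongrightarrow> y0 + (1 / (1 - 0)) *\<^sub>R (x - y0)"
      by (intro tendsto_intros l1) auto
    then have "\<forall>\<^sub>F j in sequentially. y0 + (1 / \<tau> j) *\<^sub>R (x - y0) \<in> U"
      using that U(1) by (intro topological_tendstoD) auto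
    then show ?thesis
    proof eventually_elim
      case (elim j)
      have "x = (1 - \<tau> j) *\<^sub>R y0 + \<tau> j *\<^sub>R (y0 + (1 / \<tau> j) *\<^sub>R (x - y0))"
        using \<tau>(1)[of j] by (simp add: algebra_simps)
      then show ?case using elim unfolding A_def by blast
    qed
  qed
  obtain M where M: "\<And>x. x \<in> U \<Longrightarrow> norm x \<le> M" using U(2) unfolding bounded_iff by blast
  define R where "R = 2 * \<bar>M\<bar> + 1"
  have Ufin: "emeasure lborel U \<noteq> \<infinity>" using emeasure_bounded_finite[OF U(2)] by simp
  define V where "V = measure lborel U + 1"
  have V: "0 < V" unfolding V_def by (intro add_nonneg_pos) auto
  have UV: "emeasure lborel U \<le> ennreal V"
    using Ufin by (simp add: V_def emeasure_eq_ennreal_measure ennreal_leI)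
  define \<beta> where "\<beta> = measure lborel B"
  have \<beta>: "0 < \<beta>" unfolding \<beta>_def B_def using \<sigma> by (simp add: content_ball_pos)
  have AV: "emeasure lborel (A j) \<le> ennreal V" for j
    by (rule order_trans[OF emeasure_mono[OF AU] UV]) (use U in simp)
  have region: "star_region (A j) B n R V \<beta>" for j
  proof
    show "norm (y - x) \<le> R" if "x \<in> A j" "y \<in> B" for x y
    proof -
      have "norm x \<le> M" "norm y \<le> M" using that AU[of j] BA[of j] M by auto
      then show ?thesis using norm_triangle_ineq4[of y x] unfolding R_def by linarith
    qed
  qed (use Aopen BA starA V AV \<beta> n in \<open>auto simp: B_def R_def \<beta>_def\<close>)
  define C0 where "C0 = 2 * star_region.half_const TYPE('a) n R V \<beta>"
  have exponent: "star_region.exponent n = r"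
    using star_region.exponent_def[OF region] by (simp add: r_def)
  have C0: "0 \<le> C0" unfolding C0_def star_region.half_const_def[OF region] by simp
  \<comment> \<open>The summand \<open>1\<close> keeps the bound positive, as the choice of a base point requires.\<close>
  define C1 where "C1 = 2 powr r * (2 * V * C0) + 1"
  have C1: "0 < C1" using V C0 unfolding C1_def by (intro add_nonneg_pos mult_nonneg_nonneg) auto
  have main: "\<exists>c. (\<integral>\<^sup>+x. indicator U x * ennreal (\<bar>u x - c\<bar> powr r) \<partial>lborel) \<le> ennreal (2 * C1 / \<beta> * D powr r)"
    if G: "borel_gradient \<Omega> u G" and D: "0 < D"
      and energy: "(\<integral>\<^sup>+x. indicator \<Omega> x * (ennreal (norm (G x)))\<^sup>2 \<partial>lborel) \<le> ennreal (D\<^sup>2)" for u G D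
  proof -
    have u[measurable]: "u \<in> borel_measurable borel" using G by (simp add: borel_gradient_def)
    define P where "P = (\<lambda>j w c. w \<in> borel_measurable borel \<and>
      (\<integral>\<^sup>+x. indicator (A j) x * ennreal \<bar>w x - u x\<bar> \<partial>lborel) \<le> ennreal ((1/2)^j) \<and>
      (\<integral>\<^sup>+x. indicator (A j) x * ennreal (\<bar>w x - c\<bar> powr r) \<partial>lborel) \<le> ennreal (C0 * D powr r))"
    have "\<exists>w c. P j w c" for j
    proof -
      have bA: "bounded (A j)" using bounded_subset[OF U(2) AU] .
      have cA: "closure (A j) \<subseteq> \<Omega>" using clA U(3) by blast
      have pos: "0 < (1/2::real)^j" by simp
      obtain w F where w: "\<And>x. (w has_derivative (\<lambda>h. F x \<bullet> h)) (at x)" and F: "continuous_on UNIV F"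
        and L1: "(\<integral>\<^sup>+x. indicator (A j) x * ennreal \<bar>w x - u x\<bar> \<partial>lborel) \<le> ennreal ((1/2)^j)"
        and E: "(\<integral>\<^sup>+x. indicator (A j) x * (ennreal (norm (F x)))\<^sup>2 \<partial>lborel) \<le>
          (\<integral>\<^sup>+x. indicator \<Omega> x * (ennreal (norm (G x)))\<^sup>2 \<partial>lborel)"
        using smooth_approximation[OF G \<Omega> bA cA pos] by blast
      have wc: "continuous_on S w" for S
        using w by (intro continuous_at_imp_continuous_on) (auto intro: has_derivative_continuous)
      have smooth: "smooth_on_star (A j) B n R V \<beta> w F"
        by (intro smooth_on_star.intro region smooth_on_star_axioms.intro w continuous_on_subset[OF F]) auto
      have "compact (w ` closure (A j))" using bA by (intro compact_continuous_image wc) (simp add: compact_closure)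
      from compact_imp_bounded[OF this]
      obtain K where "\<forall>y\<in>w ` closure (A j). norm y \<le> K" unfolding bounded_iff by blast
      then have K: "\<bar>w x\<bar> \<le> K" if "x \<in> closure (A j)" for x using that by simp
      have KA: "\<bar>w x\<bar> \<le> K" if "x \<in> A j" for x using K that closure_subset by blast
      from smooth_on_star.poincare_sobolev_smooth[OF smooth KA D order_trans[OF E energy]]
      obtain c where "(\<integral>\<^sup>+x. indicator (A j) x * ennreal (\<bar>w x - c\<bar> powr r) \<partial>lborel) \<le> ennreal (C0 * D powr r)"
        unfolding exponent C0_def by blast
      then show ?thesis using L1 borel_measurable_continuous_onI[OF wc]
        unfolding P_def by (intro exI[of _ w] exI[of _ c] conjI)
    qed
    then obtain w c where "\<And>j. P j (w j) (c j)" by metis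
    then have w: "\<And>j. w j \<in> borel_measurable borel"
      "\<And>j. (\<integral>\<^sup>+x. indicator (A j) x * ennreal \<bar>w j x - u x\<bar> \<partial>lborel) \<le> ennreal ((1/2)^j)"
      "\<And>j. (\<integral>\<^sup>+x. indicator (A j) x * ennreal (\<bar>w j x - c j\<bar> powr r) \<partial>lborel) \<le> ennreal (C0 * D powr r)"
      unfolding P_def by blast+
    define H where "H = 2 powr r * (2 * V * (C0 * D powr r))"
    have Ab: "A j \<in> sets borel" for j using Aopen by simp
    have Ub: "U \<in> sets borel" using U(1) by simp
    have "(\<integral>\<^sup>+x. \<integral>\<^sup>+y. indicator (A j) x * indicator (A j) y * ennreal (\<bar>w j x - w j y\<bar> powr r) \<partial>lborel \<partial>lborel) \<le> ennreal H" for j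
      unfolding H_def using V C0 by (intro double_integral_difference_le[OF w(1) Ab r AV _ w(3)]) auto
    from double_integral_difference_limit[OF u Ub w(1) Ab exh w(2) this r]
    have dbl: "(\<integral>\<^sup>+x. \<integral>\<^sup>+y. indicator U x * indicator U y * ennreal (\<bar>u x - u y\<bar> powr r) \<partial>lborel \<partial>lborel) \<le> ennreal H" .
    note [measurable] = Ub
    define J where "J = (\<lambda>x. \<integral>\<^sup>+y. indicator U y * ennreal (\<bar>u y - u x\<bar> powr r) \<partial>lborel)"
    have "(\<integral>\<^sup>+x. indicator U x * J x \<partial>lborel) =
      (\<integral>\<^sup>+x. \<integral>\<^sup>+y. indicator U x * indicator U y * ennreal (\<bar>u x - u y\<bar> powr r) \<partial>lborel \<partial>lborel)"
      unfolding J_def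
    proof (rule nn_integral_cong)
      fix x
      have "indicator U x * (\<integral>\<^sup>+y. indicator U y * ennreal (\<bar>u y - u x\<bar> powr r) \<partial>lborel) =
        (\<integral>\<^sup>+y. indicator U x * (indicator U y * ennreal (\<bar>u y - u x\<bar> powr r)) \<partial>lborel)"
        by (rule nn_integral_cmult[symmetric]) measurable
      then show "indicator U x * (\<integral>\<^sup>+y. indicator U y * ennreal (\<bar>u y - u x\<bar> powr r) \<partial>lborel) =
        (\<integral>\<^sup>+y. indicator U x * indicator U y * ennreal (\<bar>u x - u y\<bar> powr r) \<partial>lborel)"
        by (simp only: mult.assoc abs_minus_commute)
    qed
    also note dbl
    also have "ennreal H \<le> ennreal (C1 * D powr r)"
      unfolding H_def C1_def using D by (intro ennreal_leI) (simp add: distrib_right)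
    finally have JH: "(\<integral>\<^sup>+x. indicator U x * J x \<partial>lborel) \<le> ennreal (C1 * D powr r)" .
    have "ennreal \<beta> \<le> emeasure lborel U"
    proof -
      have "measure lborel B \<le> measure lborel U"
        using \<sigma> U(1) Ufin by (intro measure_mono_fmeasurable fmeasurableI) (auto simp: B_def less_top[symmetric])
      then show ?thesis using Ufin by (simp add: \<beta>_def emeasure_eq_ennreal_measure ennreal_leI)
    qed
    moreover have "J \<in> borel_measurable borel" unfolding J_def by measurable
    moreover have "0 < C1 * D powr r" using C1 D by simp
    ultimately obtain y where "y \<in> U" "J y \<le> ennreal (2 * (C1 * D powr r) / \<beta>)"
      using exists_good_base_point[OF _ Ub _ \<beta> JH] by blast
    then show ?thesis unfolding J_def by (intro exI[of _ "u y"]) (simp add: mult.assoc)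
  qed
  show ?thesis unfolding poincare_on_def r_def[symmetric]
    using main C1 \<beta> by (intro exI[of _ "2 * C1 / \<beta>"]) auto
qed

section \<open>Gluing overlapping pieces\<close>

text \<open>
On the overlap, which has positive measure, \<open>u\<close> is close to both constants, so the two constants are
close to each other.
\<close>

lemma poincare_on_union:
  fixes \<Omega> U V :: "'a::euclidean_space set"
  assumes r: "0 < r" and U: "open U" "bounded U" and V: "open V" "bounded V" and UV: "U \<inter> V \<noteq> {}"
    and PU: "poincare_on \<Omega> r U" and PV: "poincare_on \<Omega> r V"
  shows "poincare_on \<Omega> r (U \<union> V)"
proof -
  obtain C1 where C1: "0 \<le> C1" and P1: "\<And>u G D. borel_gradient \<Omega> u G \<Longrightarrow> 0 < D \<Longrightarrow>
    (\<integral>\<^sup>+x. indicator \<Omega> x * (ennreal (norm (G x)))\<^sup>2 \<partial>lborel) \<le> ennreal (D\<^sup>2) \<Longrightarrow>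
    \<exists>c. (\<integral>\<^sup>+x. indicator U x * ennreal (\<bar>u x - c\<bar> powr r) \<partial>lborel) \<le> ennreal (C1 * D powr r)"
    using PU unfolding poincare_on_def by blast
  obtain C2 where C2: "0 \<le> C2" and P2: "\<And>u G D. borel_gradient \<Omega> u G \<Longrightarrow> 0 < D \<Longrightarrow>
    (\<integral>\<^sup>+x. indicator \<Omega> x * (ennreal (norm (G x)))\<^sup>2 \<partial>lborel) \<le> ennreal (D\<^sup>2) \<Longrightarrow>
    \<exists>c. (\<integral>\<^sup>+x. indicator V x * ennreal (\<bar>u x - c\<bar> powr r) \<partial>lborel) \<le> ennreal (C2 * D powr r)"
    using PV unfolding poincare_on_def by blast
  note [measurable] = borel_open[OF U(1)] borel_open[OF V(1)]
  have fin: "emeasure lborel V = ennreal (measure lborel V)" "emeasure lborel (U \<inter> V) = ennreal (measure lborel (U \<inter> V))"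
    using emeasure_bounded_finite[OF V(2)] emeasure_bounded_finite[OF bounded_subset[OF V(2), of "U \<inter> V"]]
    by (auto intro!: emeasure_eq_ennreal_measure)
  define m where "m = measure lborel (U \<inter> V)"
  have m: "0 < m"
  proof -
    obtain x e where "e > 0" "ball x e \<subseteq> U \<inter> V"
      using UV openE[OF open_Int[OF U(1) V(1)]] by (metis all_not_in_conv)
    then have "measure lborel (ball x e) \<le> m"
      unfolding m_def using fin(2) by (intro measure_mono_fmeasurable fmeasurableI) auto
    then show ?thesis using content_ball_pos[OF \<open>e > 0\<close>, of x] by linarith
  qed
  define v where "v = measure lborel V"
  define K where "K = 2 powr r * (C1 + C2) / m"
  define C where "C = C1 + 2 powr r * (C2 + v * K)"
  have K0: "0 \<le> K" and v0: "0 \<le> v" using C1 C2 m by (auto simp: K_def v_def)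
  have "\<exists>c. (\<integral>\<^sup>+x. indicator (U \<union> V) x * ennreal (\<bar>u x - c\<bar> powr r) \<partial>lborel) \<le> ennreal (C * D powr r)"
    if G: "borel_gradient \<Omega> u G" and D: "0 < D"
      and E: "(\<integral>\<^sup>+x. indicator \<Omega> x * (ennreal (norm (G x)))\<^sup>2 \<partial>lborel) \<le> ennreal (D\<^sup>2)" for u G D
  proof -
    have [measurable]: "u \<in> borel_measurable borel" using G by (simp add: borel_gradient_def)
    obtain c1 where c1: "(\<integral>\<^sup>+x. indicator U x * ennreal (\<bar>u x - c1\<bar> powr r) \<partial>lborel) \<le> ennreal (C1 * D powr r)"
      using P1[OF G D E] by blast
    obtain c2 where c2: "(\<integral>\<^sup>+x. indicator V x * ennreal (\<bar>u x - c2\<bar> powr r) \<partial>lborel) \<le> ennreal (C2 * D powr r)"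
      using P2[OF G D E] by blast
    define X where "X = D powr r"
    have X: "0 < X" using D by (simp add: X_def)
    have "\<bar>c1 - c2\<bar> powr r \<le> K * X"
    proof -
      have "ennreal (\<bar>c1 - c2\<bar> powr r * m) = (\<integral>\<^sup>+x. ennreal (\<bar>c1 - c2\<bar> powr r) * indicator (U \<inter> V) x \<partial>lborel)"
        using fin m by (simp add: nn_integral_cmult_indicator m_def ennreal_mult)
      also have "\<dots> \<le> (\<integral>\<^sup>+x. ennreal (2 powr r) * (indicator U x * ennreal (\<bar>u x - c1\<bar> powr r) + indicator V x * ennreal (\<bar>u x - c2\<bar> powr r)) \<partial>lborel)"
      proof (rule nn_integral_mono)
        fix x
        have "\<bar>c1 - c2\<bar> powr r \<le> 2 powr r * (\<bar>u x - c1\<bar> powr r + \<bar>u x - c2\<bar> powr r)"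
          using abs_powr_add_le[OF r, of "c1 - u x" "u x - c2"] by (simp add: abs_minus_commute)
        from ennreal_leI[OF this]
        show "ennreal (\<bar>c1 - c2\<bar> powr r) * indicator (U \<inter> V) x \<le> ennreal (2 powr r) *
          (indicator U x * ennreal (\<bar>u x - c1\<bar> powr r) + indicator V x * ennreal (\<bar>u x - c2\<bar> powr r))"
          by (simp add: ennreal_mult split: split_indicator)
      qed
      also have "\<dots> = ennreal (2 powr r) * (\<integral>\<^sup>+x. indicator U x * ennreal (\<bar>u x - c1\<bar> powr r) + indicator V x * ennreal (\<bar>u x - c2\<bar> powr r) \<partial>lborel)"
        by (rule nn_integral_cmult) measurable
      also have "(\<integral>\<^sup>+x. indicator U x * ennreal (\<bar>u x - c1\<bar> powr r) + indicator V x * ennreal (\<bar>u x - c2\<bar> powr r) \<partial>lborel) =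
        (\<integral>\<^sup>+x. indicator U x * ennreal (\<bar>u x - c1\<bar> powr r) \<partial>lborel) + (\<integral>\<^sup>+x. indicator V x * ennreal (\<bar>u x - c2\<bar> powr r) \<partial>lborel)"
        by (rule nn_integral_add) measurable
      also have "ennreal (2 powr r) * \<dots> \<le> ennreal (2 powr r) * (ennreal (C1 * X) + ennreal (C2 * X))"
        unfolding X_def by (intro mult_left_mono add_mono c1 c2) auto
      also have "\<dots> = ennreal (2 powr r * (C1 * X + C2 * X))"
        using C1 C2 X by (simp add: ennreal_mult)
      finally have "\<bar>c1 - c2\<bar> powr r * m \<le> 2 powr r * (C1 * X + C2 * X)"
        using C1 C2 X by (subst (asm) ennreal_le_iff) auto
      also have "\<dots> = K * X * m" using m by (simp add: K_def distrib_right)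
      finally show ?thesis using m by simp
    qed
    note cc = this
    have "(\<integral>\<^sup>+x. indicator (U \<union> V) x * ennreal (\<bar>u x - c1\<bar> powr r) \<partial>lborel) \<le>
      (\<integral>\<^sup>+x. indicator U x * ennreal (\<bar>u x - c1\<bar> powr r) + (ennreal (2 powr r) *
        (indicator V x * ennreal (\<bar>u x - c2\<bar> powr r) + ennreal (K * X) * indicator V x)) \<partial>lborel)"
    proof (rule nn_integral_mono)
      fix x
      have "\<bar>u x - c1\<bar> powr r \<le> 2 powr r * (\<bar>u x - c2\<bar> powr r + \<bar>c1 - c2\<bar> powr r)"
        using abs_powr_add_le[OF r, of "u x - c2" "c2 - c1"] by (simp add: abs_minus_commute)
      also have "\<dots> \<le> 2 powr r * (\<bar>u x - c2\<bar> powr r + K * X)"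
        using cc by (intro mult_left_mono add_left_mono) auto
      finally have "ennreal (\<bar>u x - c1\<bar> powr r) \<le> ennreal (2 powr r) * (ennreal (\<bar>u x - c2\<bar> powr r) + ennreal (K * X))"
        using K0 X by (simp add: ennreal_mult[symmetric] ennreal_plus[symmetric] ennreal_leI del: ennreal_plus)
      then show "indicator (U \<union> V) x * ennreal (\<bar>u x - c1\<bar> powr r) \<le> indicator U x * ennreal (\<bar>u x - c1\<bar> powr r) +
        (ennreal (2 powr r) * (indicator V x * ennreal (\<bar>u x - c2\<bar> powr r) + ennreal (K * X) * indicator V x))"
        by (auto split: split_indicator intro: add_increasing)
    qed
    also have "\<dots> = (\<integral>\<^sup>+x. indicator U x * ennreal (\<bar>u x - c1\<bar> powr r) \<partial>lborel) +
      (\<integral>\<^sup>+x. ennreal (2 powr r) * (indicator V x * ennreal (\<bar>u x - c2\<bar> powr r) + ennreal (K * X) * indicator V x) \<partial>lborel)"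
      by (rule nn_integral_add) measurable
    also have "(\<integral>\<^sup>+x. ennreal (2 powr r) * (indicator V x * ennreal (\<bar>u x - c2\<bar> powr r) + ennreal (K * X) * indicator V x) \<partial>lborel) =
      ennreal (2 powr r) * (\<integral>\<^sup>+x. indicator V x * ennreal (\<bar>u x - c2\<bar> powr r) + ennreal (K * X) * indicator V x \<partial>lborel)"
      by (rule nn_integral_cmult) measurable
    also have "(\<integral>\<^sup>+x. indicator V x * ennreal (\<bar>u x - c2\<bar> powr r) + ennreal (K * X) * indicator V x \<partial>lborel) =
      (\<integral>\<^sup>+x. indicator V x * ennreal (\<bar>u x - c2\<bar> powr r) \<partial>lborel) + (\<integral>\<^sup>+x. ennreal (K * X) * indicator V x \<partial>lborel)"
      by (rule nn_integral_add) measurable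
    also have "(\<integral>\<^sup>+x. ennreal (K * X) * indicator V x \<partial>lborel) = ennreal (K * X) * ennreal v"
      using fin by (simp add: nn_integral_cmult_indicator v_def)
    also have "(\<integral>\<^sup>+x. indicator U x * ennreal (\<bar>u x - c1\<bar> powr r) \<partial>lborel) +
      ennreal (2 powr r) * ((\<integral>\<^sup>+x. indicator V x * ennreal (\<bar>u x - c2\<bar> powr r) \<partial>lborel) + ennreal (K * X) * ennreal v) \<le>
      ennreal (C1 * X) + ennreal (2 powr r) * (ennreal (C2 * X) + ennreal (K * X) * ennreal v)"
      unfolding X_def by (intro add_mono mult_left_mono c1 c2) auto
    also have "\<dots> = ennreal (C1 * X + 2 powr r * (C2 * X + K * X * v))"
      using C1 C2 X K0 v0 by (simp add: ennreal_mult)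
    also have "C1 * X + 2 powr r * (C2 * X + K * X * v) = C * D powr r"
      by (simp add: C_def X_def algebra_simps)
    finally show ?thesis by blast
  qed
  moreover have "0 \<le> C" using C1 C2 K0 v0 by (simp add: C_def)
  ultimately show ?thesis unfolding poincare_on_def by blast
qed

text \<open>
A maximal subfamily whose union has the property must be everything: otherwise connectedness provides
a further member that overlaps the union.
\<close>

lemma poincare_on_connected_union:
  fixes \<Omega> :: "'a::euclidean_space set" and F :: "'a set set"
  assumes r: "0 < r" and F: "finite F" "F \<noteq> {}" and conn: "connected (\<Union>F)"
    and sets: "\<And>U. U \<in> F \<Longrightarrow> open U \<and> bounded U \<and> U \<noteq> {} \<and> poincare_on \<Omega> r U"
  shows "poincare_on \<Omega> r (\<Union>F)"
proof -
  define good where "good = {F'. F' \<subseteq> F \<and> F' \<noteq> {} \<and> poincare_on \<Omega> r (\<Union>F')}"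
  obtain U0 where "U0 \<in> F" using F by blast
  then have "{U0} \<in> good" using sets by (simp add: good_def)
  moreover have "finite good" using F(1) by (auto simp: good_def intro: finite_subset[of _ "Pow F"])
  ultimately obtain F' where F': "F' \<in> good" and maximal: "\<And>H. H \<in> good \<Longrightarrow> F' \<subseteq> H \<Longrightarrow> F' = H"
    using finite_has_maximal[of good] by blast
  have sub: "F' \<subseteq> F" and ne: "F' \<noteq> {}" and P: "poincare_on \<Omega> r (\<Union>F')" using F' by (auto simp: good_def)
  have "F' = F"
  proof (rule ccontr)
    assume "F' \<noteq> F"
    then obtain W where W: "W \<in> F - F'" using sub by blast
    have o1: "open (\<Union>F')" and o2: "open (\<Union>(F - F'))" using sets sub by (auto intro!: open_Union)
    have "\<Union>F' \<inter> \<Union>(F - F') \<noteq> {}"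
    proof
      assume "\<Union>F' \<inter> \<Union>(F - F') = {}"
      moreover have "\<Union>F \<subseteq> \<Union>F' \<union> \<Union>(F - F')" by blast
      moreover have "\<Union>F' \<inter> \<Union>F \<noteq> {}" "\<Union>(F - F') \<inter> \<Union>F \<noteq> {}" using W sets ne sub by blast+
      ultimately show False using connectedD[OF conn o1 o2] by blast
    qed
    then obtain V where V: "V \<in> F - F'" "\<Union>F' \<inter> V \<noteq> {}" by blast
    have "finite F'" using sub F(1) by (rule finite_subset)
    then have "bounded (\<Union>F')" using sets sub by (intro bounded_Union) auto
    then have "poincare_on \<Omega> r (\<Union>F' \<union> V)"
      using V sets[of V] by (intro poincare_on_union[OF r o1 _ _ _ V(2) P]) auto
    moreover have "\<Union>(insert V F') = \<Union>F' \<union> V" by blast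
    ultimately have "insert V F' \<in> good" using sub V by (simp add: good_def)
    then have "F' = insert V F'" by (rule maximal) blast
    then show False using V by blast
  qed
  then show ?thesis using P by simp
qed

section \<open>Star-shaped pieces of a Lipschitz domain\<close>

text \<open>
The orthogonal projection along the vertical direction \<open>v\<close>.
\<close>

definition horizontal :: "'a::euclidean_space \<Rightarrow> 'a \<Rightarrow> 'a" where
  "horizontal v y = y - (y \<bullet> v) *\<^sub>R v"

lemma horizontal_add: "horizontal v (x + y) = horizontal v x + horizontal v y"
  by (simp add: horizontal_def inner_add_left scaleR_add_left)

lemma horizontal_diff: "horizontal v (x - y) = horizontal v x - horizontal v y"
  by (simp add: horizontal_def inner_diff_left scaleR_diff_left)

lemma horizontal_scaleR: "horizontal v (c *\<^sub>R x) = c *\<^sub>R horizontal v x"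
  by (simp add: horizontal_def scaleR_diff_right)

lemma horizontal_self: "norm v = 1 \<Longrightarrow> horizontal v v = 0"
  by (simp add: horizontal_def dot_square_norm)

lemma horizontal_inner: "norm v = 1 \<Longrightarrow> horizontal v y \<bullet> v = 0"
  by (simp add: horizontal_def inner_diff_left dot_square_norm)

lemma norm_horizontal_le: "norm v = 1 \<Longrightarrow> norm (horizontal v y) \<le> norm y"
proof -
  assume v: "norm v = 1"
  have "v \<bullet> v = 1" using v by (simp add: dot_square_norm)
  then have "horizontal v y \<bullet> horizontal v y = y \<bullet> y - (y \<bullet> v)\<^sup>2"
    by (simp add: horizontal_def inner_diff_left inner_diff_right inner_commute[of v y] power2_eq_square)
  then have "(norm (horizontal v y))\<^sup>2 \<le> (norm y)\<^sup>2" by (simp add: dot_square_norm)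
  then show ?thesis by (rule power2_le_imp_le) simp
qed

lemma norm_le_horizontal_vertical: "norm v = 1 \<Longrightarrow> norm y \<le> norm (horizontal v y) + \<bar>y \<bullet> v\<bar>"
  using norm_triangle_ineq[of "horizontal v y" "(y \<bullet> v) *\<^sub>R v"] by (simp add: horizontal_def)

lemma continuous_on_horizontal [continuous_intros]:
  "continuous_on S f \<Longrightarrow> continuous_on S (\<lambda>x. horizontal v (f x))"
  unfolding horizontal_def by (intro continuous_intros)

text \<open>
The piece is the part of a thin vertical cylinder around \<open>p\<close> that lies above the graph of \<open>\<gamma>\<close> and below a
flat top. The ball sits so high above the graph that the direction from any low point \<open>x\<close> of the piece
to a point of the ball is steeper than the Lipschitz constant, hence the segment stays above the graph;
if \<open>x\<close> is high itself, the whole segment lies above the highest point of the graph in the cylinder.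
\<close>

lemma boundary_point_star_piece:
  fixes \<Omega> :: "'a::euclidean_space set" and \<gamma> :: "'a \<Rightarrow> real"
  assumes \<Omega>: "open \<Omega>" and p: "p \<in> frontier \<Omega>" and rad: "0 < rad" and v: "norm v = 1"
    and lip: "L-lipschitz_on {z. z \<bullet> v = 0} \<gamma>"
    and graph: "\<Omega> \<inter> ball p rad = {y \<in> ball p rad. \<gamma> (horizontal v y) < y \<bullet> v}"
  shows "\<exists>\<rho>>0. \<exists>U y0 \<sigma>. open U \<and> bounded U \<and> U \<subseteq> \<Omega> \<and> \<Omega> \<inter> ball p \<rho> \<subseteq> U \<and> 0 < \<sigma> \<and> ball y0 \<sigma> \<subseteq> U \<and>
    (\<forall>x\<in>U. \<forall>y\<in>ball y0 \<sigma>. \<forall>t\<in>{0..1}. x + t *\<^sub>R (y - x) \<in> U)"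
proof -
  let ?\<pi> = "horizontal v"
  have L: "0 \<le> L" using lip by (simp add: lipschitz_on_def)
  have \<gamma>: "\<bar>\<gamma> (?\<pi> y) - \<gamma> (?\<pi> z)\<bar> \<le> L * norm (?\<pi> (y - z))" for y z
    using lipschitz_onD[OF lip, of "?\<pi> y" "?\<pi> z"] v by (simp add: horizontal_inner dist_norm horizontal_diff)
  have vert: "\<bar>y \<bullet> v\<bar> \<le> norm y" for y using Cauchy_Schwarz_ineq2[of y v] v by simp
  have pv: "p \<bullet> v = \<gamma> (?\<pi> p)"
  proof (rule antisym)
    have "p \<notin> \<Omega>" using p \<Omega> by (simp add: frontier_def interior_open)
    then have "p \<notin> {y \<in> ball p rad. \<gamma> (?\<pi> y) < y \<bullet> v}" using graph by blast
    then show "p \<bullet> v \<le> \<gamma> (?\<pi> p)" using rad by (simp add: not_less)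
    show "\<gamma> (?\<pi> p) \<le> p \<bullet> v"
    proof (rule field_le_epsilon)
      fix e :: real assume e: "0 < e"
      define d where "d = min rad (e / (L + 1))"
      have d: "0 < d" "d \<le> rad" "d \<le> e / (L + 1)" using rad e L by (auto simp: d_def)
      have "p \<in> closure \<Omega>" using p by (simp add: frontier_def)
      then obtain y where y: "y \<in> \<Omega>" "dist y p < d" using d(1) unfolding closure_approachable by blast
      then have "y \<in> \<Omega> \<inter> ball p rad" using d(2) by (simp add: dist_commute)
      then have "\<gamma> (?\<pi> y) < y \<bullet> v" using graph by blast
      moreover have "\<bar>\<gamma> (?\<pi> y) - \<gamma> (?\<pi> p)\<bar> \<le> L * d"
      proof -
        have "norm (?\<pi> (y - p)) \<le> d" using norm_horizontal_le[OF v, of "y - p"] y(2) by (simp add: dist_norm)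
        then have "L * norm (?\<pi> (y - p)) \<le> L * d" using L by (rule mult_left_mono)
        then show ?thesis using \<gamma>[of y p] by linarith
      qed
      moreover have "\<bar>(y - p) \<bullet> v\<bar> \<le> d" using vert[of "y - p"] y(2) by (simp add: dist_norm)
      then have "\<bar>y \<bullet> v - p \<bullet> v\<bar> \<le> d" by (simp add: inner_diff_left)
      moreover have "L * d + d \<le> e" using d(3) L by (simp add: field_simps)
      ultimately show "\<gamma> (?\<pi> p) \<le> p \<bullet> v + e" by linarith
    qed
  qed
  \<comment> \<open>The radius is such that the cylinder of radius \<open>\<rho>\<close>, with top at height \<open>H\<close> and graph within \<open>L \<rho>\<close> of \<open>p\<close>, fits into the ball of radius \<open>rad\<close>.\<close>
  define \<rho> where "\<rho> = rad / (3 * L + 4)"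
  have "0 < 3 * L + 4" using L by simp
  then have \<rho>: "0 < \<rho>" "(3 * L + 4) * \<rho> = rad" using rad by (simp_all add: \<rho>_def)
  have L\<rho>: "0 \<le> L * \<rho>" using L \<rho> by simp
  have rad_eq: "rad = 3 * (L * \<rho>) + 4 * \<rho>" using \<rho>(2) by (simp add: algebra_simps)
  define H where "H = 3 * (L * \<rho>) + 3 * \<rho>"
  define y0 where "y0 = p + (3 * (L * \<rho>) + 2 * \<rho>) *\<^sub>R v"
  define U where "U = {y. norm (?\<pi> (y - p)) < \<rho> \<and> \<gamma> (?\<pi> y) < y \<bullet> v \<and> y \<bullet> v < p \<bullet> v + H}"
  have near: "\<bar>\<gamma> (?\<pi> y) - p \<bullet> v\<bar> \<le> L * \<rho>" if "norm (?\<pi> (y - p)) < \<rho>" for y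
    using \<gamma>[of y p] pv mult_left_mono[of "norm (?\<pi> (y - p))" \<rho> L] that L by linarith
  have Uball: "U \<subseteq> ball p rad"
  proof
    fix y assume "y \<in> U"
    then have y: "norm (?\<pi> (y - p)) < \<rho>" "\<gamma> (?\<pi> y) < y \<bullet> v" "y \<bullet> v < p \<bullet> v + H" by (auto simp: U_def)
    have "\<bar>(y - p) \<bullet> v\<bar> \<le> H" using near[OF y(1)] y(2,3) \<rho>(1) L\<rho>
      unfolding inner_diff_left H_def by linarith
    then have "norm (y - p) < rad" using norm_le_horizontal_vertical[OF v, of "y - p"] y(1) rad_eq
      unfolding H_def by linarith
    then show "y \<in> ball p rad" by (simp add: dist_norm norm_minus_commute)
  qed
  have U\<Omega>: "U \<subseteq> \<Omega>"
  proof
    fix y assume "y \<in> U"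
    then have "y \<in> {y \<in> ball p rad. \<gamma> (?\<pi> y) < y \<bullet> v}" using Uball by (auto simp: U_def)
    then show "y \<in> \<Omega>" unfolding graph[symmetric] by simp
  qed
  have cover: "\<Omega> \<inter> ball p \<rho> \<subseteq> U"
  proof
    fix y assume y: "y \<in> \<Omega> \<inter> ball p \<rho>"
    have "\<rho> \<le> rad" using rad_eq \<rho>(1) L\<rho> by linarith
    then have "y \<in> \<Omega> \<inter> ball p rad" using y by simp
    then have "\<gamma> (?\<pi> y) < y \<bullet> v" unfolding graph by simp
    moreover have n: "norm (y - p) < \<rho>" using y by (simp add: dist_norm norm_minus_commute)
    then have "norm (?\<pi> (y - p)) < \<rho>" using norm_horizontal_le[OF v, of "y - p"] by linarith
    moreover have "y \<bullet> v < p \<bullet> v + H" using vert[of "y - p"] n \<rho>(1) L\<rho> unfolding H_def inner_diff_left by linarith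
    ultimately show "y \<in> U" by (simp add: U_def)
  qed
  have inball: "norm (?\<pi> (y - p)) < \<rho> \<and> p \<bullet> v + 3 * (L * \<rho>) + \<rho> < y \<bullet> v \<and> y \<bullet> v < p \<bullet> v + H" if "y \<in> ball y0 \<rho>" for y
  proof -
    have n: "norm (y - y0) < \<rho>" using that by (simp add: dist_norm norm_minus_commute)
    have "y - p = (y - y0) + (3 * (L * \<rho>) + 2 * \<rho>) *\<^sub>R v" by (simp add: y0_def)
    then have "?\<pi> (y - p) = ?\<pi> (y - y0)"
      by (simp only: horizontal_add horizontal_scaleR horizontal_self[OF v] scaleR_zero_right add_0_right)
    moreover have "y \<bullet> v = p \<bullet> v + (3 * (L * \<rho>) + 2 * \<rho>) + (y - y0) \<bullet> v"
      using v by (simp add: y0_def inner_diff_left inner_add_left dot_square_norm)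
    moreover have "\<bar>(y - y0) \<bullet> v\<bar> < \<rho>" using n vert[of "y - y0"] by linarith
    moreover have "norm (?\<pi> (y - y0)) < \<rho>" using n norm_horizontal_le[OF v, of "y - y0"] by linarith
    ultimately show ?thesis unfolding H_def by auto
  qed
  have ballU: "ball y0 \<rho> \<subseteq> U"
  proof
    fix y assume y: "y \<in> ball y0 \<rho>"
    then show "y \<in> U" using inball[OF y] near[of y] \<rho>(1) L\<rho> unfolding U_def by auto
  qed
  have star: "x + t *\<^sub>R (y - x) \<in> U" if x: "x \<in> U" and y: "y \<in> ball y0 \<rho>" and t: "t \<in> {0..1}" for x y t
  proof -
    let ?z = "x + t *\<^sub>R (y - x)"
    have xU: "norm (?\<pi> (x - p)) < \<rho>" "\<gamma> (?\<pi> x) < x \<bullet> v" "x \<bullet> v < p \<bullet> v + H" using x by (auto simp: U_def)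
    have yU: "norm (?\<pi> (y - p)) < \<rho>" "p \<bullet> v + 3 * (L * \<rho>) + \<rho> < y \<bullet> v" "y \<bullet> v < p \<bullet> v + H"
      using inball[OF y] by auto
    have t01: "0 \<le> t" "0 \<le> 1 - t" "(1 - t) + t = 1" using t by auto
    have "?\<pi> (?z - p) = (1 - t) *\<^sub>R ?\<pi> (x - p) + t *\<^sub>R ?\<pi> (y - p)"
      unfolding horizontal_scaleR[symmetric] horizontal_add[symmetric] by (simp add: algebra_simps)
    then have "norm (?\<pi> (?z - p)) \<le> (1 - t) * norm (?\<pi> (x - p)) + t * norm (?\<pi> (y - p))"
      using norm_triangle_ineq[of "(1 - t) *\<^sub>R ?\<pi> (x - p)" "t *\<^sub>R ?\<pi> (y - p)"] t01 by simp
    also have "\<dots> < \<rho>" using xU(1) yU t01 by (intro convex_bound_lt) auto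
    finally have hz: "norm (?\<pi> (?z - p)) < \<rho>" .
    have zv: "?z \<bullet> v = (1 - t) * (x \<bullet> v) + t * (y \<bullet> v)" by (simp add: inner_add_left inner_diff_left algebra_simps)
    have "(1 - t) * (x \<bullet> v) + t * (y \<bullet> v) < p \<bullet> v + H" using xU(3) yU t01 by (intro convex_bound_lt) auto
    then have top: "?z \<bullet> v < p \<bullet> v + H" unfolding zv .
    have "\<gamma> (?\<pi> ?z) < ?z \<bullet> v"
    proof (cases "2 * (L * \<rho>) \<le> y \<bullet> v - x \<bullet> v")
      case True
      have "norm (?\<pi> (y - x)) \<le> 2 * \<rho>"
      proof -
        have "?\<pi> (y - x) = ?\<pi> (y - p) - ?\<pi> (x - p)" by (simp add: horizontal_diff)
        then have "norm (?\<pi> (y - x)) \<le> norm (?\<pi> (y - p)) + norm (?\<pi> (x - p))"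
          using norm_triangle_ineq4[of "?\<pi> (y - p)" "?\<pi> (x - p)"] by simp
        then show ?thesis using xU(1) yU(1) by linarith
      qed
      have "\<gamma> (?\<pi> ?z) - \<gamma> (?\<pi> x) \<le> L * norm (?\<pi> (?z - x))" using \<gamma>[of ?z x] by linarith
      also have "norm (?\<pi> (?z - x)) = t * norm (?\<pi> (y - x))" using t01 by (simp add: horizontal_scaleR)
      also have "L * (t * norm (?\<pi> (y - x))) \<le> L * (t * (2 * \<rho>))"
        using \<open>norm (?\<pi> (y - x)) \<le> 2 * \<rho>\<close> t01 L by (intro mult_left_mono) auto
      also have "\<dots> = t * (2 * (L * \<rho>))" by simp
      also have "\<dots> \<le> t * (y \<bullet> v - x \<bullet> v)" using True t01 by (intro mult_left_mono) auto
      finally have "\<gamma> (?\<pi> ?z) - \<gamma> (?\<pi> x) \<le> t * (y \<bullet> v - x \<bullet> v)" .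
      moreover have "?z \<bullet> v = x \<bullet> v + t * (y \<bullet> v - x \<bullet> v)" unfolding zv by (simp add: algebra_simps)
      ultimately show ?thesis using xU(2) by linarith
    next
      case False
      have "p \<bullet> v + L * \<rho> < x \<bullet> v" "p \<bullet> v + L * \<rho> < y \<bullet> v" using False yU L\<rho> \<rho>(1) by linarith+
      then have "- (?z \<bullet> v) < - (p \<bullet> v + L * \<rho>)"
        unfolding zv using t01 convex_bound_lt[of "- (x \<bullet> v)" "- (p \<bullet> v + L * \<rho>)" "- (y \<bullet> v)" "1 - t" t] by simp
      then show ?thesis using near[OF hz] by linarith
    qed
    then show ?thesis using hz top by (simp add: U_def)
  qed
  have cont: "continuous_on UNIV (\<lambda>y. \<gamma> (?\<pi> y))"
    by (rule continuous_on_compose2[OF lipschitz_on_continuous_on[OF lip]])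
      (use v in \<open>auto intro!: continuous_intros simp: horizontal_inner\<close>)
  have "open U" unfolding U_def
    by (intro open_Collect_conj open_Collect_less continuous_intros cont)
  moreover have "bounded U" using Uball bounded_ball bounded_subset by blast
  ultimately show ?thesis using \<rho>(1) U\<Omega> cover ballU star
    by (intro exI[of _ \<rho>] conjI exI[of _ U] exI[of _ y0] ballI)
qed

lemma lipschitz_domain_star_piece:
  fixes \<Omega> :: "'a::euclidean_space set"
  assumes \<Omega>: "bounded_lipschitz_domain \<Omega>" and p: "p \<in> closure \<Omega>"
  shows "\<exists>\<rho>>0. \<exists>U y0 \<sigma>. open U \<and> bounded U \<and> U \<subseteq> \<Omega> \<and> \<Omega> \<inter> ball p \<rho> \<subseteq> U \<and> 0 < \<sigma> \<and> ball y0 \<sigma> \<subseteq> U \<and>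
    (\<forall>x\<in>U. \<forall>y\<in>ball y0 \<sigma>. \<forall>t\<in>{0..1}. x + t *\<^sub>R (y - x) \<in> U)"
proof (cases "p \<in> \<Omega>")
  case True
  then obtain e where e: "0 < e" "ball p e \<subseteq> \<Omega>"
    using \<Omega> openE unfolding bounded_lipschitz_domain_def by blast
  have "x + t *\<^sub>R (y - x) \<in> ball p e" if "x \<in> ball p e" "y \<in> ball p e" "t \<in> {0..1}" for x y t
  proof -
    have "(1 - t) *\<^sub>R x + t *\<^sub>R y \<in> ball p e"
      using that by (intro convexD[OF convex_ball]) auto
    then show ?thesis by (simp add: algebra_simps)
  qed
  then show ?thesis using e
    by (intro exI[of _ e] conjI exI[of _ "ball p e"] exI[of _ p]) auto
next
  case False
  have op: "open \<Omega>" using \<Omega> by (simp add: bounded_lipschitz_domain_def)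
  have pf: "p \<in> frontier \<Omega>" using False p op by (simp add: frontier_def interior_open)
  then obtain rad v \<gamma> L where *: "0 < rad" "norm v = 1" "L-lipschitz_on {z. z \<bullet> v = 0} \<gamma>"
    "\<Omega> \<inter> ball p rad = {y \<in> ball p rad. \<gamma> (y - (y \<bullet> v) *\<^sub>R v) < y \<bullet> v}"
    using \<Omega> unfolding bounded_lipschitz_domain_def lipschitz_boundary_def by blast
  show ?thesis by (rule boundary_point_star_piece[OF op pf *(1-3)]) (use *(4) in \<open>simp add: horizontal_def\<close>)
qed

lemma poincare_on_lipschitz_domain:
  fixes \<Omega> :: "'a::euclidean_space set"
  assumes \<Omega>: "bounded_lipschitz_domain \<Omega>" and n: "real DIM('a) \<le> n" "2 < n"
  shows "poincare_on \<Omega> (2 * n / (n - 2)) \<Omega>"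
proof -
  have op: "open \<Omega>" and conn: "connected \<Omega>" and ne: "\<Omega> \<noteq> {}" and bd: "bounded \<Omega>"
    using \<Omega> by (auto simp: bounded_lipschitz_domain_def)
  define piece where "piece = (\<lambda>p \<rho> U. open U \<and> bounded U \<and> U \<subseteq> \<Omega> \<and> \<Omega> \<inter> ball p \<rho> \<subseteq> U \<and> U \<noteq> {} \<and>
    poincare_on \<Omega> (2 * n / (n - 2)) U)"
  have "\<exists>\<rho> U. 0 < \<rho> \<and> piece p \<rho> U" if p: "p \<in> closure \<Omega>" for p
  proof -
    obtain \<rho> U y0 \<sigma> where *: "0 < \<rho>" "open U" "bounded U" "U \<subseteq> \<Omega>" "\<Omega> \<inter> ball p \<rho> \<subseteq> U" "0 < \<sigma>" "ball y0 \<sigma> \<subseteq> U"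
      and star: "\<forall>x\<in>U. \<forall>y\<in>ball y0 \<sigma>. \<forall>t\<in>{0..1}. x + t *\<^sub>R (y - x) \<in> U"
      using lipschitz_domain_star_piece[OF \<Omega> p] by (elim exE conjE)
    have "poincare_on \<Omega> (2 * n / (n - 2)) U"
      by (rule poincare_on_star_shaped[OF n op *(2-4,6,7) star[rule_format]])
    moreover have "y0 \<in> U" using *(6,7) by auto
    then have "U \<noteq> {}" by blast
    ultimately show ?thesis using *(1-5) unfolding piece_def by (intro exI[of _ \<rho>] exI[of _ U] conjI)
  qed
  then have "\<forall>p\<in>closure \<Omega>. \<exists>z. 0 < fst z \<and> piece p (fst z) (snd z)" by simp
  then obtain z where z: "\<forall>p\<in>closure \<Omega>. 0 < fst (z p) \<and> piece p (fst (z p)) (snd (z p))"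
    using bchoice[of "closure \<Omega>" "\<lambda>p z. 0 < fst z \<and> piece p (fst z) (snd z)"] by blast
  define \<rho> where "\<rho> = (\<lambda>p. fst (z p))"
  define U where "U = (\<lambda>p. snd (z p))"
  have pc: "0 < \<rho> p" "piece p (\<rho> p) (U p)" if "p \<in> closure \<Omega>" for p
    using z that by (auto simp: \<rho>_def U_def)
  have "compact (closure \<Omega>)" using bd by (simp add: compact_closure)
  moreover have "open (ball p (\<rho> p))" for p by simp
  moreover have "closure \<Omega> \<subseteq> (\<Union>p\<in>closure \<Omega>. ball p (\<rho> p))"
  proof
    fix p assume "p \<in> closure \<Omega>"
    then show "p \<in> (\<Union>p\<in>closure \<Omega>. ball p (\<rho> p))" using pc(1)[of p] by (intro UN_I[of p]) auto
  qed
  ultimately obtain P where P: "P \<subseteq> closure \<Omega>" "finite P" "closure \<Omega> \<subseteq> (\<Union>p\<in>P. ball p (\<rho> p))"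
    using compactE_image[of "closure \<Omega>" "closure \<Omega>" "\<lambda>p. ball p (\<rho> p)"] by metis
  have eq: "\<Union>(U ` P) = \<Omega>"
  proof
    show "\<Union>(U ` P) \<subseteq> \<Omega>"
    proof (rule UN_least)
      fix p assume "p \<in> P"
      then show "U p \<subseteq> \<Omega>" using pc(2)[of p] P(1) unfolding piece_def by fast
    qed
    show "\<Omega> \<subseteq> \<Union>(U ` P)"
    proof
      fix x assume x: "x \<in> \<Omega>"
      then obtain p where p: "p \<in> P" "x \<in> ball p (\<rho> p)" using P(3) closure_subset[of \<Omega>] by fast
      then have "\<Omega> \<inter> ball p (\<rho> p) \<subseteq> U p" using pc(2)[of p] P(1) unfolding piece_def by fast
      then show "x \<in> \<Union>(U ` P)" using x p by blast
    qed
  qed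
  have "poincare_on \<Omega> (2 * n / (n - 2)) (\<Union>(U ` P))"
  proof (rule poincare_on_connected_union)
    show "0 < 2 * n / (n - 2)" using n by simp
    show "finite (U ` P)" using P by simp
    show "U ` P \<noteq> {}" using eq ne by auto
    show "connected (\<Union>(U ` P))" using eq conn by simp
    show "open W \<and> bounded W \<and> W \<noteq> {} \<and> poincare_on \<Omega> (2 * n / (n - 2)) W" if W: "W \<in> U ` P" for W
    proof -
      obtain p where "p \<in> P" "W = U p" using W by blast
      then show ?thesis using pc(2)[of p] P(1) unfolding piece_def by fast
    qed
  qed
  then show ?thesis unfolding eq .
qed

section \<open>Borel representatives\<close>

text \<open>
A function that is Lebesgue measurable on \<open>\<Omega>\<close>, extended by zero, agrees almost everywhere with a Borel
function. Such representatives connect \<open>weak_gradient\<close> with \<open>borel_gradient\<close>.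
\<close>

lemma lebesgue_on_borel_representative:
  fixes f :: "'a::euclidean_space \<Rightarrow> real"
  assumes \<Omega>: "\<Omega> \<in> sets lebesgue" and f: "f \<in> borel_measurable (lebesgue_on \<Omega>)"
  shows "\<exists>f'\<in>borel_measurable borel. AE x in lebesgue. indicator \<Omega> x * f x = f' x"
proof -
  have "(\<lambda>x. indicator \<Omega> x *\<^sub>R f x) \<in> borel_measurable lebesgue"
    using f \<Omega> by (subst (asm) borel_measurable_restrict_space_iff) auto
  then have "(\<lambda>x. indicator \<Omega> x * f x) \<in> borel_measurable (completion lborel)" by simp
  from completion_ex_borel_measurable_real[OF this]
  obtain f' where "f' \<in> borel_measurable lborel" "AE x in lborel. indicator \<Omega> x * f x = f' x" by blast
  then show ?thesis by (intro bexI[of _ f'] AE_completion) auto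
qed

lemma lebesgue_on_borel_representative_vector:
  fixes G :: "'a::euclidean_space \<Rightarrow> 'a"
  assumes \<Omega>: "\<Omega> \<in> sets lebesgue" and G: "G \<in> borel_measurable (lebesgue_on \<Omega>)"
  shows "\<exists>G'\<in>borel_measurable borel. AE x in lebesgue. indicator \<Omega> x *\<^sub>R G x = G' x"
proof -
  define P where "P = (\<lambda>b f. f \<in> borel_measurable borel \<and> (AE x in lebesgue. indicator \<Omega> x * (G x \<bullet> b) = f x))"
  have "\<exists>f. P b f" for b
    using lebesgue_on_borel_representative[OF \<Omega>, of "\<lambda>x. G x \<bullet> b"] G unfolding P_def by auto
  then obtain f where "\<And>b. P b (f b)" by metis
  then have f: "\<And>b. f b \<in> borel_measurable borel" "\<And>b. AE x in lebesgue. indicator \<Omega> x * (G x \<bullet> b) = f b x"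
    unfolding P_def by blast+
  have "AE x in lebesgue. \<forall>b\<in>Basis. indicator \<Omega> x * (G x \<bullet> b) = f b x"
    using f(2) by (intro AE_finite_allI) auto
  then have "AE x in lebesgue. indicator \<Omega> x *\<^sub>R G x = (\<Sum>b\<in>Basis. f b x *\<^sub>R b)"
  proof eventually_elim
    case (elim x)
    have "indicator \<Omega> x *\<^sub>R G x = (\<Sum>b\<in>Basis. ((indicator \<Omega> x *\<^sub>R G x) \<bullet> b) *\<^sub>R b)"
      by (rule euclidean_representation[symmetric])
    also have "\<dots> = (\<Sum>b\<in>Basis. f b x *\<^sub>R b)" using elim by (intro sum.cong) auto
    finally show ?case .
  qed
  then show ?thesis using f(1) by (intro bexI[of _ "\<lambda>x. \<Sum>b\<in>Basis. f b x *\<^sub>R b"]) auto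
qed

lemma integral_lebesgue_on_eq_lborel:
  fixes f h :: "'a::euclidean_space \<Rightarrow> real"
  assumes \<Omega>: "\<Omega> \<in> sets lebesgue" and h: "h \<in> borel_measurable borel"
    and ae: "AE x in lebesgue. indicator \<Omega> x * f x = h x"
    and f: "f \<in> borel_measurable (lebesgue_on \<Omega>)"
  shows "(LINT x|lebesgue_on \<Omega>. f x) = (\<integral>x. h x \<partial>lborel)"
proof -
  have fm: "(\<lambda>x. indicator \<Omega> x *\<^sub>R f x) \<in> borel_measurable lebesgue"
    using f \<Omega> by (subst (asm) borel_measurable_restrict_space_iff) auto
  have "(LINT x|lebesgue_on \<Omega>. f x) = (\<integral>x. indicator \<Omega> x *\<^sub>R f x \<partial>lebesgue)"
    using \<Omega> by (intro integral_restrict_space) auto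
  also have "\<dots> = (\<integral>x. h x \<partial>lebesgue)"
    using ae fm h by (intro integral_cong_AE) (auto simp: measurable_completion)
  also have "\<dots> = (\<integral>x. h x \<partial>lborel)" using h by (intro integral_completion) auto
  finally show ?thesis .
qed

lemma test_function_borel:
  assumes "test_function \<Omega> \<phi>"
  shows "\<phi> \<in> borel_measurable borel" "b \<in> Basis \<Longrightarrow> partial_deriv b \<phi> \<in> borel_measurable borel"
proof -
  have "Ck 0 \<phi>" "Ck (Suc 0) \<phi>" using assms unfolding test_function_def by blast+
  then show "\<phi> \<in> borel_measurable borel" "b \<in> Basis \<Longrightarrow> partial_deriv b \<phi> \<in> borel_measurable borel"
    by (auto intro: borel_measurable_continuous_onI)
qed

lemma borel_measurable_lebesgue_on_of_borel:
  "f \<in> borel_measurable borel \<Longrightarrow> f \<in> borel_measurable (lebesgue_on \<Omega>)"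
  by (intro measurable_restrict_space1 measurable_completion) simp

lemma loc_integrable_borel_representative:
  fixes f :: "'a::euclidean_space \<Rightarrow> 'b::euclidean_space"
  assumes loc: "loc_integrable \<Omega> f" and f': "f' \<in> borel_measurable borel"
    and ae: "AE x in lebesgue. indicator \<Omega> x *\<^sub>R f x = f' x" and K: "compact K" "K \<subseteq> \<Omega>"
  shows "integrable lborel (\<lambda>x. indicator K x *\<^sub>R f' x)"
proof -
  have Kb[measurable]: "K \<in> sets borel" using K by (simp add: borel_compact)
  note [measurable] = f'
  have "integrable (lebesgue_on K) f" using loc K by (simp add: loc_integrable_def)
  then have i: "integrable lebesgue (\<lambda>x. indicator K x *\<^sub>R f x)"
    using Kb by (subst (asm) integrable_restrict_space) auto
  have m: "(\<lambda>x. indicator K x *\<^sub>R f' x) \<in> borel_measurable lborel" by measurable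
  have "AE x in lebesgue. indicator K x *\<^sub>R f x = indicator K x *\<^sub>R f' x"
    using ae by eventually_elim (use K in \<open>auto simp: indicator_def split: if_splits\<close>)
  then have "integrable lebesgue (\<lambda>x. indicator K x *\<^sub>R f' x)"
    using i m by (subst integrable_cong_AE[where g = "\<lambda>x. indicator K x *\<^sub>R f x"]) (auto simp: measurable_completion elim: eventually_mono)
  then show ?thesis using m by (subst (asm) integrable_completion) auto
qed

lemma weak_gradient_borel_representative:
  fixes \<Omega> :: "'a::euclidean_space set"
  assumes \<Omega>: "open \<Omega>" and wg: "weak_gradient \<Omega> u G"
    and um: "u \<in> borel_measurable (lebesgue_on \<Omega>)" and Gm: "G \<in> borel_measurable (lebesgue_on \<Omega>)"
  shows "\<exists>u' G'. borel_gradient \<Omega> u' G' \<and> (AE x in lebesgue. indicator \<Omega> x * u x = u' x) \<and>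
    (AE x in lebesgue. indicator \<Omega> x *\<^sub>R G x = G' x)"
proof -
  have \<Omega>l: "\<Omega> \<in> sets lebesgue" using \<Omega> by simp
  obtain u' where u': "u' \<in> borel_measurable borel" "AE x in lebesgue. indicator \<Omega> x * u x = u' x"
    using lebesgue_on_borel_representative[OF \<Omega>l um] by blast
  obtain G' where G': "G' \<in> borel_measurable borel" "AE x in lebesgue. indicator \<Omega> x *\<^sub>R G x = G' x"
    using lebesgue_on_borel_representative_vector[OF \<Omega>l Gm] by blast
  have "borel_gradient \<Omega> u' G'"
    unfolding borel_gradient_def
  proof (intro conjI allI impI; (elim conjE)?)
    show "u' \<in> borel_measurable borel" "G' \<in> borel_measurable borel" by fact+
  next
    fix K :: "'a set" assume K: "compact K" "K \<subseteq> \<Omega>"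
    show "integrable lborel (\<lambda>x. indicator K x * u' x)"
      using loc_integrable_borel_representative[of \<Omega> u u' K] wg u' K by (simp add: weak_gradient_def)
    show "integrable lborel (\<lambda>x. indicator K x *\<^sub>R G' x)"
      using loc_integrable_borel_representative[of \<Omega> G G' K] wg G' K by (simp add: weak_gradient_def)
  next
    fix \<phi> b assume \<phi>: "test_function \<Omega> \<phi>" and b: "b \<in> (Basis :: 'a set)"
    note tb = test_function_borel(1)[OF \<phi>] test_function_borel(2)[OF \<phi> b]
    note tl = tb[THEN borel_measurable_lebesgue_on_of_borel, of \<Omega>]
    have "(\<integral>x. u' x * partial_deriv b \<phi> x \<partial>lborel) = (LINT x|lebesgue_on \<Omega>. u x * partial_deriv b \<phi> x)"
    proof (rule integral_lebesgue_on_eq_lborel[OF \<Omega>l, symmetric])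
      show "AE x in lebesgue. indicator \<Omega> x * (u x * partial_deriv b \<phi> x) = u' x * partial_deriv b \<phi> x"
        using u'(2) by eventually_elim (simp add: mult.assoc[symmetric])
    qed (use u'(1) tb tl um in auto)
    also have "\<dots> = - (LINT x|lebesgue_on \<Omega>. (G x \<bullet> b) * \<phi> x)"
      using wg \<phi> b unfolding weak_gradient_def by blast
    also have "(LINT x|lebesgue_on \<Omega>. (G x \<bullet> b) * \<phi> x) = (\<integral>x. (G' x \<bullet> b) * \<phi> x \<partial>lborel)"
    proof (rule integral_lebesgue_on_eq_lborel[OF \<Omega>l])
      show "AE x in lebesgue. indicator \<Omega> x * ((G x \<bullet> b) * \<phi> x) = (G' x \<bullet> b) * \<phi> x"
        using G'(2)
      proof eventually_elim
        case (elim x)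
        then show ?case by (simp add: elim[symmetric] mult.assoc)
      qed
    qed (use G'(1) tb tl Gm in auto)
    finally show "(\<integral>x. u' x * partial_deriv b \<phi> x \<partial>lborel) = - (\<integral>x. (G' x \<bullet> b) * \<phi> x \<partial>lborel)" .
  qed
  then show ?thesis using u'(2) G'(2) by blast
qed

lemma nn_integral_lebesgue_on_eq_lborel:
  fixes h k :: "'a::euclidean_space \<Rightarrow> ennreal"
  assumes \<Omega>: "\<Omega> \<in> sets borel" and k: "k \<in> borel_measurable borel"
    and ae: "AE x in lebesgue. x \<in> \<Omega> \<longrightarrow> h x = k x"
  shows "(\<integral>\<^sup>+x. h x \<partial>lebesgue_on \<Omega>) = (\<integral>\<^sup>+x. indicator \<Omega> x * k x \<partial>lborel)"
proof -
  note [measurable] = \<Omega> k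
  have "(\<integral>\<^sup>+x. h x \<partial>lebesgue_on \<Omega>) = (\<integral>\<^sup>+x. h x * indicator \<Omega> x \<partial>lebesgue)"
    using \<Omega> by (intro nn_integral_restrict_space) auto
  also have "\<dots> = (\<integral>\<^sup>+x. indicator \<Omega> x * k x \<partial>lebesgue)"
    by (rule nn_integral_cong_AE) (use ae in \<open>eventually_elim, auto split: split_indicator\<close>)
  also have "\<dots> = (\<integral>\<^sup>+x. indicator \<Omega> x * k x \<partial>lborel)"
    by (rule nn_integral_completion)
  finally show ?thesis .
qed

section \<open>The entropy inequality\<close>

lemma poincare_sobolev_weak_gradient:
  fixes \<Omega> :: "'a::euclidean_space set"
  assumes dom: "bounded_lipschitz_domain \<Omega>" and n: "real DIM('a) \<le> n" "2 < n"
  defines "r \<equiv> 2 * n / (n - 2)"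
  shows "\<exists>C>0. \<forall>u G D. u \<in> borel_measurable (lebesgue_on \<Omega>) \<and> weak_gradient \<Omega> u G \<and> in_Lp \<Omega> 2 G \<and> 0 < D \<and>
      (LINT x|lebesgue_on \<Omega>. (norm (G x))\<^sup>2) \<le> D\<^sup>2 \<longrightarrow>
    (\<exists>c. integrable (lebesgue_on \<Omega>) (\<lambda>x. \<bar>u x - c\<bar> powr r) \<and>
      (LINT x|lebesgue_on \<Omega>. \<bar>u x - c\<bar> powr r) \<le> (C * D) powr r)"
proof -
  have op: "open \<Omega>" using dom by (simp add: bounded_lipschitz_domain_def)
  then have \<Omega>b[measurable]: "\<Omega> \<in> sets borel" by simp
  have r: "0 < r" using n by (simp add: r_def)
  obtain C0 where C0: "0 \<le> C0" and P: "\<And>u G D. borel_gradient \<Omega> u G \<Longrightarrow> 0 < D \<Longrightarrow>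
    (\<integral>\<^sup>+x. indicator \<Omega> x * (ennreal (norm (G x)))\<^sup>2 \<partial>lborel) \<le> ennreal (D\<^sup>2) \<Longrightarrow>
    \<exists>c. (\<integral>\<^sup>+x. indicator \<Omega> x * ennreal (\<bar>u x - c\<bar> powr r) \<partial>lborel) \<le> ennreal (C0 * D powr r)"
    using poincare_on_lipschitz_domain[OF dom n] unfolding poincare_on_def r_def[symmetric] by blast
  define C where "C = (C0 + 1) powr (1/r)"
  have C: "0 < C" "C powr r = C0 + 1" using C0 r by (auto simp: C_def powr_powr)
  have "\<exists>c. integrable (lebesgue_on \<Omega>) (\<lambda>x. \<bar>u x - c\<bar> powr r) \<and>
      (LINT x|lebesgue_on \<Omega>. \<bar>u x - c\<bar> powr r) \<le> (C * D) powr r"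
    if um: "u \<in> borel_measurable (lebesgue_on \<Omega>)" and wg: "weak_gradient \<Omega> u G" and G2: "in_Lp \<Omega> 2 G"
      and D: "0 < D" and E: "(LINT x|lebesgue_on \<Omega>. (norm (G x))\<^sup>2) \<le> D\<^sup>2" for u G D
  proof -
    have Gm: "G \<in> borel_measurable (lebesgue_on \<Omega>)" using G2 by (simp add: in_Lp_def)
    have Gi: "integrable (lebesgue_on \<Omega>) (\<lambda>x. (norm (G x))\<^sup>2)" using G2 by (simp add: in_Lp_def)
    obtain u' G' where bg: "borel_gradient \<Omega> u' G'" and u': "AE x in lebesgue. indicator \<Omega> x * u x = u' x"
      and G': "AE x in lebesgue. indicator \<Omega> x *\<^sub>R G x = G' x"
      using weak_gradient_borel_representative[OF op wg um Gm] by blast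
    have [measurable]: "u' \<in> borel_measurable borel" "G' \<in> borel_measurable borel"
      using bg by (auto simp: borel_gradient_def)
    have "(\<integral>\<^sup>+x. indicator \<Omega> x * (ennreal (norm (G' x)))\<^sup>2 \<partial>lborel) = (\<integral>\<^sup>+x. ennreal ((norm (G x))\<^sup>2) \<partial>lebesgue_on \<Omega>)"
    proof (rule nn_integral_lebesgue_on_eq_lborel[OF \<Omega>b, symmetric])
      show "AE x in lebesgue. x \<in> \<Omega> \<longrightarrow> ennreal ((norm (G x))\<^sup>2) = (ennreal (norm (G' x)))\<^sup>2"
        using G' by eventually_elim (auto simp: ennreal_power)
    qed measurable
    also have "\<dots> = ennreal (LINT x|lebesgue_on \<Omega>. (norm (G x))\<^sup>2)"
      using Gi by (intro nn_integral_eq_integral) auto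
    also have "\<dots> \<le> ennreal (D\<^sup>2)" using E by (rule ennreal_leI)
    finally obtain c where c: "(\<integral>\<^sup>+x. indicator \<Omega> x * ennreal (\<bar>u' x - c\<bar> powr r) \<partial>lborel) \<le> ennreal (C0 * D powr r)"
      using P[OF bg D] by blast
    have "(\<integral>\<^sup>+x. ennreal (\<bar>u x - c\<bar> powr r) \<partial>lebesgue_on \<Omega>) = (\<integral>\<^sup>+x. indicator \<Omega> x * ennreal (\<bar>u' x - c\<bar> powr r) \<partial>lborel)"
    proof (rule nn_integral_lebesgue_on_eq_lborel[OF \<Omega>b])
      show "AE x in lebesgue. x \<in> \<Omega> \<longrightarrow> ennreal (\<bar>u x - c\<bar> powr r) = ennreal (\<bar>u' x - c\<bar> powr r)"
        using u' by eventually_elim auto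
    qed measurable
    then have le: "(\<integral>\<^sup>+x. ennreal (\<bar>u x - c\<bar> powr r) \<partial>lebesgue_on \<Omega>) \<le> ennreal (C0 * D powr r)" using c by simp
    have int: "integrable (lebesgue_on \<Omega>) (\<lambda>x. \<bar>u x - c\<bar> powr r)"
      using um le by (intro integrableI_nonneg) (auto intro: le_less_trans)
    then have "ennreal (LINT x|lebesgue_on \<Omega>. \<bar>u x - c\<bar> powr r) \<le> ennreal (C0 * D powr r)"
      using le by (subst nn_integral_eq_integral[symmetric]) auto
    then have "(LINT x|lebesgue_on \<Omega>. \<bar>u x - c\<bar> powr r) \<le> C0 * D powr r"
      using C0 by (subst (asm) ennreal_le_iff) auto
    also have "\<dots> \<le> (C * D) powr r" unfolding powr_mult C(2) by (intro mult_right_mono) auto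
    finally show ?thesis using int by blast
  qed
  then show ?thesis using C(1) by blast
qed

text \<open>
In dimension at least \<open>3\<close> the dimension itself is the right parameter and \<open>2 n / (n - 2)\<close> is the critical
Sobolev exponent; the hypothesis on \<open>s\<close> says exactly that \<open>q / s\<close> does not exceed it, strictly for
\<open>q = 1\<close>. In dimensions \<open>1\<close> and \<open>2\<close> the exponent can be made as large as desired by taking \<open>n\<close>
slightly above \<open>2\<close>; the choice below makes it \<open>q / s + 3\<close>.
\<close>

lemma sobolev_exponent_exists:
  fixes q s d :: real
  assumes s: "0 < s" and d: "1 \<le> d"
    and qs: "(q = 1 \<and> s > q * (d - 2) / (2 * d)) \<or> (q > 1 \<and> s \<ge> q * (d - 2) / (2 * d))"
  shows "\<exists>n. d \<le> n \<and> 2 < n \<and> 2 \<le> 2 * n / (n - 2) \<and>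
    ((q = 1 \<and> q / s < 2 * n / (n - 2)) \<or> (1 < q \<and> q / s \<le> 2 * n / (n - 2)))"
proof (cases "2 < d")
  case True
  then have "q = 1 \<and> q / s < 2 * d / (d - 2) \<or> 1 < q \<and> q / s \<le> 2 * d / (d - 2)"
    using qs s by (auto simp: field_simps)
  moreover have "2 \<le> 2 * d / (d - 2)" using True by (simp add: field_simps)
  ultimately show ?thesis using True by (intro exI[of _ d]) auto
next
  case False
  have q: "0 < q / s" using qs s by auto
  define n where "n = 2 + 4 / (q / s + 1)"
  have n2: "n - 2 = 4 / (q / s + 1)" "2 < n" using q by (auto simp: n_def)
  have "2 * n / (n - 2) = 2 + 4 / (n - 2)" using n2(2) by (simp add: field_simps)
  also have "\<dots> = q / s + 3" unfolding n2(1) using q by simp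
  finally show ?thesis using False n2(2) qs q by (intro exI[of _ n]) auto
qed

theorem theorem2:
  fixes \<Omega> :: "'a::euclidean_space set" and q s :: real
  assumes "bounded_lipschitz_domain \<Omega>"
    and "s > 0"
    and "(q = 1 \<and> s > q * (real DIM('a) - 2) / (2 * real DIM('a))) \<or>
         (q > 1 \<and> s \<ge> q * (real DIM('a) - 2) / (2 * real DIM('a)))"
  shows "\<exists>C>0. \<forall>(g :: 'a \<Rightarrow> real) (G :: 'a \<Rightarrow> 'a).
    (AE x in lebesgue_on \<Omega>. 0 \<le> g x) \<and> in_Lp \<Omega> q g \<and>
    weak_gradient \<Omega> (\<lambda>x. g x powr s) G \<and> in_Lp \<Omega> 2 G \<longrightarrow>
      integrable (lebesgue_on \<Omega>) (\<lambda>x. eta q (g x) (mean_value \<Omega> g)) \<and>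
      (LINT x|lebesgue_on \<Omega>. eta q (g x) (mean_value \<Omega> g))
        \<le> C * Lp_norm \<Omega> q g powr (q - 2 * s) * (LINT x|lebesgue_on \<Omega>. (norm (G x))\<^sup>2)"
proof -
  let ?M = "lebesgue_on \<Omega>"
  obtain n where n: "real DIM('a) \<le> n" "2 < n" and r: "2 \<le> 2 * n / (n - 2)"
    "(q = 1 \<and> q / s < 2 * n / (n - 2)) \<or> (1 < q \<and> q / s \<le> 2 * n / (n - 2))"
    using sobolev_exponent_exists[OF assms(2) _ assms(3)] by auto
  define r where "r = 2 * n / (n - 2)"
  have r0: "0 < r" using r(1) by (simp add: r_def)
  have op: "open \<Omega>" and bd: "bounded \<Omega>" and ne: "\<Omega> \<noteq> {}" using assms(1) by (auto simp: bounded_lipschitz_domain_def)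
  have \<Omega>l: "\<Omega> \<in> sets lebesgue" using op by simp
  have lm: "\<Omega> \<in> lmeasurable" using op bd by (simp add: lmeasurable_open)
  have fin: "finite_measure ?M" using lm by (rule finite_measure_lebesgue_on)
  have mass: "measure ?M (space ?M) = measure lebesgue \<Omega>" using \<Omega>l by (simp add: measure_restrict_space)
  have pos: "0 < measure ?M (space ?M)"
  proof -
    obtain x e where "0 < e" "ball x e \<subseteq> \<Omega>" using op ne openE by blast
    then have "measure lebesgue (ball x e) \<le> measure lebesgue \<Omega>" using lm by (intro measure_mono_fmeasurable) auto
    moreover have "0 < measure lebesgue (ball x e)" using content_ball_pos[OF \<open>0 < e\<close>, of x] by simp
    ultimately show ?thesis unfolding mass by linarith
  qed
  obtain C1 where C1: "C1 > 0" and entropy: "\<And>g c D. g \<in> borel_measurable ?M \<Longrightarrow> (\<And>x. 0 \<le> g x) \<Longrightarrow>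
      integrable ?M (\<lambda>x. g x powr q) \<Longrightarrow> 0 \<le> c \<Longrightarrow> 0 < D \<Longrightarrow> integrable ?M (\<lambda>x. \<bar>g x powr s - c\<bar> powr r) \<Longrightarrow>
      (\<integral>x. \<bar>g x powr s - c\<bar> powr r \<partial>?M) \<le> D powr r \<Longrightarrow>
    integrable ?M (\<lambda>x. eta q (g x) ((\<integral>x. g x \<partial>?M) / measure ?M (space ?M))) \<and>
    (\<integral>x. eta q (g x) ((\<integral>x. g x \<partial>?M) / measure ?M (space ?M)) \<partial>?M) \<le>
      C1 * ((\<integral>x. g x powr q \<partial>?M) powr (1/q)) powr (q - 2 * s) * D\<^sup>2"
    using entropy_inequality[OF fin pos assms(2) r] unfolding r_def by blast
  obtain C2 where C2: "C2 > 0" and sobolev: "\<And>u G D. u \<in> borel_measurable ?M \<Longrightarrow> weak_gradient \<Omega> u G \<Longrightarrow> in_Lp \<Omega> 2 G \<Longrightarrow>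
      0 < D \<Longrightarrow> (LINT x|?M. (norm (G x))\<^sup>2) \<le> D\<^sup>2 \<Longrightarrow>
    \<exists>c. integrable ?M (\<lambda>x. \<bar>u x - c\<bar> powr r) \<and> (LINT x|?M. \<bar>u x - c\<bar> powr r) \<le> (C2 * D) powr r"
    using poincare_sobolev_weak_gradient[OF assms(1) n] unfolding r_def by blast
  have main: "integrable ?M (\<lambda>x. eta q (g x) (mean_value \<Omega> g)) \<and>
      (LINT x|?M. eta q (g x) (mean_value \<Omega> g))
        \<le> (C1 * C2\<^sup>2) * Lp_norm \<Omega> q g powr (q - 2 * s) * (LINT x|?M. (norm (G x))\<^sup>2)"
    if g0: "AE x in ?M. 0 \<le> g x" and gq: "in_Lp \<Omega> q g" and wg: "weak_gradient \<Omega> (\<lambda>x. g x powr s) G" and G2: "in_Lp \<Omega> 2 G"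
    for g :: "'a \<Rightarrow> real" and G :: "'a \<Rightarrow> 'a"
  proof -
    define h where "h = (\<lambda>x. max 0 (g x))"
    have gm[measurable]: "g \<in> borel_measurable ?M" using gq by (simp add: in_Lp_def)
    have hm[measurable]: "h \<in> borel_measurable ?M" unfolding h_def by measurable
    have hg: "AE x in ?M. h x = g x" using g0 by eventually_elim (simp add: h_def)
    have q_eq: "(LINT x|?M. norm (g x) powr q) = (LINT x|?M. h x powr q)"
      using hg by (intro integral_cong_AE) (auto simp: h_def)
    have hq: "integrable ?M (\<lambda>x. h x powr q)"
    proof -
      have "AE x in ?M. norm (g x) powr q = h x powr q" using hg by eventually_elim (auto simp: h_def)
      then show ?thesis using gq unfolding in_Lp_def by (subst integrable_cong_AE[where g = "\<lambda>x. norm (g x) powr q"]) auto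
    qed
    have mean: "mean_value \<Omega> g = (\<integral>x. h x \<partial>?M) / measure ?M (space ?M)"
    proof -
      have "(LINT x|?M. g x) = (LINT x|?M. h x)" using hg by (intro integral_cong_AE) (auto elim: eventually_mono)
      then show ?thesis unfolding mean_value_def mass by simp
    qed
    have eta_meas: "(\<lambda>x. eta q (k x) m) \<in> borel_measurable ?M" if "k \<in> borel_measurable ?M" for k m
      using that unfolding eta_def by measurable
    have eta_eq: "AE x in ?M. eta q (h x) m = eta q (g x) m" for m using hg by eventually_elim simp
    define E where "E = (LINT x|?M. (norm (G x))\<^sup>2)"
    have E0: "0 \<le> E" unfolding E_def by simp
    define N where "N = Lp_norm \<Omega> q g powr (q - 2 * s)"
    \<comment> \<open>The Sobolev and entropy inequalities ask for a positive \<open>D\<close>, while the energy may vanish; hence the detour through all \<open>D\<close> above its root.\<close>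
    have bound: "integrable ?M (\<lambda>x. eta q (g x) (mean_value \<Omega> g)) \<and>
      (LINT x|?M. eta q (g x) (mean_value \<Omega> g)) \<le> (C1 * C2\<^sup>2) * N * D\<^sup>2" if D: "sqrt E < D" for D
    proof -
      have D0: "0 < D" using D E0 by (meson le_less_trans real_sqrt_ge_zero)
      have "E = (sqrt E)\<^sup>2" using E0 by simp
      also have "\<dots> \<le> D\<^sup>2" using D E0 by (intro power_mono) auto
      finally obtain c where c: "integrable ?M (\<lambda>x. \<bar>g x powr s - c\<bar> powr r)"
        "(LINT x|?M. \<bar>g x powr s - c\<bar> powr r) \<le> (C2 * D) powr r"
        using sobolev[OF _ wg G2 D0] unfolding E_def by auto
      \<comment> \<open>As \<open>g\<close> is nonnegative, replacing \<open>c\<close> by its positive part does not increase the distance.\<close>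
      have le: "AE x in ?M. \<bar>h x powr s - max 0 c\<bar> powr r \<le> \<bar>g x powr s - c\<bar> powr r"
        using hg
      proof eventually_elim
        case (elim x)
        have "\<bar>g x powr s - max 0 c\<bar> \<le> \<bar>g x powr s - c\<bar>"
          using powr_ge_zero[of "g x" s] by (auto simp: max_def abs_if)
        then show ?case unfolding elim using r0 by (intro powr_mono2) auto
      qed
      have i: "integrable ?M (\<lambda>x. \<bar>h x powr s - max 0 c\<bar> powr r)"
        by (rule Bochner_Integration.integrable_bound[OF c(1)]) (use le in auto)
      have "(LINT x|?M. \<bar>h x powr s - max 0 c\<bar> powr r) \<le> (LINT x|?M. \<bar>g x powr s - c\<bar> powr r)"
        by (rule integral_mono_AE[OF i c(1) le])
      then have osc: "(LINT x|?M. \<bar>h x powr s - max 0 c\<bar> powr r) \<le> (C2 * D) powr r" using c(2) by simp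
      have "0 < C2 * D" using C2 D0 by simp
      from entropy[OF hm _ hq _ this i osc]
      have res: "integrable ?M (\<lambda>x. eta q (h x) (mean_value \<Omega> g))"
        "(LINT x|?M. eta q (h x) (mean_value \<Omega> g)) \<le> C1 * ((\<integral>x. h x powr q \<partial>?M) powr (1/q)) powr (q - 2 * s) * (C2 * D)\<^sup>2"
        unfolding mean by (auto simp: h_def)
      have "integrable ?M (\<lambda>x. eta q (g x) (mean_value \<Omega> g))"
        using res(1) eta_eq eta_meas[OF hm] eta_meas[OF gm] by (subst (asm) integrable_cong_AE) auto
      moreover have "(LINT x|?M. eta q (g x) (mean_value \<Omega> g)) = (LINT x|?M. eta q (h x) (mean_value \<Omega> g))"
        by (rule integral_cong_AE[OF eta_meas[OF hm] eta_meas[OF gm] eta_eq, symmetric])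
      moreover have "C1 * ((\<integral>x. h x powr q \<partial>?M) powr (1/q)) powr (q - 2 * s) * (C2 * D)\<^sup>2 = (C1 * C2\<^sup>2) * N * D\<^sup>2"
        unfolding N_def Lp_norm_def q_eq by (simp add: power_mult_distrib)
      ultimately show ?thesis using res(2) by (simp only: simp_thms)
    qed
    have "((\<lambda>D. (C1 * C2\<^sup>2) * N * D\<^sup>2) \<longlongrightarrow> (C1 * C2\<^sup>2) * N * (sqrt E)\<^sup>2) (at_right (sqrt E))"
      by (intro tendsto_intros)
    then have "(LINT x|?M. eta q (g x) (mean_value \<Omega> g)) \<le> (C1 * C2\<^sup>2) * N * (sqrt E)\<^sup>2"
      by (rule tendsto_lowerbound) (auto intro!: eventually_at_rightI[of "sqrt E" "sqrt E + 1"] conjunct2[OF bound])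
    then show ?thesis using conjunct1[OF bound[of "sqrt E + 1"]] E0 by (simp add: N_def E_def)
  qed
  show ?thesis using C1 C2 main by (intro exI[of _ "C1 * C2\<^sup>2"]) auto
qed



end
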